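(* A minimum-size set of input nodes satisfying structural controllability, where this problem is formulated as $$\text{maximize}\ \{|R|:\ R\in\mathcal{M}_1^{\ast},\ R\in\mathcal{M}_2^{\ast}\},\qquad S=V\setminus R,$$ can be obtained in time polynomial in $n$.
   Context: **System.** $V=\{1,\dots,n\}$ indexes the states of $F\dot{\mathbf{x}}(t)=A\mathbf{x}(t)$, where $F=Q_F+T_F$, $A=Q_A+T_A$ are $n\times n$; $Q_F,Q_A$ are known fixed real matrices and $T_F,T_A$ are structure matrices: their nonzero entries are independent free parameters that can take any real value. The system is assumed solvable: for every initial state there is a unique trajectory. $S\subseteq V$ is the input set (the states $x_i$, $i\in S$, are set directly equal to control inputs) and $R=V\setminus S$. $T_B(S)$ is the $n\times n$ diagonal matrix with a free parameter in the $i$-th diagonal entry for $i\in S$ and zeros elsewhere. Membership of $R$ in both $\mathcal{M}_1^{\ast}$ and $\mathcal{M}_2^{\ast}$ (independence in both) is the paper's condition guaranteeing structural controllability from $S=V\setminus R$. **Matroid $\mathcal{M}_1$.** $\mathcal{M}([I|Q_A|0])$ and $\mathcal{M}([I|T_A|T_B(S)])$ denote the linear matroids on the common set of $3n$ column indices (free parameters algebraically independent), and $\vee$ is matroid union. Put $\rho_1(S)=\mathrm{rank}(\mathcal{M}([I|Q_A|0])\vee\mathcal{M}([I|T_A|T_B(S)]))-\mathrm{rank}(\mathcal{M}([I|Q_A])\vee\mathcal{M}([I|T_A]))$. This is the rank function of a matroid $\mathcal{M}_1$ on $V$; $\mathcal{M}_1^{\ast}$ is its dual. **Auxiliary graph $G'$.**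 Let $\Omega=\begin{pmatrix}Q_A-Q_F\\ I\end{pmatrix}$, with rows indexed $w_1,\dots,w_n,x_1,\dots,x_n$. Say $(i,j)\in T$ if the $(i,j)$ entry of $T_A$ or $T_F$ is nonzero. Let $H$ be the bipartite graph with sides $\{w_i^T\}$ and $\{w_i^Q\}\cup\{x_i^Q\}$ and edges $(w_i^T,w_i^Q)$ for all $i$, and $(w_i^T,x_j^Q)$ for $(i,j)\in T$. By solvability there is a matching $m$ of $H$ matching all $w_i^T$ such that the rows in $J=\{w_i:m(w_i^T)=w_i^Q\}\cup\{x_j: m(w_i^T)=x_j^Q\text{ for some }i\}$ are linearly independent in $\Omega$; fix such an $m$. Let $\Omega_J$ be the submatrix of rows $J$ and $\tilde\Omega=\Omega\Omega_J^{-1}$, with columns indexed by $J$. $G'=(V',E')$ is the directed graph with vertices $w_i^T,w_i^Q,x_i^T,x_i^Q$ ($i=1,\dots,n$) and edges: $w_i^T\to x_j^Q$ if $(i,j)\in T$, $m(w_i^T)\ne x_j^Q$; $x_j^Q\to w_i^T$ if $(i,j)\in T$, $m(w_i^T)=x_j^Q$; $w_i^T\to w_i^Q$ if $m(w_i^T)\neq w_i^Q$; $w_i^Q\to w_i^T$ if $m(w_i^T)=w_i^Q$; $a^Q\to b^Q$ for $a\notin J$, $b\in J$, $\tilde\Omega_{ab}\ne0$. **Matroid $\mathcal{M}_2$.** Let $\overline{V}'$ be the set of strongly connected components of $G'$ with no outgoing edge to another component. Identifying $i\in V$ with $w_i^T$, set $\rho_2(S)=|\{C\in\overline{V}': C\cap\{w_i^T:i\in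 S\}\neq\emptyset\}|$. This is the rank function of a matroid $\mathcal{M}_2$ on $V$; $\mathcal{M}_2^{\ast}$ is its dual. *)

theory Defs
  imports
    "HOL-Analysis.Analysis"
    "HOL-Library.Poly_Mapping"
    "HOL-Computational_Algebra.Fraction_Field"
    "Jordan_Normal_Form.VS_Connect"
    "Jordan_Normal_Form.Gauss_Jordan_Elimination"
    "Graph_Theory.Graph_Theory"
begin

section \<open>Structured descriptor systems\<close>

text \<open>
  States are numbered \<open>0, \<dots>, n - 1\<close>. A structure matrix is given by the set of positions of its
  free parameters.
\<close>

record descriptor_system =
  dim :: nat
  QF :: "real mat"
  QA :: "real mat"
  TF :: "(nat \<times> nat) set"
  TA :: "(nat \<times> nat) set"

definition states :: "descriptor_system \<Rightarrow> nat set" where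
  "states sys = {0..<dim sys}"

definition wf_system :: "descriptor_system \<Rightarrow> bool" where
  "wf_system sys \<longleftrightarrow> 1 \<le> dim sys
     \<and> QF sys \<in> carrier_mat (dim sys) (dim sys) \<and> QA sys \<in> carrier_mat (dim sys) (dim sys)
     \<and> TF sys \<subseteq> states sys \<times> states sys \<and> TA sys \<subseteq> states sys \<times> states sys"

definition realizations :: "nat \<Rightarrow> (nat \<times> nat) set \<Rightarrow> real mat set" where
  "realizations n T = {M \<in> carrier_mat n n. \<forall>i<n. \<forall>j<n. (i, j) \<notin> T \<longrightarrow> M $$ (i, j) = 0}"

definition trajectory :: "nat \<Rightarrow> real mat \<Rightarrow> real mat \<Rightarrow> (real \<Rightarrow> real vec) \<Rightarrow> bool" where
  "trajectory n F A x \<longleftrightarrow> (\<forall>t\<ge>0. x t \<in> carrier_vec n)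
     \<and> (\<exists>x'. \<forall>t\<ge>0. x' t \<in> carrier_vec n
          \<and> (\<forall>i<n. ((\<lambda>s. x s $ i) has_real_derivative (x' t $ i)) (at t within {0..}))
          \<and> F *\<^sub>v x' t = A *\<^sub>v x t)"

text \<open>
  When \<open>F\<close> is singular the system contains algebraic constraints, and the possible initial states
  are those compatible with them, i.e.\ those from which some trajectory starts.
\<close>

definition initial_states :: "nat \<Rightarrow> real mat \<Rightarrow> real mat \<Rightarrow> real vec set" where
  "initial_states n F A = {x 0 | x. trajectory n F A x}"

definition solvable :: "nat \<Rightarrow> real mat \<Rightarrow> real mat \<Rightarrow> bool" where
  "solvable n F A \<longleftrightarrow> (\<forall>x0 \<in> initial_states n F A. \<exists>x. trajectory n F A x \<and> x 0 = x0
     \<and> (\<forall>y. trajectory n F A y \<and> y 0 = x0 \<longrightarrow> (\<forall>t\<ge>0. y t = x t)))"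

text \<open>
  As usual for structural properties, solvability is required for some values of the free
  parameters.
\<close>

definition structurally_solvable :: "descriptor_system \<Rightarrow> bool" where
  "structurally_solvable sys \<longleftrightarrow>
     (\<exists>F0 \<in> realizations (dim sys) (TF sys). \<exists>A0 \<in> realizations (dim sys) (TA sys).
        solvable (dim sys) (QF sys + F0) (QA sys + A0))"

section \<open>Matroids\<close>

text \<open>A matroid is represented by its family of independent sets.\<close>

definition family_rank :: "'a set set \<Rightarrow> nat" where
  "family_rank I = Max (card ` I)"

definition matroid_union :: "'a set set \<Rightarrow> 'a set set \<Rightarrow> 'a set set" where
  "matroid_union I1 I2 = {X \<union> Y | X Y. X \<in> I1 \<and> Y \<in> I2}"

definition bases :: "'a set set \<Rightarrow> 'a set set" where
  "bases I = {B \<in> I. \<forall>X \<in> I. B \<subseteq> X \<longrightarrow> X = B}"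

definition dual :: "'a set \<Rightarrow> 'a set set \<Rightarrow> 'a set set" where
  "dual V I = {X. X \<subseteq> V \<and> (\<exists>B \<in> bases I. X \<inter> B = {})}"

definition matroid_of_rank :: "'a set \<Rightarrow> ('a set \<Rightarrow> nat) \<Rightarrow> 'a set set" where
  "matroid_of_rank V \<rho> = {X. X \<subseteq> V \<and> \<rho> X = card X}"

text \<open>
  The vectors of a linear matroid are indexed, so two equal columns are dependent: this is what
  injectivity of \<open>col M\<close> expresses.
\<close>

definition linear_matroid :: "'a::field mat \<Rightarrow> nat set set" where
  "linear_matroid M = {J. J \<subseteq> {0..<dim_col M} \<and> inj_on (col M) J
     \<and> module.lin_indpt class_ring (module_vec TYPE('a) (dim_row M)) (col M ` J)}"

definition append_cols :: "'a::zero mat \<Rightarrow> 'a mat \<Rightarrow> 'a mat" (infixr \<open>@\<^sub>c\<close> 65) where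
  "A @\<^sub>c B = four_block_mat A B (0\<^sub>m 0 (dim_col A)) (0\<^sub>m 0 (dim_col B))"

section \<open>The matroid of the rank condition\<close>

text \<open>
  Rational functions over the reals in the indeterminates \<open>param 0, param 1, \<dots>\<close>. Distinct
  indeterminates play the role of algebraically independent free parameters.
\<close>

type_synonym ratfun = "((nat \<Rightarrow>\<^sub>0 nat) \<Rightarrow>\<^sub>0 real) fract"

definition param :: "nat \<Rightarrow> ratfun" where
  "param k = Fract (Poly_Mapping.single (Poly_Mapping.single k 1) 1) 1"

definition TA_mat :: "descriptor_system \<Rightarrow> ratfun mat" where
  "TA_mat sys = mat (dim sys) (dim sys)
     (\<lambda>(i, j). if (i, j) \<in> TA sys then param (i * dim sys + j) else 0)"

text \<open>The indices used here are disjoint from those used in \<^const>\<open>TA_mat\<close>.\<close>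

definition TB_mat :: "descriptor_system \<Rightarrow> nat set \<Rightarrow> ratfun mat" where
  "TB_mat sys S = mat (dim sys) (dim sys)
     (\<lambda>(i, j). if i = j \<and> i \<in> S then param (dim sys * dim sys + i) else 0)"

text \<open>The subtraction does not truncate: the second rank is at most the first.\<close>

definition rho1 :: "descriptor_system \<Rightarrow> nat set \<Rightarrow> nat" where
  "rho1 sys S = (let n = dim sys in
     family_rank (matroid_union
       (linear_matroid (1\<^sub>m n @\<^sub>c QA sys @\<^sub>c 0\<^sub>m n n))
       (linear_matroid (1\<^sub>m n @\<^sub>c TA_mat sys @\<^sub>c TB_mat sys S)))
     - family_rank (matroid_union
       (linear_matroid (1\<^sub>m n @\<^sub>c QA sys))
       (linear_matroid (1\<^sub>m n @\<^sub>c TA_mat sys))))"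

definition M1 :: "descriptor_system \<Rightarrow> nat set set" where
  "M1 sys = matroid_of_rank (states sys) (rho1 sys)"

section \<open>The auxiliary graph and its matroid\<close>

datatype node = WT nat | WQ nat | XT nat | XQ nat

definition pattern :: "descriptor_system \<Rightarrow> (nat \<times> nat) set" where
  "pattern sys = TA sys \<union> TF sys"

definition Omega :: "descriptor_system \<Rightarrow> real mat" where
  "Omega sys = (QA sys - QF sys) @\<^sub>r 1\<^sub>m (dim sys)"

definition Q_nodes :: "descriptor_system \<Rightarrow> node set" where
  "Q_nodes sys = WQ ` states sys \<union> XQ ` states sys"

text \<open>Row of \<^const>\<open>Omega\<close> belonging to a node of \<^const>\<open>Q_nodes\<close>.\<close>

fun row_index :: "descriptor_system \<Rightarrow> node \<Rightarrow> nat" where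
  "row_index sys (WQ i) = i"
| "row_index sys (XQ j) = dim sys + j"
| "row_index sys _ = undefined"

text \<open>
  A matching of all \<open>WT i\<close> is given by the function mapping \<open>i\<close> to the partner of \<open>WT i\<close>; it is
  admissible if the rows of its image \<open>J\<close> are linearly independent in \<^const>\<open>Omega\<close>.
\<close>

definition admissible_matching :: "descriptor_system \<Rightarrow> (nat \<Rightarrow> node) \<Rightarrow> bool" where
  "admissible_matching sys m \<longleftrightarrow>
     (\<forall>i \<in> states sys. m i = WQ i \<or> (\<exists>j. (i, j) \<in> pattern sys \<and> m i = XQ j))
     \<and> inj_on m (states sys)
     \<and> row_index sys ` m ` states sys \<in> linear_matroid (transpose_mat (Omega sys))"

text \<open>
  The columns of \<open>\<Omega> \<Omega>\<^sub>J\<^sup>-\<^sup>1\<close> are indexed by \<open>J\<close>; listing \<open>J\<close> as \<open>m 0, \<dots>, m (n - 1)\<close>, column \<open>i\<close> is the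
  one with index \<open>m i\<close>.
\<close>

definition Omega_J :: "descriptor_system \<Rightarrow> (nat \<Rightarrow> node) \<Rightarrow> real mat" where
  "Omega_J sys m =
     mat_of_rows (dim sys) (map (\<lambda>i. row (Omega sys) (row_index sys (m i))) [0..<dim sys])"

definition Omega_tilde :: "descriptor_system \<Rightarrow> (nat \<Rightarrow> node) \<Rightarrow> real mat" where
  "Omega_tilde sys m = Omega sys * the (mat_inverse (Omega_J sys m))"

definition aux_graph :: "descriptor_system \<Rightarrow> (nat \<Rightarrow> node) \<Rightarrow> node pair_pre_digraph" where
  "aux_graph sys m = \<lparr>
     pverts = WT ` states sys \<union> WQ ` states sys \<union> XT ` states sys \<union> XQ ` states sys,
     parcs =
       {(WT i, XQ j) | i j. (i, j) \<in> pattern sys \<and> m i \<noteq> XQ j}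
       \<union> {(XQ j, WT i) | i j. (i, j) \<in> pattern sys \<and> m i = XQ j}
       \<union> {(WT i, WQ i) | i. i \<in> states sys \<and> m i \<noteq> WQ i}
       \<union> {(WQ i, WT i) | i. i \<in> states sys \<and> m i = WQ i}
       \<union> {(a, m i) | a i. a \<in> Q_nodes sys \<and> a \<notin> m ` states sys \<and> i \<in> states sys
            \<and> Omega_tilde sys m $$ (row_index sys a, i) \<noteq> 0}\<rparr>"

definition sink_components :: "node pair_pre_digraph \<Rightarrow> node set set" where
  "sink_components G = {C \<in> pre_digraph.sccs_verts (with_proj G).
     \<not> (\<exists>u \<in> C. \<exists>v. v \<notin> C \<and> (u, v) \<in> parcs G)}"

definition rho2 :: "descriptor_system \<Rightarrow> (nat \<Rightarrow> node) \<Rightarrow> nat set \<Rightarrow> nat" where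
  "rho2 sys m S = card {C \<in> sink_components (aux_graph sys m). C \<inter> WT ` S \<noteq> {}}"

definition M2 :: "descriptor_system \<Rightarrow> (nat \<Rightarrow> node) \<Rightarrow> nat set set" where
  "M2 sys m = matroid_of_rank (states sys) (rho2 sys m)"

section \<open>Minimum input sets\<close>

definition optimal_input_set :: "descriptor_system \<Rightarrow> (nat \<Rightarrow> node) \<Rightarrow> nat set \<Rightarrow> bool" where
  "optimal_input_set sys m S \<longleftrightarrow> S \<subseteq> states sys
     \<and> is_arg_max card
         (\<lambda>R. R \<in> dual (states sys) (M1 sys) \<and> R \<in> dual (states sys) (M2 sys m))
         (states sys - S)"

section \<open>Computation model\<close>

text \<open>
  Since the input contains arbitrary real matrices, running time is measured in the real-number
  model (as for Blum--Shub--Smale machines): exact arithmetic and comparisons of reals have unit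
  cost. There is no rounding, and the only real constants in programs are 0 and 1, so programs are
  finite objects and cannot hide information in constants. Programs are first-order recursive
  functional programs over binary trees with real leaves. Every evaluation step has cost 1; building
  a cell is a single step because cells are shared, not copied. Primitives are totalized by \<open>Null\<close> on
  ill-typed arguments.
\<close>

datatype data = Null | Atom real | Cell data data

datatype prim1 = Head | Tail
datatype prim2 = Pair | Add | Sub | Mul | Div | Le

text \<open>\<open>Null\<close> is false, everything else is true. Quotients by 0 are 0, as for the type \<^typ>\<open>real\<close>.\<close>

fun apply1 :: "prim1 \<Rightarrow> data \<Rightarrow> data" where
  "apply1 Head (Cell a b) = a"
| "apply1 Tail (Cell a b) = b"
| "apply1 _ _ = Null"

fun apply2 :: "prim2 \<Rightarrow> data \<Rightarrow> data \<Rightarrow> data" where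
  "apply2 Pair a b = Cell a b"
| "apply2 Add (Atom x) (Atom y) = Atom (x + y)"
| "apply2 Sub (Atom x) (Atom y) = Atom (x - y)"
| "apply2 Mul (Atom x) (Atom y) = Atom (x * y)"
| "apply2 Div (Atom x) (Atom y) = Atom (x / y)"
| "apply2 Le (Atom x) (Atom y) = (if x \<le> y then Cell Null Null else Null)"
| "apply2 _ _ _ = Null"

text \<open>
  Variables are de Bruijn indices. \<open>Call f e\<close> calls the function number \<open>f\<close> of the program; its
  body sees only the argument, as variable 0.
\<close>

datatype expr =
    Var nat
  | NullE
  | Zero
  | One
  | Prim1 prim1 expr
  | Prim2 prim2 expr expr
  | If expr expr expr
  | LetIn expr expr
  | Call nat expr

type_synonym program = "expr list"

text \<open>\<open>evaluates P env e v t\<close>: in the environment \<open>env\<close>, \<open>e\<close> evaluates to \<open>v\<close> in \<open>t\<close> steps.\<close>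

inductive evaluates :: "program \<Rightarrow> data list \<Rightarrow> expr \<Rightarrow> data \<Rightarrow> nat \<Rightarrow> bool" for P where
  "i < length env \<Longrightarrow> evaluates P env (Var i) (env ! i) 1"
| "evaluates P env NullE Null 1"
| "evaluates P env Zero (Atom 0) 1"
| "evaluates P env One (Atom 1) 1"
| "evaluates P env e v t \<Longrightarrow> evaluates P env (Prim1 p e) (apply1 p v) (t + 1)"
| "evaluates P env e1 v1 t1 \<Longrightarrow> evaluates P env e2 v2 t2 \<Longrightarrow>
     evaluates P env (Prim2 p e1 e2) (apply2 p v1 v2) (t1 + t2 + 1)"
| "evaluates P env c b t1 \<Longrightarrow> b \<noteq> Null \<Longrightarrow> evaluates P env e1 v t2 \<Longrightarrow>
     evaluates P env (If c e1 e2) v (t1 + t2 + 1)"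
| "evaluates P env c Null t1 \<Longrightarrow> evaluates P env e2 v t2 \<Longrightarrow>
     evaluates P env (If c e1 e2) v (t1 + t2 + 1)"
| "evaluates P env e1 v1 t1 \<Longrightarrow> evaluates P (v1 # env) e2 v t2 \<Longrightarrow>
     evaluates P env (LetIn e1 e2) v (t1 + t2 + 1)"
| "evaluates P env e v1 t1 \<Longrightarrow> f < length P \<Longrightarrow> evaluates P [v1] (P ! f) v t2 \<Longrightarrow>
     evaluates P env (Call f e) v (t1 + t2 + 1)"

inductive_cases evaluates_elims:
  "evaluates P env (Var i) v t"
  "evaluates P env NullE v t"
  "evaluates P env Zero v t"
  "evaluates P env One v t"
  "evaluates P env (Prim1 p e) v t"
  "evaluates P env (Prim2 p e1 e2) v t"
  "evaluates P env (If c e1 e2) v t"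
  "evaluates P env (LetIn e1 e2) v t"
  "evaluates P env (Call f e) v t"

lemma evaluates_deterministic:
  "evaluates P env e v t \<Longrightarrow> evaluates P env e v' t' \<Longrightarrow> v' = v \<and> t' = t"
proof (induction arbitrary: v' t' rule: evaluates.induct)
  case (1 i env) from 1(2) show ?case by (rule evaluates_elims) simp
next case (2 env) from 2 show ?case by (rule evaluates_elims) simp
next case (3 env) from 3 show ?case by (rule evaluates_elims) simp
next case (4 env) from 4 show ?case by (rule evaluates_elims) simp
next case 5 from "5.prems" show ?case by (rule evaluates_elims) (auto dest!: "5.IH")
next case 6 from "6.prems" show ?case by (rule evaluates_elims) (auto dest!: "6.IH")
next case 7 from "7.prems" show ?case by (rule evaluates_elims) (auto dest!: "7.IH" simp: "7.hyps")
next case 8 from "8.prems" show ?case by (rule evaluates_elims) (auto dest!: "8.IH")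
next case 9 from "9.prems" show ?case by (rule evaluates_elims) (auto dest!: "9.IH")
next case 10 from "10.prems" show ?case by (rule evaluates_elims) (auto dest!: "10.IH")
qed

text \<open>Running a program means calling its function 0 on the input.\<close>

definition runs :: "program \<Rightarrow> data \<Rightarrow> data \<Rightarrow> nat \<Rightarrow> bool" where
  "runs P inp out t \<longleftrightarrow> evaluates P [inp] (Call 0 (Var 0)) out t"

fun list_data :: "data list \<Rightarrow> data" where
  "list_data [] = Null"
| "list_data (x # xs) = Cell x (list_data xs)"

definition mat_data :: "real mat \<Rightarrow> data" where
  "mat_data M = list_data (map (\<lambda>r. list_data (map Atom (list_of_vec r))) (rows M))"

definition pattern_data :: "nat \<Rightarrow> (nat \<times> nat) set \<Rightarrow> data" where
  "pattern_data n T = mat_data (mat n n (\<lambda>p. if p \<in> T then 1 else 0))"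

definition system_data :: "descriptor_system \<Rightarrow> data" where
  "system_data sys = list_data [mat_data (QF sys), mat_data (QA sys),
     pattern_data (dim sys) (TF sys), pattern_data (dim sys) (TA sys)]"

definition set_data :: "nat \<Rightarrow> nat set \<Rightarrow> data" where
  "set_data n S = list_data (map (\<lambda>i. Atom (if i \<in> S then 1 else 0)) [0..<n])"

end

theory Submission
  imports Defs "Jordan_Normal_Form.Determinant"
begin

definition indep :: "nat set \<Rightarrow> ('e \<Rightarrow> nat \<Rightarrow> 'a::field) \<Rightarrow> 'e set \<Rightarrow> bool" where
  "indep P v A \<longleftrightarrow> finite A \<and> (\<forall>c. (\<forall>p\<in>P. (\<Sum>a\<in>A. c a * v a p) = 0) \<longrightarrow> (\<forall>a\<in>A. c a = 0))"

lemma indep_finite: "indep P v A \<Longrightarrow> finite A"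
  by (simp add: indep_def)

lemma indepD: "indep P v A \<Longrightarrow> (\<And>p. p \<in> P \<Longrightarrow> (\<Sum>a\<in>A. c a * v a p) = 0) \<Longrightarrow> a \<in> A \<Longrightarrow> c a = 0"
  unfolding indep_def by blast

lemma dependent_if_card:
  fixes v :: "'e \<Rightarrow> nat \<Rightarrow> 'a::field"
  assumes "finite P" "finite A" "card P < card A"
  shows "\<exists>c. (\<forall>p\<in>P. (\<Sum>a\<in>A. c a * v a p) = 0) \<and> (\<exists>a\<in>A. c a \<noteq> 0)"
  using assms
proof (induction P arbitrary: A v rule: finite_induct)
  case empty
  then have "A \<noteq> {}" by auto
  then show ?case by (intro exI[of _ "\<lambda>_. 1"]) auto
next
  case (insert q P)
  show ?case
  proof (cases "\<forall>a\<in>A. v a q = 0")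
    case True
    obtain c where "\<forall>p\<in>P. (\<Sum>a\<in>A. c a * v a p) = 0" "\<exists>a\<in>A. c a \<noteq> 0"
      using insert.IH[of A v] insert.prems insert.hyps by auto
    then show ?thesis using True by (intro exI[of _ c]) auto
  next
    case False
    then obtain b where b: "b \<in> A" "v b q \<noteq> 0" by blast
    define A' where "A' = A - {b}"
    define w where "w a p = v a p - v a q / v b q * v b p" for a p
    have A: "A = insert b A'" "b \<notin> A'" "finite A'" using b insert.prems A'_def by auto
    have "card P < card A'" using insert.prems insert.hyps A by simp
    then obtain c where c: "\<forall>p\<in>P. (\<Sum>a\<in>A'. c a * w a p) = 0" "\<exists>a\<in>A'. c a \<noteq> 0"
      using insert.IH[of A' w] A by auto
    define s where "s = - (\<Sum>a\<in>A'. c a * v a q) / v b q"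
    define c' where "c' = c(b := s)"
    have sum: "(\<Sum>a\<in>A. c' a * v a p) = s * v b p + (\<Sum>a\<in>A'. c a * v a p)" for p
    proof -
      have "(\<Sum>a\<in>A'. c' a * v a p) = (\<Sum>a\<in>A'. c a * v a p)"
        using A(2) by (intro sum.cong) (auto simp: c'_def)
      then show ?thesis unfolding A(1) using A(2,3) by (simp add: c'_def)
    qed
    have "(\<Sum>a\<in>A. c' a * v a p) = 0" if p: "p \<in> insert q P" for p
    proof (cases "p = q")
      case True
      then show ?thesis using b by (simp add: sum s_def)
    next
      case False
      then have "0 = (\<Sum>a\<in>A'. c a * w a p)" using c p by auto
      also have "\<dots> = (\<Sum>a\<in>A'. c a * v a p) - (\<Sum>a\<in>A'. c a * v a q) / v b q * v b p"
        unfolding w_def by (simp add: sum_subtractf sum_distrib_left sum_distrib_right sum_divide_distrib algebra_simps)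
      finally show ?thesis unfolding sum s_def by (simp add: algebra_simps)
    qed
    moreover have "\<exists>a\<in>A. c' a \<noteq> 0" using c(2) A unfolding c'_def by auto
    ultimately show ?thesis by blast
  qed
qed

lemma indep_card_support:
  assumes "indep P v A" "Q \<subseteq> P" "finite Q" "\<And>a p. a \<in> A \<Longrightarrow> p \<in> P \<Longrightarrow> p \<notin> Q \<Longrightarrow> v a p = 0"
  shows "card A \<le> card Q"
proof (rule ccontr)
  assume "\<not> card A \<le> card Q"
  then obtain c where c: "\<forall>p\<in>Q. (\<Sum>a\<in>A. c a * v a p) = 0" "\<exists>a\<in>A. c a \<noteq> 0"
    using dependent_if_card[of Q A v] assms indep_finite by fastforce
  have "(\<Sum>a\<in>A. c a * v a p) = 0" if "p \<in> P" for p
    using c(1) assms(4) that by (cases "p \<in> Q") auto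
  then show False using indepD[OF assms(1)] c(2) by blast
qed

lemma indep_card: "indep P v A \<Longrightarrow> finite P \<Longrightarrow> card A \<le> card P"
  by (erule indep_card_support) auto

lemma indep_empty: "indep P v {}"
  by (simp add: indep_def)

lemma indep_subset:
  assumes "indep P v A" "B \<subseteq> A"
  shows "indep P v B"
  unfolding indep_def
proof (intro conjI allI impI ballI)
  show "finite B" using assms finite_subset indep_finite by blast
  fix c b assume c: "\<forall>p\<in>P. (\<Sum>a\<in>B. c a * v a p) = 0" and b: "b \<in> B"
  have "(\<Sum>a\<in>A. (if a \<in> B then c a else 0) * v a p) = (\<Sum>a\<in>B. c a * v a p)" for p
    by (rule sum.mono_neutral_cong_right) (use assms indep_finite in auto)
  then show "c b = 0"
    using indepD[OF assms(1), of "\<lambda>a. if a \<in> B then c a else 0" b] c b assms(2) by auto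
qed

lemma dependent_insert:
  assumes A: "indep P v A" and b: "\<not> indep P v (insert b A)"
  shows "\<exists>e. \<forall>p\<in>P. v b p = (\<Sum>a\<in>A. e a * v a p)"
proof -
  have bA: "b \<notin> A" using A b by (auto simp: insert_absorb)
  have f: "finite A" using A by (rule indep_finite)
  obtain c a0 where c: "\<forall>p\<in>P. (\<Sum>a\<in>insert b A. c a * v a p) = 0" "a0 \<in> insert b A" "c a0 \<noteq> 0"
    using b f unfolding indep_def by auto
  have c': "c b * v b p + (\<Sum>a\<in>A. c a * v a p) = 0" if "p \<in> P" for p
    using c(1) that bA f by auto
  have cb: "c b \<noteq> 0"
  proof
    assume "c b = 0"
    then have "c a = 0" if "a \<in> A" for a using indepD[OF A, of c a] c' that by auto
    then show False using c \<open>c b = 0\<close> by auto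
  qed
  have "v b p = (\<Sum>a\<in>A. (- c a / c b) * v a p)" if "p \<in> P" for p
  proof -
    have "c b * v b p = - (\<Sum>a\<in>A. c a * v a p)" using c'[OF that] by (simp add: eq_neg_iff_add_eq_0)
    then have "v b p = - (\<Sum>a\<in>A. c a * v a p) / c b" using cb by (simp add: field_simps)
    then show ?thesis by (simp add: sum_divide_distrib sum_negf)
  qed
  then have "\<forall>p\<in>P. v b p = (\<Sum>a\<in>A. (- c a / c b) * v a p)" by simp
  then show ?thesis by (intro exI[of _ "\<lambda>a. - c a / c b"])
qed

lemma indep_augment:
  assumes A: "indep P v A" and B: "indep P v B" and card: "card A < card B"
  shows "\<exists>b\<in>B. b \<notin> A \<and> indep P v (insert b A)"
proof (rule ccontr)
  assume no: "\<not> ?thesis"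
  have "\<exists>e. \<forall>p\<in>P. v b p = (\<Sum>a\<in>A. e a * v a p)" if b: "b \<in> B" for b
  proof (cases "b \<in> A")
    case True
    have "(\<Sum>a\<in>A. (if a = b then 1 else 0) * v a p) = v b p" for p
      using True indep_finite[OF A] by (simp add: if_distrib[of "\<lambda>x. x * _"] cong: if_cong)
    then show ?thesis by (intro exI[of _ "\<lambda>a. if a = b then 1 else 0"]) simp
  next
    case False
    then have "\<not> indep P v (insert b A)" using no b by blast
    from dependent_insert[OF A this] show ?thesis .
  qed
  then obtain e where e: "\<And>b p. b \<in> B \<Longrightarrow> p \<in> P \<Longrightarrow> v b p = (\<Sum>a\<in>A. e b a * v a p)" by metis
  obtain h where h: "bij_betw h A {..<card A}"
    using ex_bij_betw_finite_nat[OF indep_finite[OF A]] by (auto simp: atLeast0LessThan)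
  have hinv: "a \<in> A \<Longrightarrow> inv_into A h (h a) = a" for a
    using h by (auto simp: bij_betw_def)
  obtain c where c: "\<forall>p\<in>{..<card A}. (\<Sum>b\<in>B. c b * e b (inv_into A h p)) = 0" "\<exists>b\<in>B. c b \<noteq> 0"
    using dependent_if_card[of "{..<card A}" B "\<lambda>b p. e b (inv_into A h p)"] card indep_finite[OF B] by auto
  have c0: "(\<Sum>b\<in>B. c b * e b a) = 0" if "a \<in> A" for a
    using c(1)[rule_format, of "h a"] hinv[OF that] h that by (auto simp: bij_betw_def)
  have "(\<Sum>b\<in>B. c b * v b p) = 0" if p: "p \<in> P" for p
  proof -
    have "(\<Sum>b\<in>B. c b * v b p) = (\<Sum>b\<in>B. \<Sum>a\<in>A. c b * (e b a * v a p))"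
      using e[OF _ p] by (simp add: sum_distrib_left)
    also have "\<dots> = (\<Sum>a\<in>A. (\<Sum>b\<in>B. c b * e b a) * v a p)"
      by (subst sum.swap) (simp add: sum_distrib_right mult.assoc)
    finally show ?thesis using c0 by simp
  qed
  then show False using indepD[OF B] c(2) by blast
qed

lemma indep_extend:
  assumes "indep P v A" "indep P v B" "card A \<le> card B"
  obtains C where "A \<subseteq> C" "C \<subseteq> A \<union> B" "indep P v C" "card C = card B"
proof -
  have "\<exists>C. A \<subseteq> C \<and> C \<subseteq> A \<union> B \<and> indep P v C \<and> card C = card B"
    using assms
  proof (induction "card B - card A" arbitrary: A)
    case 0 then show ?case by (intro exI[of _ A]) auto
  next
    case (Suc k)
    then have "card A < card B" by simp
    then obtain b where b: "b \<in> B" "b \<notin> A" "indep P v (insert b A)"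
      using indep_augment[OF Suc.prems(1,2)] by blast
    have c: "card (insert b A) = Suc (card A)" using b(2) indep_finite[OF Suc.prems(1)] by simp
    have "k = card B - card (insert b A)" "card (insert b A) \<le> card B" using c Suc.hyps(2) by auto
    from Suc.hyps(1)[OF this(1) b(3) Suc.prems(2) this(2)]
    obtain C where "insert b A \<subseteq> C" "C \<subseteq> insert b A \<union> B" "indep P v C" "card C = card B" by blast
    then show ?case using b(1) by (intro exI[of _ C]) auto
  qed
  then show thesis using that by blast
qed

lemma indep_cong:
  assumes "\<And>a p. a \<in> A \<Longrightarrow> p \<in> P \<Longrightarrow> v a p = w a p"
  shows "indep P v A = indep P w A"
proof -
  have "(\<Sum>a\<in>A. c a * v a p) = (\<Sum>a\<in>A. c a * w a p)" if "p \<in> P" for c :: "'a \<Rightarrow> 'b" and p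
    using assms that by (intro sum.cong) auto
  then show ?thesis unfolding indep_def by auto
qed

lemma indep_orthogonal:
  fixes v :: "'e \<Rightarrow> nat \<Rightarrow> 'a::field"
  assumes X: "indep P v X" "finite P" "card X = card P"
    and y: "\<And>x. x \<in> X \<Longrightarrow> (\<Sum>p\<in>P. y p * v x p) = 0" and p: "p \<in> P"
  shows "y p = 0"
proof -
  define v' where "v' = (\<lambda>x. case x of None \<Rightarrow> (\<lambda>q. if q = p then 1 else 0) | Some a \<Rightarrow> v a)"
  have ind: "indep P v' (Some ` X)"
    unfolding indep_def
  proof (intro conjI allI impI ballI)
    show "finite (Some ` X)" using indep_finite[OF X(1)] by simp
    fix c a assume "\<forall>p\<in>P. (\<Sum>a\<in>Some ` X. c a * v' a p) = 0" "a \<in> Some ` X"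
    then show "c a = 0" using indepD[OF X(1), of "c \<circ> Some"] 
      by (auto simp: sum.reindex v'_def)
  qed
  have "\<not> indep P v' (insert None (Some ` X))"
  proof
    assume "indep P v' (insert None (Some ` X))"
    from indep_card[OF this X(2)] show False using X(3) indep_finite[OF X(1)] by (simp add: card_image)
  qed
  from dependent_insert[OF ind this] obtain e
    where "\<forall>q\<in>P. v' None q = (\<Sum>a\<in>Some ` X. e a * v' a q)" ..
  then have e: "(if q = p then 1 else 0) = (\<Sum>a\<in>X. e (Some a) * v a q)" if "q \<in> P" for q
    using that by (simp add: v'_def sum.reindex)
  have "(\<Sum>q\<in>P. y q * (if q = p then 1 else 0)) = (\<Sum>q\<in>P. if q = p then y q else 0)"
    by (rule sum.cong) auto
  then have "y p = (\<Sum>q\<in>P. y q * (if q = p then 1 else 0))" using p X(2) by simp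
  also have "\<dots> = (\<Sum>q\<in>P. \<Sum>a\<in>X. e (Some a) * (y q * v a q))"
    by (rule sum.cong) (simp_all add: e sum_distrib_left mult.left_commute)
  also have "\<dots> = (\<Sum>a\<in>X. e (Some a) * (\<Sum>q\<in>P. y q * v a q))"
    by (subst sum.swap) (simp add: sum_distrib_left)
  also have "\<dots> = 0" using y by simp
  finally show ?thesis .
qed

lemma ex_orthogonal:
  fixes v :: "'e \<Rightarrow> nat \<Rightarrow> 'a::field"
  assumes "finite P" "finite X" "card X < card P"
  obtains y where "\<And>x. x \<in> X \<Longrightarrow> (\<Sum>p\<in>P. y p * v x p) = 0" "\<exists>p\<in>P. y p \<noteq> 0"
proof -
  obtain h where h: "bij_betw h X {..<card X}"
    using ex_bij_betw_finite_nat[OF assms(2)] by (auto simp: atLeast0LessThan)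
  have hinv: "a \<in> X \<Longrightarrow> inv_into X h (h a) = a" for a
    using h by (auto simp: bij_betw_def)
  obtain y where y: "\<forall>q\<in>{..<card X}. (\<Sum>p\<in>P. y p * v (inv_into X h q) p) = 0" "\<exists>p\<in>P. y p \<noteq> 0"
    using dependent_if_card[of "{..<card X}" P "\<lambda>p q. v (inv_into X h q) p"] assms by auto
  have "(\<Sum>p\<in>P. y p * v x p) = 0" if "x \<in> X" for x
    using y(1)[rule_format, of "h x"] hinv[OF that] h that by (auto simp: bij_betw_def)
  then show thesis using that y(2) by blast
qed

definition pivot :: "('e \<Rightarrow> nat \<Rightarrow> real) \<Rightarrow> 'e \<Rightarrow> nat \<Rightarrow> 'e \<Rightarrow> nat \<Rightarrow> real" where
  "pivot tab b q a p =
     (if p = q then tab a q / tab b q else tab a p - tab a q / tab b q * tab b p)"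

lemma indep_pivot:
  assumes "q \<in> P" "tab b q \<noteq> 0"
  shows "indep P (pivot tab b q) A = indep P tab A"
proof -
  have "(\<forall>p\<in>P. (\<Sum>a\<in>A. c a * pivot tab b q a p) = 0) = (\<forall>p\<in>P. (\<Sum>a\<in>A. c a * tab a p) = 0)" for c
  proof -
    define S where "S p = (\<Sum>a\<in>A. c a * tab a p)" for p
    have *: "(\<Sum>a\<in>A. c a * pivot tab b q a p) = (if p = q then S q / tab b q else S p - S q / tab b q * tab b p)" for p
      unfolding S_def pivot_def
      by (auto simp: sum_divide_distrib sum_subtractf sum_distrib_right right_diff_distrib mult.assoc intro!: sum.cong)
    show ?thesis unfolding * S_def[symmetric]
    proof
      assume l: "\<forall>p\<in>P. (if p = q then S q / tab b q else S p - S q / tab b q * tab b p) = 0"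
      then have "S q = 0" using assms by (auto dest!: bspec[of _ _ q])
      then show "\<forall>p\<in>P. S p = 0" using l by (auto split: if_splits)
    qed (use assms in auto)
  qed
  then show ?thesis unfolding indep_def by simp
qed

locale rado =
  fixes n m d vb :: nat and N :: "nat \<Rightarrow> nat \<Rightarrow> bool" and vec :: "nat \<Rightarrow> nat \<Rightarrow> real" and tg :: "nat \<Rightarrow> bool"
  assumes d_le: "d \<le> vb" and vec0: "\<And>a p. a < m \<Longrightarrow> d \<le> p \<Longrightarrow> vec a p = 0"
begin

abbreviation "D \<equiv> vb + n"

definition nbrs :: "nat set \<Rightarrow> nat set" where
  "nbrs X = {a. a < m \<and> (\<exists>k\<in>X. N k a)}"

definition transversal :: "nat set \<Rightarrow> (nat \<Rightarrow> nat) \<Rightarrow> bool" where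
  "transversal R f \<longleftrightarrow> R \<subseteq> {..<n} \<and> inj_on f R \<and> (\<forall>i\<in>R. f i < m \<and> N i (f i)) \<and> indep {..<D} vec (f ` R)"

definition matchable :: "nat set \<Rightarrow> bool" where
  "matchable R \<longleftrightarrow> (\<exists>f. transversal R f)"

definition tight :: "nat set \<Rightarrow> bool" where
  "tight X \<longleftrightarrow> (\<forall>A \<subseteq> nbrs X. indep {..<D} vec A \<longrightarrow> card A \<le> card X)"

definition tableau :: "(nat \<Rightarrow> nat \<Rightarrow> real) \<Rightarrow> (nat \<Rightarrow> (nat \<times> bool) option) \<Rightarrow> bool" where
  "tableau tab own \<longleftrightarrow>
     (\<forall>A. A \<subseteq> {..<m} \<longrightarrow> indep {..<D} tab A = indep {..<D} vec A) \<and>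
     (\<forall>a p. a < m \<longrightarrow> d \<le> p \<longrightarrow> p < D \<longrightarrow> tab a p = 0) \<and>
     (\<forall>k<n. \<exists>p<D. \<exists>t. own p = Some (k, t)) \<and>
     (\<forall>p q k t t'. own p = Some (k, t) \<longrightarrow> own q = Some (k, t') \<longrightarrow> p = q) \<and>
     (\<forall>p k t. own p = Some (k, t) \<longrightarrow> k < n \<and> p < D) \<and>
     (\<forall>p k t. d \<le> p \<longrightarrow> own p = Some (k, t) \<longrightarrow> p = vb + k \<and> t) \<and>
     (\<forall>p k t. p < d \<longrightarrow> own p = Some (k, t) \<longrightarrow>
        (\<exists>a<m. N k a \<and> t = tg a \<and> (\<forall>q<D. tab a q = (if q = p then 1 else 0))))"

lemma invD:
  assumes "tableau tab own"
  shows "\<And>A. A \<subseteq> {..<m} \<Longrightarrow> indep {..<D} tab A = indep {..<D} vec A"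
    and "\<And>a p. a < m \<Longrightarrow> d \<le> p \<Longrightarrow> p < D \<Longrightarrow> tab a p = 0"
    and "\<And>k. k < n \<Longrightarrow> \<exists>p<D. \<exists>t. own p = Some (k, t)"
    and "\<And>p q k t t'. own p = Some (k, t) \<Longrightarrow> own q = Some (k, t') \<Longrightarrow> p = q"
    and "\<And>p k t. own p = Some (k, t) \<Longrightarrow> k < n \<and> p < D"
    and "\<And>p k t. own p = Some (k, t) \<Longrightarrow> d \<le> p \<Longrightarrow> p = vb + k \<and> t"
    and "\<And>p k t. own p = Some (k, t) \<Longrightarrow> p < d \<Longrightarrow>
        (\<exists>a<m. N k a \<and> t = tg a \<and> (\<forall>q<D. tab a q = (if q = p then 1 else 0)))"
proof -
  note c = assms[unfolded tableau_def]
  note c1 = c[THEN conjunct1] and c = c[THEN conjunct2]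
  note c2 = c[THEN conjunct1] and c = c[THEN conjunct2]
  note c3 = c[THEN conjunct1] and c = c[THEN conjunct2]
  note c4 = c[THEN conjunct1] and c = c[THEN conjunct2]
  note c5 = c[THEN conjunct1] and c = c[THEN conjunct2]
  note c6 = c[THEN conjunct1] and c7 = c[THEN conjunct2]
  show "\<And>A. A \<subseteq> {..<m} \<Longrightarrow> indep {..<D} tab A = indep {..<D} vec A" by (rule c1[rule_format])
  show "\<And>a p. a < m \<Longrightarrow> d \<le> p \<Longrightarrow> p < D \<Longrightarrow> tab a p = 0" by (rule c2[rule_format])
  show "\<And>k. k < n \<Longrightarrow> \<exists>p<D. \<exists>t. own p = Some (k, t)" by (rule c3[rule_format])
  show "\<And>p q k t t'. own p = Some (k, t) \<Longrightarrow> own q = Some (k, t') \<Longrightarrow> p = q" by (rule c4[rule_format])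
  show "\<And>p k t. own p = Some (k, t) \<Longrightarrow> k < n \<and> p < D" by (rule c5[rule_format])
  show "\<And>p k t. own p = Some (k, t) \<Longrightarrow> d \<le> p \<Longrightarrow> p = vb + k \<and> t" by (rule c6[rule_format])
  show "\<And>p k t. own p = Some (k, t) \<Longrightarrow> p < d \<Longrightarrow>
        (\<exists>a<m. N k a \<and> t = tg a \<and> (\<forall>q<D. tab a q = (if q = p then 1 else 0)))" by (rule c7[rule_format])
qed

definition rows :: "(nat \<Rightarrow> (nat \<times> bool) option) \<Rightarrow> nat set" where
  "rows own = {k. \<exists>p<d. \<exists>t. own p = Some (k, t)}"

definition own0 :: "nat \<Rightarrow> (nat \<times> bool) option" where
  "own0 p = (if vb \<le> p \<and> p < D then Some (p - vb, True) else None)"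

lemma inv0: "tableau vec own0"
  unfolding tableau_def own0_def using d_le vec0 by (auto split: if_splits intro: exI[of _ "vb + k" for k])

lemma rows0: "rows own0 = {}"
  unfolding rows_def own0_def using d_le by auto

definition touch :: "(nat \<Rightarrow> nat \<Rightarrow> real) \<Rightarrow> (nat \<Rightarrow> (nat \<times> bool) option) \<Rightarrow> nat \<Rightarrow> nat \<Rightarrow> bool" where
  "touch tab own p q \<longleftrightarrow> (\<exists>k t a. own p = Some (k, t) \<and> a < m \<and> N k a \<and> tab a q \<noteq> 0)"

text \<open>Moving a row to a free position\<close>

lemma inv_move:
  assumes inv: "tableau tab own" and p: "own p = Some (k, t)" and q: "q < D" "own q = None"
    and a: "a < m" "N k a" "tab a q \<noteq> 0"
  shows "tableau (pivot tab a q) (own(q := Some (k, tg a), p := None))"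
    and "rows (own(q := Some (k, tg a), p := None)) = insert k (rows own)"
    and "q < d"
proof -
  note I = invD[OF inv]
  show qd: "q < d" using I(2) a q by (meson not_le)
  have pq: "p \<noteq> q" using p q by auto
  have pk: "p < D" "k < n" using I(5) p by auto
  let ?own = "own(q := Some (k, tg a), p := None)"
  have own': "?own x = Some (k', t') \<longleftrightarrow> (if x = p then False else if x = q then k' = k \<and> t' = tg a else own x = Some (k', t'))" for x k' t'
    using pq by auto
  have other: "own x = Some (k', t') \<Longrightarrow> x \<noteq> p \<Longrightarrow> k' \<noteq> k" for x k' t'
    using I(4) p by blast
  have nq: "own x = Some (k', t') \<Longrightarrow> x \<noteq> q" for x k' t' using q by auto
  show "tableau (pivot tab a q) ?own"
    unfolding tableau_def
  proof (intro conjI allI impI)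
    show "indep {..<D} (pivot tab a q) A = indep {..<D} vec A" if "A \<subseteq> {..<m}" for A
      using I(1)[OF that] indep_pivot[of q "{..<D}" tab a] q a by simp
    show "pivot tab a q b x = 0" if "b < m" "d \<le> x" "x < D" for b x
      using I(2)[OF _ that(2,3)] that(1) a(1) qd that(2) by (simp add: pivot_def)
    show "\<exists>x<D. \<exists>t. ?own x = Some (k', t)" if "k' < n" for k'
    proof (cases "k' = k")
      case True then show ?thesis using q pq by (intro exI[of _ q]) auto
    next
      case False
      obtain x t' where x: "x < D" "own x = Some (k', t')" using I(3) \<open>k' < n\<close> by blast
      then have "x \<noteq> p" "x \<noteq> q" using False p q by auto
      then show ?thesis using x by (intro exI[of _ x]) auto
    qed
    show "x = y" if "?own x = Some (k', t1)" "?own y = Some (k', t2)" for x y k' t1 t2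
      using that other[of x k' t1] other[of y k' t2] I(4)[of x k' t1 y t2] unfolding own' by (auto split: if_splits)
    show "k' < n" "x < D" if "?own x = Some (k', t1)" for x k' t1
      using that I(5) q pk unfolding own' by (auto split: if_splits)
    show "x = vb + k'" "t1" if "d \<le> x" "?own x = Some (k', t1)" for x k' t1
      using that I(6) qd unfolding own' by (auto split: if_splits)
    show "\<exists>b<m. N k' b \<and> t1 = tg b \<and> (\<forall>y<D. pivot tab a q b y = (if y = x then 1 else 0))"
      if xo: "x < d" "?own x = Some (k', t1)" for x k' t1
    proof (cases "x = q")
      case True
      then have "k' = k" "t1 = tg a" using xo(2) pq by auto
      then show ?thesis using a True by (intro exI[of _ a]) (auto simp: pivot_def)
    next
      case False
      then have "own x = Some (k', t1)" using xo(2) unfolding own' by (auto split: if_splits)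
      then obtain b where b: "b < m" "N k' b" "t1 = tg b" "\<forall>y<D. tab b y = (if y = x then 1 else 0)"
        using I(7)[OF _ xo(1)] by blast
      have "pivot tab a q b y = tab b y" for y using b(4) q(1) False by (auto simp: pivot_def)
      then show ?thesis using b by (intro exI[of _ b]) auto
    qed
  qed
  show "rows ?own = insert k (rows own)"
  proof
    show "rows ?own \<subseteq> insert k (rows own)"
      unfolding rows_def own' by (auto split: if_splits)
    show "insert k (rows own) \<subseteq> rows ?own"
    proof
      fix j assume "j \<in> insert k (rows own)"
      then consider "j = k" | x t' where "j \<noteq> k" "x < d" "own x = Some (j, t')" unfolding rows_def by auto
      then show "j \<in> rows ?own"
      proof cases
        case 1 then show ?thesis using qd pq unfolding rows_def by (auto intro!: exI[of _ q])
      next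
        case 2
        then have "x \<noteq> p" "x \<noteq> q" using p q by auto
        then show ?thesis using 2 unfolding rows_def by (auto intro!: exI[of _ x])
      qed
    qed
  qed
qed

lemma matchable_rows:
  assumes inv: "tableau tab own"
  shows "\<exists>f. transversal (rows own) f \<and> (\<forall>k\<in>rows own. \<exists>p<d. own p = Some (k, tg (f k)))"
proof -
  note I = invD[OF inv]
  have "\<forall>k\<in>rows own. \<exists>p a. p < d \<and> own p = Some (k, tg a) \<and> a < m \<and> N k a \<and> (\<forall>q<D. tab a q = (if q = p then 1 else 0))"
    using I(7) unfolding rows_def by blast
  then obtain g f where gf: "\<And>k. k \<in> rows own \<Longrightarrow> g k < d \<and> own (g k) = Some (k, tg (f k)) \<and> f k < m \<and> N k (f k)
       \<and> (\<forall>q<D. tab (f k) q = (if q = g k then 1 else 0))" by metis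
  have ginj: "inj_on g (rows own)" using gf by (intro inj_onI) (metis option.inject prod.inject)
  have gD: "g k < D" if "k \<in> rows own" for k using gf[OF that] I(5) by blast
  have finj: "inj_on f (rows own)"
  proof (rule inj_onI)
    fix k l assume kl: "k \<in> rows own" "l \<in> rows own" "f k = f l"
    have "tab (f k) (g k) = 1" "tab (f l) (g k) = (if g k = g l then 1 else 0)"
      using gf[OF kl(1)] gf[OF kl(2)] gD[OF kl(1)] by simp_all
    then have "g k = g l" using kl(3) by (simp split: if_splits)
    then show "k = l" using ginj kl by (auto dest: inj_onD)
  qed
  have sub: "rows own \<subseteq> {..<n}" using I(5) unfolding rows_def by auto
  have "indep {..<D} tab (f ` rows own)"
    unfolding indep_def
  proof (intro conjI allI impI ballI)
    show "finite (f ` rows own)" using sub finite_subset by blast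
    fix c a assume c: "\<forall>p\<in>{..<D}. (\<Sum>a\<in>f ` rows own. c a * tab a p) = 0" and "a \<in> f ` rows own"
    then obtain k where k: "k \<in> rows own" "a = f k" by auto
    have "0 = (\<Sum>l\<in>rows own. c (f l) * tab (f l) (g k))"
      using c gD[OF k(1)] finj by (simp add: sum.reindex)
    also have "\<dots> = (\<Sum>l\<in>rows own. if l = k then c (f l) else 0)"
      using gf gD[OF k(1)] ginj k(1) by (intro sum.cong) (auto dest: inj_onD)
    also have "\<dots> = c (f k)" using k(1) finite_subset[OF sub] by simp
    finally show "c a = 0" using k by simp
  qed
  moreover have "f ` rows own \<subseteq> {..<m}" using gf by auto
  ultimately have "transversal (rows own) f"
    unfolding transversal_def using I(1) finj sub gf by auto
  then show ?thesis using gf by blast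
qed

lemma matchable_subset: "matchable R \<Longrightarrow> S \<subseteq> R \<Longrightarrow> matchable S"
  unfolding matchable_def transversal_def
  by (metis (no_types, lifting) image_mono indep_subset inj_on_subset subset_iff)

text \<open>Certificates\<close>

definition closed :: "(nat \<Rightarrow> nat \<Rightarrow> real) \<Rightarrow> (nat \<Rightarrow> (nat \<times> bool) option) \<Rightarrow> nat set \<Rightarrow> bool" where
  "closed tab own C \<longleftrightarrow> C \<subseteq> {..<D} \<and> (\<forall>p\<in>C. \<forall>q<D. touch tab own p q \<longrightarrow> q \<in> C \<and> own q \<noteq> None)"

definition rows_of :: "(nat \<Rightarrow> (nat \<times> bool) option) \<Rightarrow> nat set \<Rightarrow> nat set" where
  "rows_of own C = {k. \<exists>p\<in>C. \<exists>t. own p = Some (k, t)}"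

lemma closed_bound:
  assumes inv: "tableau tab own" and C: "closed tab own C" and A: "A \<subseteq> nbrs (rows_of own C)" "indep {..<D} vec A"
  shows "card A \<le> card (rows_of own C \<inter> rows own)"
proof -
  note I = invD[OF inv]
  define Q where "Q = {p\<in>C. p < d \<and> own p \<noteq> None}"
  have CD: "C \<subseteq> {..<D}" using C unfolding closed_def by blast
  then have fQ: "finite Q" "Q \<subseteq> {..<D}" unfolding Q_def by (auto intro: finite_subset)
  have "A \<subseteq> {..<m}" using A(1) unfolding nbrs_def by auto
  then have "indep {..<D} tab A" using A(2) I(1) by auto
  then have "card A \<le> card Q"
  proof (rule indep_card_support[OF _ fQ(2,1)])
    fix a p assume a: "a \<in> A" and p: "p \<in> {..<D}" "p \<notin> Q"
    show "tab a p = 0"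
    proof (rule ccontr)
      assume nz: "tab a p \<noteq> 0"
      obtain k p0 t where k: "a < m" "N k a" "p0 \<in> C" "own p0 = Some (k, t)"
        using A(1) a unfolding nbrs_def rows_of_def by auto
      then have "touch tab own p0 p" using nz unfolding touch_def by blast
      then have "p \<in> C" "own p \<noteq> None" using C k p unfolding closed_def by auto
      moreover have "p < d" using I(2) k(1) p(1) nz by (meson lessThan_iff not_le)
      ultimately show False using p unfolding Q_def by simp
    qed
  qed
  also have "card Q \<le> card (rows_of own C \<inter> rows own)"
  proof (rule card_inj_on_le)
    show "inj_on (\<lambda>p. fst (the (own p))) Q"
    proof (rule inj_onI)
      fix x y assume xy: "x \<in> Q" "y \<in> Q" "fst (the (own x)) = fst (the (own y))"
      then obtain k t k' t' where "own x = Some (k, t)" "own y = Some (k', t')" unfolding Q_def by auto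
      then show "x = y" using xy(3) I(4)[of x k t y t'] by simp
    qed
    show "(\<lambda>p. fst (the (own p))) ` Q \<subseteq> rows_of own C \<inter> rows own"
    proof
      fix k assume "k \<in> (\<lambda>p. fst (the (own p))) ` Q"
      then obtain p where p: "p \<in> Q" "k = fst (the (own p))" by blast
      then obtain k' t where "own p = Some (k', t)" unfolding Q_def by auto
      then show "k \<in> rows_of own C \<inter> rows own" using p unfolding Q_def rows_of_def rows_def by auto
    qed
    have "rows own \<subseteq> {..<n}" using I(5) unfolding rows_def by auto
    then show "finite (rows_of own C \<inter> rows own)" by (meson finite_Int finite_lessThan finite_subset)
  qed
  finally show ?thesis .
qed

lemma transversal_card:
  assumes "transversal R f" "X \<subseteq> R"
  shows "f ` X \<subseteq> nbrs X" "indep {..<D} vec (f ` X)" "card (f ` X) = card X"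
  using assms unfolding transversal_def nbrs_def
  by (auto intro: indep_subset[of _ _ "f ` R"] card_image inj_on_subset)

lemma not_matchable_closed:
  assumes inv: "tableau tab own" and C: "closed tab own C" and i: "i \<in> rows_of own C" "i \<notin> rows own"
    "rows_of own C \<subseteq> insert i (rows own)"
  shows "\<not> matchable (insert i (rows own))"
proof
  assume "matchable (insert i (rows own))"
  then obtain f where f: "transversal (insert i (rows own)) f" unfolding matchable_def by blast
  note T = transversal_card[OF f i(3)]
  have "card (rows_of own C) \<le> card (rows_of own C \<inter> rows own)"
    using closed_bound[OF inv C T(1,2)] T(3) by simp
  moreover have "finite (rows_of own C)" using f i(3) unfolding transversal_def by (meson finite_lessThan finite_subset)
  moreover have "rows_of own C \<inter> rows own \<subset> rows_of own C" using i by auto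
  ultimately show False using psubset_card_mono by (metis not_le)
qed

lemma closed_Union: "(\<And>i. i \<in> I \<Longrightarrow> closed tab own (C i)) \<Longrightarrow> closed tab own (\<Union>i\<in>I. C i)"
  unfolding closed_def by blast

lemma card_bound_closed:
  assumes inv: "tableau tab own" and C: "closed tab own C" and all: "{..<n} - rows own \<subseteq> rows_of own C"
    and R: "matchable R"
  shows "card R \<le> card (rows own)"
proof -
  note I = invD[OF inv]
  obtain f where f: "transversal R f" using R unfolding matchable_def by blast
  have Rn: "R \<subseteq> {..<n}" using f unfolding transversal_def by blast
  then have fR: "finite R" using finite_subset by blast
  have rn: "rows own \<subseteq> {..<n}" using I(5) unfolding rows_def by auto
  then have fr: "finite (rows own)" using finite_subset by blast
  let ?X = "rows_of own C"
  note T = transversal_card[OF f, of "R \<inter> ?X"]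
  have "f ` (R \<inter> ?X) \<subseteq> nbrs ?X" using T(1) unfolding nbrs_def by auto
  then have 1: "card (R \<inter> ?X) \<le> card (?X \<inter> rows own)"
    using closed_bound[OF inv C _ T(2)] T(3) by auto
  have 2: "card (R - ?X) \<le> card (rows own - ?X)"
    using all Rn fr by (intro card_mono) auto
  have "card R = card (R \<inter> ?X) + card (R - ?X)"
    using card_Un_disjoint[of "R \<inter> ?X" "R - ?X"] fR by (auto simp: Int_Diff_Un)
  moreover have "card (rows own) = card (rows own \<inter> ?X) + card (rows own - ?X)"
    using card_Un_disjoint[of "rows own \<inter> ?X" "rows own - ?X"] fr by (auto simp: Int_Diff_Un)
  ultimately show ?thesis using 1 2 by (simp add: Int_commute)
qed


text \<open>The search\<close>

definition grow :: "(nat \<Rightarrow> nat \<Rightarrow> real) \<Rightarrow> (nat \<Rightarrow> (nat \<times> bool) option) \<Rightarrow> nat set \<Rightarrow> nat set" where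
  "grow tab own P = P \<union> {q. q < D \<and> (\<exists>p\<in>P. touch tab own p q)}"

definition hit :: "(nat \<Rightarrow> nat \<Rightarrow> real) \<Rightarrow> (nat \<Rightarrow> (nat \<times> bool) option) \<Rightarrow> nat set \<Rightarrow> bool" where
  "hit tab own P \<longleftrightarrow> (\<exists>p\<in>P. \<exists>q<D. own q = None \<and> touch tab own p q)"

lemma grow_iff: "q \<in> grow tab own P \<longleftrightarrow> q \<in> P \<or> (q < D \<and> (\<exists>p\<in>P. touch tab own p q))"
  unfolding grow_def by auto

lemma grow_cong: "(\<And>r x. r \<in> P \<Longrightarrow> touch tab own r x = touch tab' own' r x) \<Longrightarrow> grow tab own P = grow tab' own' P"
  unfolding grow_def by auto

abbreviation lev where "lev tab own s j \<equiv> (grow tab own ^^ j) {s}"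

fun mstep where
  "mstep (tab, own, P0, P) (tab', own', P0', P') \<longleftrightarrow> P0' = P0 \<and>
    (if hit tab own P then P' = P0 \<and>
       (\<exists>p\<in>P. \<exists>q<D. \<exists>k t a. own p = Some (k, t) \<and> own q = None \<and> a < m \<and> N k a \<and> tab a q \<noteq> 0 \<and>
          tab' = pivot tab a q \<and> own' = own(q := Some (k, tg a), p := None))
     else tab' = tab \<and> own' = own \<and> P' = grow tab own P)"

lemma lev_mono: "i \<le> j \<Longrightarrow> lev tab own s i \<subseteq> lev tab own s j"
  by (induction j) (auto simp: le_Suc_eq grow_def)

lemma hit_mono: "hit tab own P \<Longrightarrow> P \<subseteq> Q \<Longrightarrow> hit tab own Q"
  unfolding hit_def by blast

lemma lev_sub: "s < D \<Longrightarrow> lev tab own s j \<subseteq> {..<D}"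
  by (induction j) (auto simp: grow_iff)

lemma lev_const:
  assumes "lev tab own s (Suc j) = lev tab own s j" "j \<le> i"
  shows "lev tab own s i = lev tab own s j"
  using assms(2)
proof (induction i)
  case (Suc i)
  show ?case
  proof (cases "j \<le> i")
    case True then show ?thesis using Suc assms(1) by simp
  next
    case False then have "j = Suc i" using Suc by simp then show ?thesis by simp
  qed
qed simp

lemma lev_stable:
  assumes s: "s < D" and i: "D \<le> i"
  shows "lev tab own s i = lev tab own s D"
proof -
  have "\<exists>j\<le>D. lev tab own s (Suc j) = lev tab own s j"
  proof (rule ccontr)
    assume n: "\<not> ?thesis"
    have "j \<le> Suc D \<Longrightarrow> j < card (lev tab own s j)" for j
    proof (induction j)
      case 0 then show ?case by simp
    next
      case (Suc j)
      have "lev tab own s j \<subset> lev tab own s (Suc j)"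
        using n Suc.prems lev_mono[of j "Suc j" tab own s] by auto
      moreover have "finite (lev tab own s (Suc j))"
        using lev_sub[OF s, of "Suc j" tab own] finite_subset by blast
      ultimately have "card (lev tab own s j) < card (lev tab own s (Suc j))" by (simp add: psubset_card_mono)
      then show ?case using Suc by simp
    qed
    then have "Suc D < card (lev tab own s (Suc D))" by blast
    moreover have "card (lev tab own s (Suc D)) \<le> D"
      using card_mono[OF _ lev_sub[OF s, of "Suc D" tab own]] by simp
    ultimately show False by simp
  qed
  then obtain j where j: "j \<le> D" "lev tab own s (Suc j) = lev tab own s j" by blast
  show ?thesis using lev_const[OF j(2), of i] lev_const[OF j(2), of D] j(1) i by simp
qed

lemma hit_level: "s < D \<Longrightarrow> hit tab own (lev tab own s t) \<Longrightarrow> hit tab own (lev tab own s D)"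
  using lev_stable[of s t tab own] lev_mono[of t D tab own s] hit_mono by (metis nle_le)

text \<open>After a move from the first level with a free position, the next one is found earlier.\<close>

lemma move_level:
  assumes inv: "tableau tab own" and s: "own s \<noteq> None" and nohit: "\<And>i. i \<le> j \<Longrightarrow> \<not> hit tab own (lev tab own s i)"
    and sD: "s < D"
    and p: "p \<in> lev tab own s (Suc j)" "own p = Some (k, t)" and q: "q < D" "own q = None"
    and a: "a < m" "N k a" "tab a q \<noteq> 0"
  shows "hit (pivot tab a q) (own(q := Some (k, tg a), p := None))
      (lev (pivot tab a q) (own(q := Some (k, tg a), p := None)) s j)"
    and "s \<noteq> p"
proof -
  let ?tab = "pivot tab a q" and ?own = "own(q := Some (k, tg a), p := None)"
  note nh = nohit
  have "p \<notin> lev tab own s j"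
    using nh[of j] p q a unfolding hit_def touch_def by blast
  then obtain p1 where p1: "p1 \<in> lev tab own s j" "touch tab own p1 p" and pD: "p < D"
    using p(1) by (auto simp: grow_iff)
  have sp: "s \<in> lev tab own s j" using lev_mono[of 0 j tab own s] by auto
  then show "s \<noteq> p" using \<open>p \<notin> lev tab own s j\<close> by auto
  have owned: "own r \<noteq> None" if "i \<le> j" "r \<in> lev tab own s i" for i r
    using that
  proof (induction i)
    case 0 then show ?case using s by simp
  next
    case (Suc i)
    show ?case
    proof (cases "r \<in> lev tab own s i")
      case True then show ?thesis using Suc by simp
    next
      case False
      then have "r < D" "\<exists>p\<in>lev tab own s i. touch tab own p r" using Suc.prems by (auto simp: grow_iff)
      then show ?thesis using nh[of i] Suc.prems(1) unfolding hit_def by auto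
    qed
  qed
  have touch: "touch ?tab ?own r x = touch tab own r x" if r: "r \<in> lev tab own s j" for r x
  proof -
    have "r \<noteq> p" using r \<open>p \<notin> lev tab own s j\<close> by auto
    moreover have "r \<noteq> q" using owned[of j r] r q by auto
    moreover have "pivot tab a q b x = tab b x" if "own r = Some (k', t')" "b < m" "N k' b" for b k' t' x
    proof -
      have "tab b q = 0" using nh[of j] r that q unfolding hit_def touch_def by blast
      then show ?thesis by (auto simp: pivot_def)
    qed
    ultimately show ?thesis unfolding touch_def by (auto, metis+)
  qed
  have "i \<le> j \<Longrightarrow> lev ?tab ?own s i = lev tab own s i" for i
  proof (induction i)
    case (Suc i)
    then have "lev tab own s i \<subseteq> lev tab own s j" using lev_mono[of i j tab own s] by simp
    then have "grow ?tab ?own (lev tab own s i) = grow tab own (lev tab own s i)"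
      using touch by (intro grow_cong) blast
    then show ?case using Suc by (simp del: fun_upd_apply fun_upd_def)
  qed simp
  then have "p1 \<in> lev ?tab ?own s j" "touch ?tab ?own p1 p" using p1 touch by auto
  moreover have "?own p = None" by simp
  ultimately show "hit ?tab ?own (lev ?tab ?own s j)" unfolding hit_def using pD by blast
qed

text \<open>Invariant of the search for row i, started with the set R of placed rows\<close>

fun sinv where
  "sinv R i (tab, own, P0, P) \<longleftrightarrow> tableau tab own \<and> P0 = {vb + i} \<and> P \<subseteq> insert (vb + i) {..<d} \<and>
     R \<subseteq> rows own \<and> rows own \<subseteq> insert i R"

lemma sinv_mstep:
  assumes "sinv R i st" "mstep st st'"
  shows "sinv R i st'"
proof -
  obtain tab own P0 P where st: "st = (tab, own, P0, P)" by (cases st)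
  obtain tab' own' P0' P' where st': "st' = (tab', own', P0', P')" by (cases st')
  have inv: "tableau tab own" and P: "P0 = {vb + i}" "P \<subseteq> insert (vb + i) {..<d}" and R: "R \<subseteq> rows own" "rows own \<subseteq> insert i R"
    using assms(1) unfolding st by auto
  note I = invD[OF inv]
  show ?thesis
  proof (cases "hit tab own P")
    case True
    then obtain p q k t a where *: "p \<in> P" "q < D" "own p = Some (k, t)" "own q = None" "a < m" "N k a" "tab a q \<noteq> 0"
      "tab' = pivot tab a q" "own' = own(q := Some (k, tg a), p := None)" and P': "P0' = P0" "P' = P0"
      using assms(2) unfolding st st' by auto
    have "k \<in> insert i R"
    proof (cases "p < d")
      case True then show ?thesis using * R(2) unfolding rows_def by blast
    next
      case False then have "p = vb + i" "p = vb + k" using P * I(6)[of p k t] by auto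
      then show ?thesis by simp
    qed
    then show ?thesis using inv_move[OF inv *(3,2,4,5,6,7)] * P' P R unfolding st' by auto
  next
    case False
    then have eq: "tab' = tab" "own' = own" "P0' = P0" "P' = grow tab own P" using assms(2) unfolding st st' by auto
    have "q < d" if "q < D" "touch tab own p q" for p q
      using that I(2) unfolding touch_def by (meson not_le)
    then have "P' \<subseteq> insert (vb + i) {..<d}" using P(2) unfolding eq grow_def by auto
    then show ?thesis using inv P R unfolding st' eq by auto
  qed
qed

lemma sinv_run: "(mstep ^^ T) st st' \<Longrightarrow> sinv R i st \<Longrightarrow> sinv R i st'"
proof (induction T arbitrary: st')
  case (Suc T)
  then obtain st1 where "(mstep ^^ T) st st1" "mstep st1 st'" by (auto elim: relpowp_Suc_E)
  then show ?case using Suc sinv_mstep by blast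
qed simp

lemma no_touch: "own p = None \<Longrightarrow> \<not> touch tab own p q"
  unfolding touch_def by simp

lemma run_stop: "(mstep ^^ T) (tab, own, {s}, {s}) (tab', own', P0', P') \<Longrightarrow> own s = None \<Longrightarrow> own' s = None"
proof (induction T arbitrary: tab own)
  case (Suc T)
  from relpowp_Suc_D2[OF Suc.prems(1)] obtain st where 
    st: "mstep (tab, own, {s}, {s}) st" "(mstep ^^ T) st (tab', own', P0', P')" by blast
  have "st = (tab, own, {s}, {s})" using st(1) Suc.prems(2)
    by (cases st) (auto simp: hit_def grow_def no_touch)
  then show ?case using Suc st by auto
qed simp

lemma run_done:
  "(mstep ^^ T) (tab, own, {s}, lev tab own s j) (tab', own', P0', P') \<Longrightarrow> tableau tab own \<Longrightarrow> own s \<noteq> None \<Longrightarrow> s < D \<Longrightarrow>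
   (\<And>i. i < j \<Longrightarrow> \<not> hit tab own (lev tab own s i)) \<Longrightarrow> hit tab own (lev tab own s t) \<Longrightarrow> j \<le> t \<Longrightarrow>
   (t + 1) * (t + 1) \<le> T + j \<Longrightarrow> own' s = None"
proof (induction T arbitrary: tab own j t)
  case 0
  then show ?case by simp
next
  case (Suc T)
  from relpowp_Suc_D2[OF Suc.prems(1)] obtain tab1 own1 P01 P1 where 
    st: "mstep (tab, own, {s}, lev tab own s j) (tab1, own1, P01, P1)" "(mstep ^^ T) (tab1, own1, P01, P1) (tab', own', P0', P')" 
    by (metis prod_cases4)
  show ?case
  proof (cases "hit tab own (lev tab own s j)")
    case True
    then obtain p q k ta a where *: "p \<in> lev tab own s j" "q < D" "own p = Some (k, ta)" "own q = None" "a < m" "N k a" "tab a q \<noteq> 0"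
      and eq: "tab1 = pivot tab a q" "own1 = own(q := Some (k, tg a), p := None)" "P01 = {s}" "P1 = {s}"
      using st(1) by auto
    note mv = inv_move[OF Suc.prems(2) *(3,2,4,5,6,7)]
    show ?thesis
    proof (cases j)
      case 0
      then have "own1 s = None" using * eq by auto
      then show ?thesis using run_stop st(2) unfolding eq by blast
    next
      case (Suc j')
      have nh: "\<not> hit tab own (lev tab own s i)" if "i \<le> j'" for i using Suc.prems(5) that Suc by auto
      note ml = move_level[OF Suc.prems(2,3) nh Suc.prems(4) *(1)[unfolded Suc] *(3,2,4,5,6,7)]
      have "q \<noteq> s" using Suc.prems(3) * by auto
      have 1: "(mstep ^^ T) (tab1, own1, {s}, lev tab1 own1 s 0) (tab', own', P0', P')" using st(2) eq by simp
      have 2: "own1 s \<noteq> None" using ml(2) Suc.prems(3) \<open>q \<noteq> s\<close> unfolding eq by auto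
      have "(j + 1) * (j + 1) \<le> (t + 1) * (t + 1)" using Suc.prems(7) by (intro mult_le_mono) auto
      then have "(j' + 1) * (j' + 1) \<le> T" using Suc.prems(8) Suc by simp
      show ?thesis
        by (rule Suc.IH[OF 1 mv(1)[folded eq(1,2)] 2 Suc.prems(4) _ ml(1)[folded eq(1,2)]])
          (use \<open>(j' + 1) * (j' + 1) \<le> T\<close> in auto)
    qed
  next
    case False
    then have eq: "tab1 = tab" "own1 = own" "P01 = {s}" "P1 = lev tab own s (Suc j)" using st(1) by auto
    have "j \<noteq> t" using False Suc.prems(6) by auto
    show ?thesis
    proof (rule Suc.IH[OF st(2)[unfolded eq] Suc.prems(2,3,4) _ Suc.prems(6)])
      show "\<not> hit tab own (lev tab own s i)" if "i < Suc j" for i using that Suc.prems(5) False less_Suc_eq by auto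
    qed (use \<open>j \<noteq> t\<close> Suc.prems in auto)
  qed
qed

lemma run_nohit:
  "(mstep ^^ T) (tab, own, {s}, lev tab own s j) st' \<Longrightarrow> (\<And>i. \<not> hit tab own (lev tab own s i)) \<Longrightarrow>
   st' = (tab, own, {s}, lev tab own s (T + j))"
proof (induction T arbitrary: j)
  case (Suc T)
  from relpowp_Suc_D2[OF Suc.prems(1)] obtain st where 
    st: "mstep (tab, own, {s}, lev tab own s j) st" "(mstep ^^ T) st st'" by blast
  have "st = (tab, own, {s}, lev tab own s (Suc j))" using st(1) Suc.prems(2)[of j] by (cases st) auto
  then show ?case using Suc.IH[of "Suc j"] Suc.prems(2) st(2) by simp
qed auto

lemma closed_lev:
  assumes "s < D" "\<And>i. \<not> hit tab own (lev tab own s i)"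
  shows "closed tab own (\<Union>i. lev tab own s i)"
  unfolding closed_def
proof (intro conjI ballI allI impI)
  show "(\<Union>i. lev tab own s i) \<subseteq> {..<D}" using lev_sub[OF assms(1)] by blast
  fix p q assume "p \<in> (\<Union>i. lev tab own s i)" and q: "q < D" "touch tab own p q"
  then obtain i where i: "p \<in> lev tab own s i" by blast
  then have "q \<in> lev tab own s (Suc i)" using q by (auto simp: grow_iff)
  then show "q \<in> (\<Union>i. lev tab own s i)" by blast
  show "own q \<noteq> None" using assms(2)[of i] i q unfolding hit_def by auto
qed

lemma mstep_total: "\<exists>st'. mstep st st'"
proof -
  obtain tab own P0 P where st: "st = (tab, own, P0, P)" by (cases st)
  show ?thesis
  proof (cases "hit tab own P")
    case True
    then obtain p q k t a where "p \<in> P" "q < D" "own q = None" "own p = Some (k, t)" "a < m" "N k a" "tab a q \<noteq> 0"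
      unfolding hit_def touch_def by blast
    then have "mstep st (pivot tab a q, own(q := Some (k, tg a), p := None), P0, P0)"
      unfolding st using True by auto
    then show ?thesis by blast
  next
    case False
    then have "mstep st (tab, own, P0, grow tab own P)" unfolding st by auto
    then show ?thesis by blast
  qed
qed

lemma run_total: "\<exists>st'. (mstep ^^ T) st st'"
proof (induction T)
  case (Suc T) then show ?case using mstep_total by (metis relpowp_Suc_I)
qed (metis relpowp_0_I)

lemma virtual_owner:
  assumes "tableau tab own" "i < n" "i \<notin> rows own"
  shows "own (vb + i) = Some (i, True)"
proof -
  obtain p t where p: "p < D" "own p = Some (i, t)" using invD(3)[OF assms(1,2)] by blast
  then have "d \<le> p" using assms(3) unfolding rows_def by force
  then show ?thesis using invD(6)[OF assms(1) p(2)] p by simp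
qed

lemma search:
  assumes inv: "tableau tab own" and i: "i < n" "i \<notin> rows own" and T: "(D + 1) * (D + 1) \<le> T"
    and run: "(mstep ^^ T) (tab, own, {vb + i}, {vb + i}) (tab', own', P0', P')"
  shows "tableau tab' own'"
    and "rows own' = insert i (rows own) \<or>
       own' = own \<and> (\<exists>C. closed tab own C \<and> i \<in> rows_of own C \<and> rows_of own C \<subseteq> insert i (rows own))"
proof -
  let ?s = "vb + i"
  have sD: "?s < D" using i by simp
  have own: "own ?s = Some (i, True)" by (rule virtual_owner[OF inv i])
  have si: "sinv (rows own) i (tab, own, {?s}, {?s})" using inv by auto
  from sinv_run[OF run si] have si': "tableau tab' own'" "rows own \<subseteq> rows own'" "rows own' \<subseteq> insert i (rows own)" by auto
  show "tableau tab' own'" by fact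
  show "rows own' = insert i (rows own) \<or>
       own' = own \<and> (\<exists>C. closed tab own C \<and> i \<in> rows_of own C \<and> rows_of own C \<subseteq> insert i (rows own))"
  proof (cases "\<exists>t. hit tab own (lev tab own ?s t)")
    case True
    then have "hit tab own (lev tab own ?s D)" using hit_level sD by blast
    then have "own' ?s = None"
      using run_done[of T tab own ?s 0 tab' own' P0' P' D] run inv own sD T by simp
    then have "i \<in> rows own'" using virtual_owner[OF si'(1) i(1)] by auto
    then show ?thesis using si' by auto
  next
    case False
    then have nh: "\<not> hit tab own (lev tab own ?s j)" for j by blast
    have "own' = own" using run_nohit[of T tab own ?s 0] run nh by auto
    let ?C = "\<Union>j. lev tab own ?s j"
    have "closed tab own ?C" by (rule closed_lev[OF sD nh])
    moreover have "?s \<in> ?C" by (auto intro: exI[of _ 0])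
    then have "i \<in> rows_of own ?C" using own unfolding rows_of_def by blast
    moreover have "lev tab own ?s j \<subseteq> insert ?s {..<d}" for j
    proof (induction j)
      case (Suc j)
      have "q < d" if "q < D" "touch tab own p q" for p q
        using that invD(2)[OF inv] unfolding touch_def by (meson not_le)
      then show ?case using Suc by (auto simp: grow_iff)
    qed simp
    then have "?C \<subseteq> insert ?s {..<d}" by blast
    then have "rows_of own ?C \<subseteq> insert i (rows own)"
    proof (intro subsetI)
      fix k assume C: "?C \<subseteq> insert ?s {..<d}" and "k \<in> rows_of own ?C"
      then obtain p t where p: "p \<in> ?C" "own p = Some (k, t)" unfolding rows_of_def by blast
      then have "p = ?s \<or> p < d" using C by auto
      then show "k \<in> insert i (rows own)" using p(2) own unfolding rows_def by auto
    qed
    ultimately show ?thesis using \<open>own' = own\<close> by blast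
  qed
qed

lemma search_fail_or_ok:
  assumes inv: "tableau tab own" and i: "i < n" "i \<notin> rows own"
  shows "(\<exists>tab' own'. tableau tab' own' \<and> rows own' = insert i (rows own)) \<or>
       (\<exists>C. closed tab own C \<and> i \<in> rows_of own C \<and> rows_of own C \<subseteq> insert i (rows own))"
proof -
  obtain tab' own' P0' P' where "(mstep ^^ ((D + 1) * (D + 1))) (tab, own, {vb + i}, {vb + i}) (tab', own', P0', P')"
    using run_total by (metis prod_cases4)
  from search[OF assms _ this] show ?thesis by blast
qed

lemma state_of_matchable:
  assumes "matchable R"
  shows "\<exists>tab own. tableau tab own \<and> rows own = R"
proof -
  have "finite R" "R \<subseteq> {..<n}" using assms unfolding matchable_def transversal_def by (auto intro: finite_subset)
  then show ?thesis using assms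
  proof (induction R rule: finite_induct)
    case empty then show ?case using inv0 rows0 by blast
  next
    case (insert i R)
    then have "matchable R" using matchable_subset by blast
    then obtain tab own where st: "tableau tab own" "rows own = R" using insert by auto
    from search_fail_or_ok[OF st(1), of i] not_matchable_closed[OF st(1)] st(2) insert show ?case by auto
  qed
qed

theorem matchable_augment:
  assumes "matchable R" "matchable S" "card R < card S"
  shows "\<exists>i<n. i \<notin> R \<and> matchable (insert i R)"
proof (rule ccontr)
  assume no: "\<not> ?thesis"
  obtain tab own where st: "tableau tab own" "rows own = R" using state_of_matchable[OF assms(1)] by blast
  have "\<exists>C. closed tab own C \<and> i \<in> rows_of own C" if i: "i < n" "i \<notin> R" for i
  proof -
    have "\<not> (\<exists>tab' own'. tableau tab' own' \<and> rows own' = insert i R)"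
      using no i matchable_rows unfolding matchable_def by metis
    then show ?thesis using search_fail_or_ok[OF st(1) i(1)] i st(2) by auto
  qed
  then obtain C where C: "\<And>i. i < n \<Longrightarrow> i \<notin> R \<Longrightarrow> closed tab own (C i) \<and> i \<in> rows_of own (C i)" by metis
  let ?C = "\<Union>i\<in>{..<n} - R. C i"
  have "closed tab own ?C" by (rule closed_Union) (use C in auto)
  moreover have "{..<n} - rows own \<subseteq> rows_of own ?C" using C st(2) unfolding rows_of_def by blast
  ultimately have "card S \<le> card (rows own)" using card_bound_closed[OF st(1)] assms(2) by blast
  then show False using assms(3) st(2) by simp
qed

theorem deficient_set:
  assumes "matchable R" "i < n" "\<not> matchable (insert i R)"
  shows "\<exists>X. X \<subseteq> insert i R \<and> (\<forall>A \<subseteq> nbrs X. indep {..<D} vec A \<longrightarrow> card A < card X)"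
proof -
  obtain tab own where st: "tableau tab own" "rows own = R" using state_of_matchable[OF assms(1)] by blast
  have iR: "i \<notin> R" using assms by (auto simp: insert_absorb)
  have fin: "finite R" using assms(1) unfolding matchable_def transversal_def by (auto intro: finite_subset)
  have "\<not> (\<exists>tab' own'. tableau tab' own' \<and> rows own' = insert i R)"
    using assms(3) matchable_rows unfolding matchable_def by metis
  then obtain C where C: "closed tab own C" "i \<in> rows_of own C" "rows_of own C \<subseteq> insert i R"
    using search_fail_or_ok[OF st(1) assms(2)] st(2) iR by auto
  have "card A < card (rows_of own C)" if "A \<subseteq> nbrs (rows_of own C)" "indep {..<D} vec A" for A
  proof -
    have "rows_of own C \<inter> R \<subset> rows_of own C" using C iR by auto
    then have "card (rows_of own C \<inter> R) < card (rows_of own C)"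
      using C(3) fin by (meson finite_insert finite_subset psubset_card_mono)
    then show ?thesis using closed_bound[OF st(1) C(1) that] st(2) by simp
  qed
  then show ?thesis using C(3) by blast
qed

text \<open>All rows placed: reachability and tight sets\<close>

lemma full_closed_tight:
  assumes inv: "tableau tab own" and full: "{..<n} \<subseteq> rows own" and X: "X \<subseteq> {..<n}"
  defines "C \<equiv> {p. p < D \<and> (\<exists>k\<in>X. \<exists>t. own p = Some (k, t))}"
  shows "tight X \<longleftrightarrow> (\<forall>p\<in>C. \<forall>q<D. touch tab own p q \<longrightarrow> q \<in> C)"
proof
  note I = invD[OF inv]
  assume cl: "\<forall>p\<in>C. \<forall>q<D. touch tab own p q \<longrightarrow> q \<in> C"
  have "closed tab own C" unfolding closed_def
  proof (intro conjI ballI allI impI)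
    show "C \<subseteq> {..<D}" unfolding C_def by auto
    fix p q assume "p \<in> C" "q < D" "touch tab own p q"
    then show "q \<in> C" using cl by blast
    then show "own q \<noteq> None" unfolding C_def by auto
  qed
  moreover have "rows_of own C = X"
    unfolding rows_of_def C_def using I(3) X by (auto, metis lessThan_iff subsetD)
  moreover have "card (X \<inter> rows own) \<le> card X" using X by (intro card_mono) (auto intro: finite_subset)
  ultimately show "tight X" unfolding tight_def using closed_bound[OF inv, of C] le_trans by metis
next
  note I = invD[OF inv]
  assume tight: "tight X"
  show "\<forall>p\<in>C. \<forall>q<D. touch tab own p q \<longrightarrow> q \<in> C"
  proof (intro ballI allI impI, rule ccontr)
    fix p q assume p: "p \<in> C" and q: "q < D" "touch tab own p q" "q \<notin> C"
    obtain k t a where k: "k \<in> X" "own p = Some (k, t)" "a < m" "N k a" "tab a q \<noteq> 0"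
      using p q(2) unfolding C_def touch_def by auto
    have "\<forall>j\<in>X. \<exists>b g. g < d \<and> (\<exists>t. own g = Some (j, t)) \<and> b < m \<and> N j b \<and> (\<forall>q<D. tab b q = (if q = g then 1 else 0))"
    proof
      fix j assume "j \<in> X"
      then have "j \<in> rows own" using full X by blast
      then obtain p t where p: "p < d" "own p = Some (j, t)" unfolding rows_def by auto
      from I(7)[OF p(2,1)] obtain b where "b < m" "N j b" "\<forall>q<D. tab b q = (if q = p then 1 else 0)" by blast
      then show "\<exists>b g. g < d \<and> (\<exists>t. own g = Some (j, t)) \<and> b < m \<and> N j b \<and> (\<forall>q<D. tab b q = (if q = g then 1 else 0))"
        using p by (intro exI[of _ b] exI[of _ p]) auto
    qed
    then obtain f g where fg: "\<And>j. j \<in> X \<Longrightarrow> g j < d \<and> (\<exists>t. own (g j) = Some (j, t)) \<and> f j < m \<and> N j (f j)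
         \<and> (\<forall>q<D. tab (f j) q = (if q = g j then 1 else 0))" by metis
    have gD: "g j < D" if "j \<in> X" for j using fg[OF that] d_le by auto
    have ginj: "inj_on g X" using fg by (intro inj_onI) (metis option.inject prod.inject)
    have finj: "inj_on f X"
    proof (rule inj_onI)
      fix j l assume kl: "j \<in> X" "l \<in> X" "f j = f l"
      have "tab (f j) (g j) = 1" "tab (f l) (g j) = (if g j = g l then 1 else 0)"
      using fg[OF kl(1)] fg[OF kl(2)] gD[OF kl(1)] by simp_all
      then have "g j = g l" using kl(3) by (simp split: if_splits)
      then show "j = l" using ginj kl by (auto dest: inj_onD)
    qed
    have gq: "q \<noteq> g j" if "j \<in> X" for j using fg[OF that] q gD[OF that] that unfolding C_def by auto
    have aX: "a \<notin> f ` X" using fg gq k(5) q(1) by auto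
    have finX: "finite X" using X finite_subset by blast
    have "indep {..<D} tab (insert a (f ` X))"
      unfolding indep_def
    proof (intro conjI allI impI ballI)
      show "finite (insert a (f ` X))" using finX by simp
      fix c b assume c: "\<forall>p\<in>{..<D}. (\<Sum>b\<in>insert a (f ` X). c b * tab b p) = 0" and b: "b \<in> insert a (f ` X)"
      have s: "c a * tab a p + (\<Sum>j\<in>X. c (f j) * tab (f j) p) = 0" if "p < D" for p
        using c that aX finX finj by (simp add: sum.reindex)
      have "(\<Sum>j\<in>X. c (f j) * tab (f j) q) = 0"
        by (rule sum.neutral) (use fg gq q(1) in auto)
      then have ca: "c a = 0" using s[OF q(1)] k(5) by simp
      show "c b = 0"
      proof (cases "b = a")
        case False
        then obtain j where j: "j \<in> X" "b = f j" using b by auto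
        have "0 = (\<Sum>l\<in>X. c (f l) * tab (f l) (g j))" using s[OF gD[OF j(1)]] ca by simp
        also have "\<dots> = (\<Sum>l\<in>X. if l = j then c (f l) else 0)"
          using fg gD[OF j(1)] ginj j(1) by (intro sum.cong) (auto dest: inj_onD)
        also have "\<dots> = c (f j)" using j(1) finX by simp
        finally show ?thesis using j by simp
      qed (use ca in simp)
    qed
    moreover have "insert a (f ` X) \<subseteq> nbrs X" using k fg unfolding nbrs_def by auto
    moreover have "card (insert a (f ` X)) = Suc (card X)" using aX finX finj by (simp add: card_image)
    moreover have "insert a (f ` X) \<subseteq> {..<m}" using k fg by auto
    ultimately show False using tight I(1) unfolding tight_def by (metis Suc_n_not_le_n)
  qed
qed

lemma full_search:
  assumes inv: "tableau tab own" and full: "{..<n} \<subseteq> rows own" and d: "d = n" and i: "i < n"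
    and s: "own s = Some (i, t)" and T: "D \<le> T"
    and run: "(mstep ^^ T) (tab, own, {s}, {s}) st'"
  shows "\<exists>P. st' = (tab, own, {s}, P) \<and> P \<subseteq> {..<D} \<and> rows_of own P \<subseteq> {..<n} \<and> i \<in> rows_of own P \<and> tight (rows_of own P) \<and>
      (\<forall>X \<subseteq> {..<n}. i \<in> X \<longrightarrow> tight X \<longrightarrow> rows_of own P \<subseteq> X)"
proof -
  note I = invD[OF inv]
  have sD: "s < D" using I(5) s by blast
  have "\<forall>k<n. \<exists>p<d. \<exists>t. own p = Some (k, t)" using full unfolding rows_def by auto
  then obtain g where g: "\<And>k. k < n \<Longrightarrow> g k < d \<and> (\<exists>t. own (g k) = Some (k, t))" by metis
  have ginj: "inj_on g {..<n}" by (intro inj_onI) (metis g lessThan_iff option.inject prod.inject)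
  have "g ` {..<n} \<subseteq> {..<n}" using g d by auto
  then have "g ` {..<n} = {..<n}" using ginj by (simp add: endo_inj_surj)
  then have owned: "own p \<noteq> None" if "p < d" for p
    using g that d by (metis imageE lessThan_iff option.distinct(1))
  have nh: "\<not> hit tab own P" for P
    unfolding hit_def touch_def using I(2) owned by (meson not_le)
  let ?P = "lev tab own s T"
  have st': "st' = (tab, own, {s}, ?P)" using run_nohit[of T tab own s 0] run nh by simp
  have stable: "lev tab own s j \<subseteq> ?P" for j
    using lev_stable[OF sD T] lev_mono[of j D tab own s] lev_mono[of D j tab own s] lev_stable[OF sD, of j tab own]
    by (metis nle_le subset_refl)
  have clP: "closed tab own ?P"
  proof -
    have "(\<Union>j. lev tab own s j) = ?P" using stable by blast
    then show ?thesis using closed_lev[OF sD nh] by simp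
  qed
  have PD: "?P \<subseteq> {..<D}" using clP unfolding closed_def by blast
  let ?R = "rows_of own ?P"
  have "s \<in> ?P" using lev_mono[of 0 T tab own s] by auto
  then have iR: "i \<in> ?R" using s unfolding rows_of_def by blast
  have Rn: "?R \<subseteq> {..<n}" using I(5) unfolding rows_of_def by auto
  have CR: "p \<in> ?P" if "own p = Some (k, t)" "k \<in> ?R" for p k t
    using that I(4) unfolding rows_of_def by blast
  have "tight ?R"
    unfolding full_closed_tight[OF inv full Rn]
  proof (intro ballI allI impI)
    fix p q assume "p \<in> {p. p < D \<and> (\<exists>k\<in>?R. \<exists>t. own p = Some (k, t))}" and q: "q < D" "touch tab own p q"
    then obtain k t where p: "p < D" "k \<in> ?R" "own p = Some (k, t)" by blast
    have "p \<in> ?P" by (rule CR[OF p(3,2)])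
    then have "q \<in> ?P" "own q \<noteq> None" using clP q unfolding closed_def by auto
    then show "q \<in> {p. p < D \<and> (\<exists>k\<in>?R. \<exists>t. own p = Some (k, t))}" using q(1) unfolding rows_of_def by auto
  qed
  moreover have "?R \<subseteq> X" if X: "X \<subseteq> {..<n}" "i \<in> X" "tight X" for X
  proof -
    let ?C = "{p. p < D \<and> (\<exists>k\<in>X. \<exists>t. own p = Some (k, t))}"
    have cl: "\<forall>p\<in>?C. \<forall>q<D. touch tab own p q \<longrightarrow> q \<in> ?C"
      using full_closed_tight[OF inv full X(1)] X(3) by blast
    have "lev tab own s j \<subseteq> ?C" for j
    proof (induction j)
      case 0 then show ?case using s sD X(2) by auto
    next
      case (Suc j) then show ?case using cl unfolding funpow.simps o_def grow_def by blast
    qed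
    from this[of T] show ?thesis unfolding rows_of_def by auto
  qed
  ultimately show ?thesis using st' iR Rn PD by blast
qed

end

lemma linear_matroid_iff:
  fixes M :: "'a::field mat"
  shows "J \<in> linear_matroid M \<longleftrightarrow> J \<subseteq> {0..<dim_col M} \<and> indep {..<dim_row M} (\<lambda>j r. M $$ (r, j)) J"
proof -
  define nr where "nr = dim_row M"
  interpret vec_space "TYPE('a)" nr .
  have idx: "col M j $ r = M $$ (r, j)" if "r < nr" "j < dim_col M" for r j using that by (simp add: nr_def)
  have car: "col M ` J \<subseteq> carrier_vec nr" for J using col_dim[of M] unfolding nr_def by auto
  have "inj_on (col M) J \<and> lin_indpt (col M ` J) \<longleftrightarrow> indep {..<nr} (\<lambda>j r. M $$ (r, j)) J"
    if J: "J \<subseteq> {0..<dim_col M}"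
  proof -
    have fin: "finite J" using J finite_subset by blast
    show ?thesis
    proof
      assume a: "inj_on (col M) J \<and> lin_indpt (col M ` J)"
      show "indep {..<nr} (\<lambda>j r. M $$ (r, j)) J"
        unfolding indep_def
      proof (intro conjI allI impI ballI)
        show "finite J" by fact
        fix c j assume c: "\<forall>r\<in>{..<nr}. (\<Sum>j\<in>J. c j * M $$ (r, j)) = 0" and j: "j \<in> J"
        define b where "b v = c (the_inv_into J (col M) v)" for v
        have b: "b (col M i) = c i" if "i \<in> J" for i
          using a that unfolding b_def by (simp add: the_inv_into_f_f)
        have "lincomb b (col M ` J) = 0\<^sub>v nr"
        proof (rule eq_vecI)
          show "dim_vec (lincomb b (col M ` J)) = dim_vec (0\<^sub>v nr)" using car by simp
          fix r assume "r < dim_vec (0\<^sub>v nr)"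
          then have r: "r < nr" by simp
          have "lincomb b (col M ` J) $ r = (\<Sum>v\<in>col M ` J. b v * v $ r)" by (rule lincomb_index[OF r car])
          also have "\<dots> = (\<Sum>i\<in>J. c i * M $$ (r, i))"
            using a J b idx[OF r] by (subst sum.reindex) (auto intro!: sum.cong)
          finally show "lincomb b (col M ` J) $ r = 0\<^sub>v nr $ r" using c r by simp
        qed
        then have "b (col M j) = 0"
          using a j fin unfolding lin_dep_def by (metis finite_imageI image_eqI order_refl)
        then show "c j = 0" using b[OF j] by simp
      qed
    next
      assume ind: "indep {..<nr} (\<lambda>j r. M $$ (r, j)) J"
      have inj: "inj_on (col M) J"
      proof (rule inj_onI, rule ccontr)
        fix i j assume ij: "i \<in> J" "j \<in> J" "col M i = col M j" "i \<noteq> j"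
        let ?c = "\<lambda>k. if k = i then 1 else if k = j then -1 else (0::'a)"
        have "(\<Sum>k\<in>J. ?c k * M $$ (r, k)) = 0" if r: "r \<in> {..<nr}" for r
        proof -
          have "(\<Sum>k\<in>J. ?c k * M $$ (r, k)) = (\<Sum>k\<in>{i, j}. ?c k * M $$ (r, k))"
            using fin ij by (intro sum.mono_neutral_right) auto
          also have "\<dots> = M $$ (r, i) - M $$ (r, j)" using ij(4) by simp
          also have "\<dots> = 0"
          proof -
            have "i < dim_col M" "j < dim_col M" using J ij(1,2) by auto
            then have "M $$ (r, i) = M $$ (r, j)" using idx[of r i] idx[of r j] ij(3) r by simp
            then show ?thesis by simp
          qed
          finally show ?thesis .
        qed
        from indepD[OF ind this ij(1)] show False by simp
      qed
      have "lin_indpt (col M ` J)"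
      proof
        assume "lin_dep (col M ` J)"
        then obtain A a v where A: "finite A" "A \<subseteq> col M ` J" "lincomb a A = 0\<^sub>v nr" "v \<in> A" "a v \<noteq> 0"
          unfolding lin_dep_def by auto
        let ?c = "\<lambda>j. if col M j \<in> A then a (col M j) else 0"
        have "(\<Sum>k\<in>J. ?c k * M $$ (r, k)) = 0" if r: "r \<in> {..<nr}" for r
        proof -
          have "0 = lincomb a A $ r" using A(3) r by simp
          also have "\<dots> = (\<Sum>v\<in>A. a v * v $ r)" using r A(2) car[of J] by (intro lincomb_index) auto
          also have "\<dots> = (\<Sum>v\<in>col M ` J. (if v \<in> A then a v else 0) * v $ r)"
            using A fin by (intro sum.mono_neutral_cong_left) auto
          also have "\<dots> = (\<Sum>k\<in>J. ?c k * M $$ (r, k))"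
            using idx[of r] r J by (subst sum.reindex[OF inj]) (auto intro!: sum.cong)
          finally show ?thesis by simp
        qed
        moreover obtain j where "j \<in> J" "v = col M j" using A by auto
        ultimately show False using indepD[OF ind, of ?c j] A by auto
      qed
      then show "inj_on (col M) J \<and> lin_indpt (col M ` J)" using inj by simp
    qed
  qed
  then show ?thesis unfolding linear_matroid_def nr_def by auto
qed

type_synonym rpoly = "(nat \<Rightarrow>\<^sub>0 nat) \<Rightarrow>\<^sub>0 real"

definition ev :: "nat set \<Rightarrow> rpoly \<Rightarrow> real" where
  "ev W p = (\<Sum>m\<in>Poly_Mapping.keys p. if Poly_Mapping.keys m \<subseteq> W then Poly_Mapping.lookup p m else 0)"

lemma ev_superset:
  assumes "finite F" "Poly_Mapping.keys p \<subseteq> F"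
  shows "ev W p = (\<Sum>m\<in>F. if Poly_Mapping.keys m \<subseteq> W then Poly_Mapping.lookup p m else 0)"
  unfolding ev_def using assms by (intro sum.mono_neutral_left) (auto simp: in_keys_iff)

lemma ev_add: "ev W (p + q) = ev W p + ev W q"
proof -
  let ?F = "Poly_Mapping.keys p \<union> Poly_Mapping.keys q"
  have "Poly_Mapping.keys (p + q) \<subseteq> ?F" by (rule Poly_Mapping.keys_add)
  then have *: "ev W p = (\<Sum>m\<in>?F. if Poly_Mapping.keys m \<subseteq> W then Poly_Mapping.lookup p m else 0)"
    "ev W q = (\<Sum>m\<in>?F. if Poly_Mapping.keys m \<subseteq> W then Poly_Mapping.lookup q m else 0)"
    "ev W (p + q) = (\<Sum>m\<in>?F. if Poly_Mapping.keys m \<subseteq> W then Poly_Mapping.lookup (p + q) m else 0)"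
    by (intro ev_superset; simp)+
  show ?thesis unfolding * sum.distrib[symmetric] lookup_add by (rule sum.cong) auto
qed

lemma ev_0: "ev W 0 = 0" by (simp add: ev_def)

lemma ev_sum: "ev W (sum f A) = (\<Sum>a\<in>A. ev W (f a))"
  by (induction A rule: infinite_finite_induct) (auto simp: ev_add ev_0)

lemma ev_single: "ev W (Poly_Mapping.single m c) = (if Poly_Mapping.keys m \<subseteq> W then c else 0)"
  by (simp add: ev_def)

lemma poly_sum_singles: "p = (\<Sum>m\<in>Poly_Mapping.keys p. Poly_Mapping.single m (Poly_Mapping.lookup p m))"
proof (rule poly_mapping_eqI)
  fix k
  have "Poly_Mapping.lookup (\<Sum>m\<in>Poly_Mapping.keys p. Poly_Mapping.single m (Poly_Mapping.lookup p m)) k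
     = (\<Sum>m\<in>Poly_Mapping.keys p. if m = k then Poly_Mapping.lookup p m else 0)"
    unfolding lookup_sum lookup_single by (rule sum.cong) (auto simp: when_def)
  also have "\<dots> = Poly_Mapping.lookup p k" by (auto simp: in_keys_iff)
  finally show "Poly_Mapping.lookup p k = Poly_Mapping.lookup (\<Sum>m\<in>Poly_Mapping.keys p. Poly_Mapping.single m (Poly_Mapping.lookup p m)) k" by simp
qed

lemma keys_plus_nat: "Poly_Mapping.keys (m + m' :: nat \<Rightarrow>\<^sub>0 nat) = Poly_Mapping.keys m \<union> Poly_Mapping.keys m'"
  by (auto simp: in_keys_iff lookup_add)

lemma ev_mult: "ev W (p * q) = ev W p * ev W q"
proof -
  have "p * q = (\<Sum>m\<in>Poly_Mapping.keys p. \<Sum>m'\<in>Poly_Mapping.keys q.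
      Poly_Mapping.single (m + m') (Poly_Mapping.lookup p m * Poly_Mapping.lookup q m'))"
    by (subst poly_sum_singles[of p], subst poly_sum_singles[of q]) (simp add: sum_product mult_single)
  also have "ev W \<dots> = (\<Sum>m\<in>Poly_Mapping.keys p. \<Sum>m'\<in>Poly_Mapping.keys q.
      (if Poly_Mapping.keys m \<subseteq> W then Poly_Mapping.lookup p m else 0) * (if Poly_Mapping.keys m' \<subseteq> W then Poly_Mapping.lookup q m' else 0))"
    unfolding ev_sum ev_single keys_plus_nat by (intro sum.cong) auto
  also have "\<dots> = ev W p * ev W q" unfolding ev_def by (simp add: sum_product)
  finally show ?thesis .
qed

lemma ev_1: "ev W 1 = 1"
  using ev_single[of W 0 1] by simp

lemma ev_hom: "comm_ring_hom (ev W)"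
proof
  show "ev W (x + y) = ev W x + ev W y" "ev W (x * y) = ev W x * ev W y" "ev W 0 = 0" "ev W 1 = 1" for x y
    by (rule ev_add ev_mult ev_0 ev_1)+
qed

text \<open>Generic columns and matchings\<close>

definition adj :: "nat \<Rightarrow> (nat \<times> nat) set \<Rightarrow> nat set \<Rightarrow> nat \<Rightarrow> nat \<Rightarrow> bool" where
  "adj n T S r c \<longleftrightarrow> r < n \<and> (if c < n then r = c else if c < 2 * n then (r, c - n) \<in> T else c < 3 * n \<and> r \<in> S \<and> r = c - 2 * n)"

definition par :: "nat \<Rightarrow> nat \<Rightarrow> nat \<Rightarrow> nat" where
  "par n r c = (if c < 2 * n then r * n + (c - n) else n * n + r)"

definition gent :: "nat \<Rightarrow> (nat \<times> nat) set \<Rightarrow> nat set \<Rightarrow> nat \<Rightarrow> nat \<Rightarrow> rpoly" where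
  "gent n T S c r = (if adj n T S r c then if c < n then 1 else Poly_Mapping.single (Poly_Mapping.single (par n r c) 1) 1 else 0)"

lemma par_inj:
  assumes "r < n" "r' < n" "n \<le> c" "n \<le> c'" "par n r c = par n r' c'"
    "c < 2 * n \<or> c - 2 * n = r" "c' < 2 * n \<or> c' - 2 * n = r'"
  shows "r = r'" "c = c'"
proof -
  have lt: "r * n + (c - n) < n * n" if "r < n" "n \<le> c" "c < 2 * n" for r c
  proof -
    have "r * n + (c - n) < (r + 1) * n" using that by (simp add: algebra_simps)
    also have "\<dots> \<le> n * n" using that by (intro mult_le_mono1) simp
    finally show ?thesis .
  qed
  have dm: "(r * n + (c - n)) div n = r" "(r * n + (c - n)) mod n = c - n" if "r < n" "n \<le> c" "c < 2 * n" for r c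
  proof -
    have "c - n < n" using that by linarith
    then show "(r * n + (c - n)) div n = r" "(r * n + (c - n)) mod n = c - n" by simp_all
  qed
  consider "c < 2 * n" "c' < 2 * n" | "c < 2 * n" "\<not> c' < 2 * n" | "\<not> c < 2 * n" "c' < 2 * n" | "\<not> c < 2 * n" "\<not> c' < 2 * n" by blast
  then have "r = r' \<and> c = c'"
  proof cases
    case 1
    then have "r * n + (c - n) = r' * n + (c' - n)" using assms(5) by (simp add: par_def)
    then have "r = r'" "c - n = c' - n" using dm[of r c] dm[of r' c'] 1 assms by metis+
    then show ?thesis using assms by simp
  next
    case 2 then show ?thesis using lt[of r c] assms by (simp add: par_def)
  next
    case 3 then show ?thesis using lt[of r' c'] assms by (simp add: par_def)
  next
    case 4 then show ?thesis using assms by (auto simp: par_def)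
  qed
  then show "r = r'" "c = c'" by auto
qed

lemma indep_if_matching:
  assumes fin: "finite J" and g: "inj_on g J" "\<And>c. c \<in> J \<Longrightarrow> adj n T S (g c) c"
  shows "indep {..<n} (\<lambda>c r. to_fract (gent n T S c r)) J"
proof -
  define W where "W = {par n (g c) c | c. c \<in> J \<and> n \<le> c}"
  define k where "k = card J"
  obtain h where h: "bij_betw h {0..<k} J" using ex_bij_betw_nat_finite[OF fin] unfolding k_def by blast
  have hJ: "h s \<in> J" if "s < k" for s using h that by (auto simp: bij_betw_def)
  have hinj: "h s = h s' \<Longrightarrow> s < k \<Longrightarrow> s' < k \<Longrightarrow> s = s'" for s s' using h by (auto simp: bij_betw_def inj_on_def)
  define K where "K = mat k k (\<lambda>(r, s). gent n T S (h s) (g (h r)))"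
  have Kc: "K \<in> carrier_mat k k" by (simp add: K_def)
  interpret ev: comm_ring_hom "ev W" by (rule ev_hom)
  have "map_mat (ev W) K = 1\<^sub>m k"
  proof (rule eq_matI)
    fix r s assume "r < dim_row (1\<^sub>m k :: real mat)" "s < dim_col (1\<^sub>m k :: real mat)"
    then have rs: "r < k" "s < k" by auto
    let ?c = "h s" and ?c' = "h r"
    have J: "?c \<in> J" "?c' \<in> J" using hJ rs by auto
    have "ev W (gent n T S ?c (g ?c')) = (if r = s then 1 else 0)"
    proof (cases "r = s")
      case True
      then have "adj n T S (g ?c') ?c" using g(2)[OF J(2)] by simp
      moreover have "n \<le> ?c \<Longrightarrow> par n (g ?c') ?c \<in> W" using True J unfolding W_def by auto
      ultimately show ?thesis using True by (auto simp: gent_def ev_single ev_1)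
    next
      case False
      then have ne: "?c \<noteq> ?c'" using hinj rs by blast
      show ?thesis
      proof (cases "adj n T S (g ?c') ?c")
        case True
        have cn: "n \<le> ?c"
        proof (rule ccontr)
          assume "\<not> n \<le> ?c"
          then have "g ?c' = ?c" "g ?c = ?c" using True g(2)[OF J(1)] by (auto simp: adj_def)
          then show False using g(1) J ne by (auto simp: inj_on_def)
        qed
        have "par n (g ?c') ?c \<notin> W"
        proof
          assume "par n (g ?c') ?c \<in> W"
          then obtain c2 where c2: "c2 \<in> J" "n \<le> c2" "par n (g ?c') ?c = par n (g c2) c2" unfolding W_def by auto
          note a2 = g(2)[OF c2(1)]
          have "g ?c' = g c2" "?c = c2"
            using par_inj[OF _ _ cn c2(2,3)] True a2 by (auto simp: adj_def split: if_splits)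
          then show False using g(1) J c2 ne by (auto simp: inj_on_def)
        qed
        then show ?thesis using cn False True by (simp add: gent_def ev_single)
      next
        case f: False
        then show ?thesis using False by (simp add: gent_def ev_0)
      qed
    qed
    then show "map_mat (ev W) K $$ (r, s) = 1\<^sub>m k $$ (r, s)" using rs by (simp add: K_def)
  qed (auto simp: K_def)
  then have "ev W (det K) = 1" using ev.hom_det[of K] by (simp add: det_one)
  then have det: "det K \<noteq> 0" using ev_0 by (metis zero_neq_one)
  let ?F = "map_mat to_fract K"
  interpret fr: inj_comm_ring_hom "to_fract :: rpoly \<Rightarrow> ratfun" by (unfold_locales, auto)
  have "det ?F = to_fract (det K)" by (rule fr.hom_det)
  then have detF: "det ?F \<noteq> 0" using det by simp
  have Fc: "?F \<in> carrier_mat k k" using Kc by simp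
  show ?thesis unfolding indep_def
  proof (intro conjI allI impI ballI)
    show "finite J" by fact
    fix c j assume c: "\<forall>r\<in>{..<n}. (\<Sum>j\<in>J. c j * to_fract (gent n T S j r)) = 0" and j: "j \<in> J"
    define v where "v = vec k (\<lambda>s. c (h s))"
    have "?F *\<^sub>v v = 0\<^sub>v k"
    proof (rule eq_vecI)
      fix r assume "r < dim_vec (0\<^sub>v k :: ratfun vec)"
      then have r: "r < k" by simp
      have gr: "g (h r) < n" using g(2)[OF hJ[OF r]] by (simp add: adj_def)
      have "(?F *\<^sub>v v) $ r = (\<Sum>s = 0..<k. to_fract (gent n T S (h s) (g (h r))) * c (h s))"
        using r by (simp add: K_def v_def scalar_prod_def)
      also have "\<dots> = (\<Sum>j\<in>J. to_fract (gent n T S j (g (h r))) * c j)"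
        using sum.reindex_bij_betw[OF h, of "\<lambda>j. to_fract (gent n T S j (g (h r))) * c j"] by simp
      also have "\<dots> = 0" using c gr by (simp add: mult.commute)
      finally show "(?F *\<^sub>v v) $ r = 0\<^sub>v k $ r" using r by simp
    qed (simp add: K_def)
    then have "v = 0\<^sub>v k" using detF det_0_iff_vec_prod_zero_field[OF Fc] by (metis v_def vec_carrier)
    moreover obtain s where "s < k" "h s = j" using h j by (auto simp: bij_betw_def)
    ultimately show "c j = 0" unfolding v_def by (metis index_vec index_zero_vec(1))
  qed
qed

lemma unit_indep: "finite A \<Longrightarrow> A \<subseteq> P \<Longrightarrow> indep P (\<lambda>a p. if a = p then 1 else (0::'a::field)) A"
  unfolding indep_def
proof (intro conjI allI impI ballI)
  fix c a assume "finite A" "A \<subseteq> P" "\<forall>p\<in>P. (\<Sum>a\<in>A. c a * (if a = p then 1 else (0::'a))) = 0" "a \<in> A"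
  moreover have "(\<Sum>b\<in>A. c b * (if b = a then 1 else (0::'a))) = (\<Sum>b\<in>A. if b = a then c b else 0)"
    by (rule sum.cong) auto
  ultimately show "c a = 0" by (auto simp: subset_iff)
qed

text \<open>Independent columns can be matched to rows with nonzero entries.\<close>

lemma matching_if_indep:
  fixes v :: "nat \<Rightarrow> nat \<Rightarrow> 'a::field"
  assumes ind: "indep {..<n} v J" and J: "J \<subseteq> {..<l}"
  shows "\<exists>g. inj_on g J \<and> (\<forall>c\<in>J. g c < n \<and> v c (g c) \<noteq> 0)"
proof -
  define N where "N c r \<longleftrightarrow> v c r \<noteq> 0" for c r
  define w where "w a p = (if a = p \<and> p < n then 1 else (0::real))" for a p :: nat
  interpret rado l n n n N w "\<lambda>_. False" by unfold_locales (auto simp: w_def)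
  have wind: "indep {..<n + l} w A" if "A \<subseteq> {..<n}" for A
  proof -
    have "indep {..<n + l} (\<lambda>a p. if a = p then 1 else (0::real)) A"
      using that by (intro unit_indep) (auto intro: finite_subset)
    moreover have "indep {..<n + l} (\<lambda>a p. if a = p then 1 else (0::real)) A = indep {..<n + l} w A"
      using that by (intro indep_cong) (auto simp: w_def)
    ultimately show ?thesis by simp
  qed
  have "K \<subseteq> J \<Longrightarrow> matchable K" if "finite K" for K
    using that
  proof (induction K rule: finite_induct)
    case empty
    show ?case unfolding matchable_def transversal_def by (auto simp: indep_empty)
  next
    case (insert i K)
    show ?case
    proof (rule ccontr)
      assume "\<not> matchable (insert i K)"
      then obtain X where X: "X \<subseteq> insert i K" "\<And>A. A \<subseteq> nbrs X \<Longrightarrow> indep {..<n + l} w A \<Longrightarrow> card A < card X"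
        using deficient_set[of K i] insert J by auto
      have nb: "nbrs X \<subseteq> {..<n}" unfolding nbrs_def by auto
      have "card (nbrs X) < card X" using X(2)[OF order_refl wind[OF nb]] .
      moreover have "card X \<le> card (nbrs X)"
      proof (rule indep_card_support[OF indep_subset[OF ind]])
        show "X \<subseteq> J" using X insert by auto
        show "nbrs X \<subseteq> {..<n}" by fact
        show "finite (nbrs X)" using nb finite_subset by blast
        show "v a p = 0" if "a \<in> X" "p \<in> {..<n}" "p \<notin> nbrs X" for a p
          using that unfolding nbrs_def N_def by auto
      qed
      ultimately show False by simp
    qed
  qed
  then have "matchable J" using indep_finite[OF ind] by blast
  then obtain g where "transversal J g" unfolding matchable_def ..
  then have "inj_on g J" "\<forall>c\<in>J. g c < n \<and> N c (g c)" unfolding transversal_def by simp_all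
  then show ?thesis unfolding N_def by (intro exI[of _ g]) simp
qed

lemma T_indep_iff:
  assumes "J \<subseteq> {..<3 * n}"
  shows "indep {..<n} (\<lambda>c r. to_fract (gent n T S c r)) J \<longleftrightarrow> (\<exists>g. inj_on g J \<and> (\<forall>c\<in>J. adj n T S (g c) c))"
proof
  assume "indep {..<n} (\<lambda>c r. to_fract (gent n T S c r)) J"
  from matching_if_indep[OF this assms] obtain g where "inj_on g J" "\<forall>c\<in>J. g c < n \<and> to_fract (gent n T S c (g c)) \<noteq> 0" by blast
  then show "\<exists>g. inj_on g J \<and> (\<forall>c\<in>J. adj n T S (g c) c)"
    by (intro exI[of _ g]) (auto simp: gent_def split: if_splits)
next
  assume "\<exists>g. inj_on g J \<and> (\<forall>c\<in>J. adj n T S (g c) c)"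
  then obtain g where g: "inj_on g J" "\<forall>c\<in>J. adj n T S (g c) c" by auto
  have "finite J" using assms finite_subset by auto
  then show "indep {..<n} (\<lambda>c r. to_fract (gent n T S c r)) J"
    by (rule indep_if_matching[OF _ g(1)]) (use g(2) in simp)
qed



lemma ex_max_card:
  assumes "finite F" "X0 \<in> F"
  shows "\<exists>X\<in>F. \<forall>X'\<in>F. card X' \<le> card X"
proof -
  have "Max (card ` F) \<in> card ` F" using assms by (intro Max_in) auto
  then obtain X where "X \<in> F" "card X = Max (card ` F)" by auto
  then show ?thesis using assms(1) by (intro bexI[of _ X]) auto
qed

definition pvec :: "nat \<Rightarrow> (nat \<Rightarrow> nat \<Rightarrow> real) \<Rightarrow> (nat \<Rightarrow> nat \<Rightarrow> real) \<Rightarrow> nat \<Rightarrow> nat \<Rightarrow> real" where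
  "pvec n Q Y a p = (if a < n then (if p < n then Q a p else 0)
     else if a < 2 * n then (if p < n \<and> p = a - n then 1 else 0)
     else (if a < 3 * n \<and> n \<le> p \<and> p < 2 * n then Y (a - 2 * n) (p - n) else 0))"

definition pN :: "nat \<Rightarrow> (nat \<times> nat) set \<Rightarrow> (nat \<Rightarrow> bool) \<Rightarrow> nat \<Rightarrow> nat \<Rightarrow> bool" where
  "pN n T Yf k a \<longleftrightarrow> (if a < n then a = k else if a < 2 * n then (k, a - n) \<in> T else a = 2 * n + k \<and> Yf k)"

lemma rado_Y: "rado (3 * n) (2 * n) (2 * n) (pvec n Q Y)"
  by unfold_locales (auto simp: pvec_def)

lemma rado_0: "rado (3 * n) n (2 * n) (pvec n Q (\<lambda>_ _. 0))"
  by unfold_locales (auto simp: pvec_def)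

definition colv :: "nat \<Rightarrow> (nat \<Rightarrow> nat \<Rightarrow> real) \<Rightarrow> nat \<Rightarrow> nat \<Rightarrow> real" where
  "colv n Q c r = (if c < n then if r = c then 1 else 0 else if c < 2 * n then Q r (c - n) else 0)"

text \<open>Rows of Q over I against columns of I beside Q: duality\<close>

lemma sum_pvec:
  assumes "Z \<subseteq> {..<2 * n}" "p < n"
  shows "(\<Sum>a\<in>Z. c a * pvec n Q Y a p) = (\<Sum>a\<in>{..<n}. (if a \<in> Z then c a else 0) * Q a p) + (if n + p \<in> Z then c (n + p) else 0)"
proof -
  have f: "finite Z" using assms finite_subset by blast
  have Z: "Z = (Z \<inter> {..<n}) \<union> (Z \<inter> {n..})" by auto
  have "(\<Sum>a\<in>Z. c a * pvec n Q Y a p) = (\<Sum>a\<in>Z \<inter> {..<n}. c a * pvec n Q Y a p) + (\<Sum>a\<in>Z \<inter> {n..}. c a * pvec n Q Y a p)"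
    by (subst Z, subst sum.union_disjoint) (use f in auto)
  moreover have "(\<Sum>a\<in>Z \<inter> {..<n}. c a * pvec n Q Y a p) = (\<Sum>a\<in>{..<n}. (if a \<in> Z then c a else 0) * Q a p)"
    using assms(2) by (intro sum.mono_neutral_cong_left) (auto simp: pvec_def)
  moreover have "(\<Sum>a\<in>Z \<inter> {n..}. c a * pvec n Q Y a p) = (\<Sum>a\<in>Z \<inter> {n..}. if a = n + p then c a else 0)"
    using assms by (intro sum.cong) (auto simp: pvec_def)
  moreover have "\<dots> = (if n + p \<in> Z then c (n + p) else 0)" using f by auto
  ultimately show ?thesis by simp
qed

lemma sum_colv:
  assumes "c < 2 * n"
  shows "(\<Sum>p\<in>{..<n}. y p * colv n Q c p) = (if c < n then y c else (\<Sum>p\<in>{..<n}. y p * Q p (c - n)))"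
proof (cases "c < n")
  case True
  have "(\<Sum>p\<in>{..<n}. y p * colv n Q c p) = (\<Sum>p\<in>{..<n}. if p = c then y p else 0)"
    using True by (intro sum.cong) (auto simp: colv_def)
  then show ?thesis using True by simp
next
  case False then show ?thesis using assms by (simp add: colv_def)
qed

lemma coindep:
  assumes Z: "Z \<subseteq> {..<2 * n}"
  shows "indep {..<n} (pvec n Q Y) Z \<longleftrightarrow> (\<exists>X \<subseteq> {..<2 * n} - Z. card X = n \<and> indep {..<n} (colv n Q) X)"
proof
  assume "\<exists>X \<subseteq> {..<2 * n} - Z. card X = n \<and> indep {..<n} (colv n Q) X"
  then obtain X where X: "X \<subseteq> {..<2 * n} - Z" "card X = n" "indep {..<n} (colv n Q) X" by blast
  show "indep {..<n} (pvec n Q Y) Z" unfolding indep_def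
  proof (intro conjI allI impI ballI)
    show "finite Z" using Z finite_subset by blast
    fix c a assume c: "\<forall>p\<in>{..<n}. (\<Sum>a\<in>Z. c a * pvec n Q Y a p) = 0" and a: "a \<in> Z"
    define y where "y i = (if i \<in> Z then c i else 0)" for i
    have eq: "(\<Sum>i\<in>{..<n}. y i * Q i p) + (if n + p \<in> Z then c (n + p) else 0) = 0" if "p < n" for p
      using c that sum_pvec[OF Z that, of c Q Y] unfolding y_def by simp
    have "(\<Sum>p\<in>{..<n}. y p * colv n Q x p) = 0" if x: "x \<in> X" for x
    proof (cases "x < n")
      case True
      then show ?thesis using X(1) x sum_colv[of x n y Q] unfolding y_def by auto
    next
      case False
      then have "x - n < n" "n + (x - n) \<notin> Z" using X(1) x by auto
      then show ?thesis using eq[of "x - n"] X(1) x sum_colv[of x n y Q] False by auto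
    qed
    then have y0: "y p = 0" if "p < n" for p
      using indep_orthogonal[OF X(3), of y p] X(2) that by simp
    show "c a = 0"
    proof (cases "a < n")
      case True then show ?thesis using y0[OF True] a unfolding y_def by simp
    next
      case False
      then have an: "a - n < n" "n + (a - n) = a" using a Z by auto
      have "(\<Sum>i\<in>{..<n}. y i * Q i (a - n)) = 0" using y0 by simp
      then show ?thesis using eq[OF an(1)] a unfolding an(2) by simp
    qed
  qed
next
  assume ind: "indep {..<n} (pvec n Q Y) Z"
  let ?C = "{..<2 * n} - Z"
  define F where "F = {X. X \<subseteq> ?C \<and> indep {..<n} (colv n Q) X}"
  have "finite F" unfolding F_def by (rule finite_subset[of _ "Pow ?C"]) auto
  moreover have "{} \<in> F" unfolding F_def by (simp add: indep_empty)
  ultimately obtain X where X: "X \<in> F" "\<And>X'. X' \<in> F \<Longrightarrow> card X' \<le> card X"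
    using ex_max_card[of F] by blast
  then have XC: "X \<subseteq> ?C" "indep {..<n} (colv n Q) X" unfolding F_def by auto
  have "card X \<le> n" using indep_card[OF XC(2)] by simp
  moreover have "\<not> card X < n"
  proof
    assume lt: "card X < n"
    obtain y where y: "\<And>x. x \<in> X \<Longrightarrow> (\<Sum>p\<in>{..<n}. y p * colv n Q x p) = 0" "\<exists>p\<in>{..<n}. y p \<noteq> 0"
      using ex_orthogonal[of "{..<n}" X "colv n Q"] lt indep_finite[OF XC(2)] by auto
    have orth: "(\<Sum>p\<in>{..<n}. y p * colv n Q x p) = 0" if x: "x \<in> ?C" for x
    proof (cases "x \<in> X")
      case True then show ?thesis using y by simp
    next
      case False
      have "\<not> indep {..<n} (colv n Q) (insert x X)"
      proof
        assume "indep {..<n} (colv n Q) (insert x X)"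
        then have "insert x X \<in> F" using XC x unfolding F_def by auto
        from X(2)[OF this] show False using False indep_finite[OF XC(2)] by simp
      qed
      from dependent_insert[OF XC(2) this] obtain e where e: "\<forall>p\<in>{..<n}. colv n Q x p = (\<Sum>a\<in>X. e a * colv n Q a p)" ..
      have "(\<Sum>p\<in>{..<n}. y p * colv n Q x p) = (\<Sum>p\<in>{..<n}. \<Sum>a\<in>X. e a * (y p * colv n Q a p))"
        by (rule sum.cong) (auto simp: e sum_distrib_left mult.left_commute)
      also have "\<dots> = (\<Sum>a\<in>X. e a * (\<Sum>p\<in>{..<n}. y p * colv n Q a p))"
        by (subst sum.swap) (simp add: sum_distrib_left)
      also have "\<dots> = 0" using y(1) by simp
      finally show ?thesis .
    qed
    define c where "c a = (if a < n then y a else - (\<Sum>p\<in>{..<n}. y p * Q p (a - n)))" for a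
    have y0: "y i = 0" if "i < n" "i \<notin> Z" for i
      using orth[of i] sum_colv[of i n y Q] that by auto
    have yZ: "(\<Sum>a\<in>{..<n}. (if a \<in> Z then c a else 0) * Q a p) = (\<Sum>a\<in>{..<n}. y a * Q a p)" for p
      by (rule sum.cong) (auto simp: c_def y0)
    have "(\<Sum>a\<in>Z. c a * pvec n Q Y a p) = 0" if p: "p \<in> {..<n}" for p
    proof (cases "n + p \<in> Z")
      case True
      then show ?thesis using p sum_pvec[OF Z, of p c Q Y] unfolding yZ by (simp add: c_def)
    next
      case False
      then have "(\<Sum>a\<in>{..<n}. y a * Q a p) = 0" using orth[of "n + p"] sum_colv[of "n + p" n y Q] p by auto
      then show ?thesis using p False sum_pvec[OF Z, of p c Q Y] unfolding yZ by simp
    qed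
    then have c0: "c a = 0" if "a \<in> Z" for a using indepD[OF ind _ that] by blast
    obtain p where p: "p < n" "y p \<noteq> 0" using y(2) by auto
    then have "p \<in> Z" using y0 by blast
    then show False using c0[of p] p by (simp add: c_def)
  qed
  ultimately show "\<exists>X \<subseteq> ?C. card X = n \<and> indep {..<n} (colv n Q) X" using XC by (intro exI[of _ X]) auto
qed

lemma indep_restrict:
  assumes "P' \<subseteq> P" "\<And>a p. a \<in> A \<Longrightarrow> p \<in> P \<Longrightarrow> p \<notin> P' \<Longrightarrow> v a p = 0"
  shows "indep P v A = indep P' v A"
proof -
  have "(\<forall>p\<in>P. (\<Sum>a\<in>A. c a * v a p) = 0) = (\<forall>p\<in>P'. (\<Sum>a\<in>A. c a * v a p) = 0)" for c
  proof
    assume r: "\<forall>p\<in>P'. (\<Sum>a\<in>A. c a * v a p) = 0"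
    show "\<forall>p\<in>P. (\<Sum>a\<in>A. c a * v a p) = 0"
    proof
      fix p assume p: "p \<in> P"
      show "(\<Sum>a\<in>A. c a * v a p) = 0"
        by (cases "p \<in> P'") (use r assms(2) p in auto)
    qed
  qed (use assms(1) in auto)
  then show ?thesis unfolding indep_def by simp
qed

definition matchA :: "nat \<Rightarrow> (nat \<times> nat) set \<Rightarrow> (nat \<Rightarrow> nat \<Rightarrow> real) \<Rightarrow> nat set \<Rightarrow> bool" where
  "matchA n T Q R \<longleftrightarrow> (\<exists>f. R \<subseteq> {..<n} \<and> inj_on f R \<and> (\<forall>i\<in>R. f i < 2 * n \<and> pN n T (\<lambda>_. False) i (f i)) \<and>
     indep {..<n} (pvec n Q (\<lambda>_ _. 0)) (f ` R))"

lemma matchable_iff: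
  "rado.matchable n (3 * n) (2 * n) (pN n T (\<lambda>_. False)) (pvec n Q (\<lambda>_ _. 0)) R \<longleftrightarrow> matchA n T Q R"
proof -
  interpret A: rado n "3 * n" n "2 * n" "pN n T (\<lambda>_. False)" "pvec n Q (\<lambda>_ _. 0)" "\<lambda>_. False"
    by (rule rado_0)
  have "indep {..<A.D} (pvec n Q (\<lambda>_ _. 0)) B = indep {..<n} (pvec n Q (\<lambda>_ _. 0)) B" for B
    by (rule indep_restrict) (auto simp: pvec_def)
  moreover have "(f i < 3 * n \<and> pN n T (\<lambda>_. False) i (f i)) = (f i < 2 * n \<and> pN n T (\<lambda>_. False) i (f i))" for f i
    by (auto simp: pN_def)
  ultimately show ?thesis unfolding A.matchable_def A.transversal_def matchA_def by simp
qed

lemma matchA_augment: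
  assumes "matchA n T Q R" "matchA n T Q S" "card R < card S"
  shows "\<exists>i<n. i \<notin> R \<and> matchA n T Q (insert i R)"
proof -
  interpret A: rado n "3 * n" n "2 * n" "pN n T (\<lambda>_. False)" "pvec n Q (\<lambda>_ _. 0)" "\<lambda>_. False"
    by (rule rado_0)
  show ?thesis using A.matchable_augment[of R S] assms unfolding matchable_iff by simp
qed

lemma matchA_subset:
  assumes "matchA n T Q R" "S \<subseteq> R"
  shows "matchA n T Q S"
proof -
  interpret A: rado n "3 * n" n "2 * n" "pN n T (\<lambda>_. False)" "pvec n Q (\<lambda>_ _. 0)" "\<lambda>_. False"
    by (rule rado_0)
  show ?thesis using A.matchable_subset[of R S] assms unfolding matchable_iff by simp
qed

lemma matchA_sub: "matchA n T Q R \<Longrightarrow> R \<subseteq> {..<n}"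
  unfolding matchA_def by blast

lemma matchA_finite: "matchA n T Q R \<Longrightarrow> finite R"
  by (rule finite_subset[OF matchA_sub]) simp_all

lemma matchA_empty: "matchA n T Q {}"
  unfolding matchA_def by (simp add: indep_empty)

definition I1 where "I1 n Q = {X. X \<subseteq> {..<2 * n} \<and> indep {..<n} (colv n Q) X}"
definition I2 where "I2 n T S = {Y. Y \<subseteq> {..<3 * n} \<and> (\<exists>g. inj_on g Y \<and> (\<forall>c\<in>Y. adj n T S (g c) c))}"

lemma finite_union_family: "finite (matroid_union (I1 n Q) (I2 n T S))"
proof (rule finite_subset)
  show "matroid_union (I1 n Q) (I2 n T S) \<subseteq> Pow {..<3 * n}"
    unfolding matroid_union_def I1_def I2_def by auto
qed simp

lemma union_rank_lower:
  assumes R: "matchA n T Q R" and S: "S \<subseteq> {..<n}"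
  shows "n + card (R \<union> S) \<le> family_rank (matroid_union (I1 n Q) (I2 n T S))"
proof -
  obtain f where f: "R \<subseteq> {..<n}" "inj_on f R" "\<And>i. i \<in> R \<Longrightarrow> f i < 2 * n \<and> pN n T (\<lambda>_. False) i (f i)"
    "indep {..<n} (pvec n Q (\<lambda>_ _. 0)) (f ` R)" using R unfolding matchA_def by blast
  have sub: "f ` R \<subseteq> {..<2 * n}" using f(3) by auto
  obtain X where X: "X \<subseteq> {..<2 * n} - f ` R" "card X = n" "indep {..<n} (colv n Q) X"
    using f(4) coindep[OF sub, of Q "\<lambda>_ _. 0"] by blast
  define Z where "Z = (\<lambda>i. 2 * n + i) ` (S - R)"
  define Y where "Y = f ` R \<union> Z"
  define g where "g c = (if c < 2 * n then inv_into R f c else c - 2 * n)" for c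
  have fin: "finite R" "finite S" using f(1) S finite_subset by auto
  have gf: "g (f i) = i" if "i \<in> R" for i using f(2,3) that by (simp add: g_def)
  have gZ: "g (2 * n + i) = i" for i by (simp add: g_def)
  have "inj_on g Y" unfolding Y_def Z_def by (intro inj_onI) (auto simp: gf gZ)
  moreover have adj: "adj n T S (g c) c" if "c \<in> Y" for c
    using that unfolding Y_def
  proof
    assume "c \<in> f ` R"
    then obtain i where i: "i \<in> R" "c = f i" by auto
    then show ?thesis using f(1) f(3)[OF i(1)] gf[OF i(1)] unfolding adj_def pN_def by (auto split: if_splits)
  next
    assume "c \<in> Z"
    then obtain i where i: "i \<in> S" "c = 2 * n + i" unfolding Z_def by auto
    then show ?thesis using S gZ unfolding adj_def by auto
  qed
  moreover have "Y \<subseteq> {..<3 * n}"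
  proof
    fix c assume "c \<in> Y"
    from adj[OF this] show "c \<in> {..<3 * n}" by (auto simp: adj_def split: if_splits)
  qed
  ultimately have "Y \<in> I2 n T S" unfolding I2_def by blast
  moreover have "X \<in> I1 n Q" unfolding I1_def using X by auto
  ultimately have U: "X \<union> Y \<in> matroid_union (I1 n Q) (I2 n T S)" unfolding matroid_union_def by blast
  have "finite X" using X(1) finite_subset by blast
  have cZ: "card Z = card (S - R)" unfolding Z_def by (intro card_image) (auto intro: inj_onI)
  have "card Y = card R + card (S - R)"
    unfolding Y_def using fin f(2) sub cZ by (subst card_Un_disjoint) (auto simp: card_image Z_def)
  moreover have "card (R \<union> S) = card R + card (S - R)"
    using fin by (subst card_Un_disjoint[symmetric]) (auto intro: arg_cong[of _ _ card])
  moreover have "card (X \<union> Y) = card X + card Y"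
    using fin X(1) \<open>finite X\<close> unfolding Y_def Z_def by (intro card_Un_disjoint) auto
  ultimately have "n + card (R \<union> S) = card (X \<union> Y)" using X(2) by simp
  also have "\<dots> \<le> family_rank (matroid_union (I1 n Q) (I2 n T S))"
    unfolding family_rank_def using U finite_union_family by (intro Max_ge) auto
  finally show ?thesis .
qed

lemma unit_colv: "indep {..<n} (colv n Q) {..<n}"
proof -
  have "indep {..<n} (\<lambda>a p. if a = p then 1 else (0::real)) {..<n}" by (rule unit_indep) auto
  moreover have "indep {..<n} (\<lambda>a p. if a = p then 1 else (0::real)) {..<n} = indep {..<n} (colv n Q) {..<n}"
    by (rule indep_cong) (auto simp: colv_def)
  ultimately show ?thesis by simp
qed

lemma union_rank_upper:
  assumes True: "finite S"
  shows "\<exists>R. matchA n T Q R \<and> family_rank (matroid_union (I1 n Q) (I2 n T S)) \<le> n + card (R \<union> S)"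
proof -
  let ?U = "matroid_union (I1 n Q) (I2 n T S)"
  have "{} \<in> I1 n Q" unfolding I1_def by (simp add: indep_empty)
  moreover have "{} \<in> I2 n T S" unfolding I2_def by simp
  ultimately have "{} \<in> ?U" unfolding matroid_union_def by force
  then have "family_rank ?U \<in> card ` ?U" unfolding family_rank_def using finite_union_family by (intro Max_in) auto
  then obtain X Y where XY: "X \<in> I1 n Q" "Y \<in> I2 n T S" "family_rank ?U = card (X \<union> Y)" unfolding matroid_union_def by auto
  have Xi: "indep {..<n} (colv n Q) X" and X2: "X \<subseteq> {..<2 * n}" using XY(1) unfolding I1_def by auto
  have "card X \<le> card {..<n}" using indep_card[OF Xi] by simp
  from indep_extend[OF Xi unit_colv this] obtain B where B: "X \<subseteq> B" "B \<subseteq> X \<union> {..<n}" "indep {..<n} (colv n Q) B" "card B = n" by auto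
  obtain g where Y: "Y \<subseteq> {..<3 * n}" and g: "inj_on g Y" "\<And>c. c \<in> Y \<Longrightarrow> adj n T S (g c) c" using XY(2) unfolding I2_def by blast
  have fin: "finite Y" "finite B" using Y finite_subset indep_finite[OF B(3)] by auto
  define Z where "Z = {c \<in> Y. c < 2 * n \<and> c \<notin> B}"
  define W where "W = {c \<in> Y. 2 * n \<le> c}"
  have ZW: "finite Z" "finite W" "Z \<inter> W = {}" "Z \<union> W \<subseteq> Y" using fin unfolding Z_def W_def by auto
  have Z2: "Z \<subseteq> {..<2 * n}" unfolding Z_def by auto
  have B2: "B \<subseteq> {..<2 * n} - Z" using B(2) X2 unfolding Z_def by auto
  have Zind: "indep {..<n} (pvec n Q (\<lambda>_ _. 0)) Z" using coindep[OF Z2] B2 B(3,4) by blast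
  define R where "R = g ` Z"
  have gZ: "inj_on g Z" using g(1) ZW(4) by (auto intro: inj_on_subset)
  have ginv: "inv_into Z g (g c) = c" if "c \<in> Z" for c using gZ that by simp
  have "matchA n T Q R" unfolding matchA_def
  proof (intro exI[of _ "inv_into Z g"] conjI)
    show "R \<subseteq> {..<n}" using g(2) ZW(4) unfolding R_def adj_def by auto
    show "inj_on (inv_into Z g) R" unfolding R_def by (simp add: inj_on_inv_into)
    show "\<forall>i\<in>R. inv_into Z g i < 2 * n \<and> pN n T (\<lambda>_. False) i (inv_into Z g i)"
    proof
      fix i assume "i \<in> R"
      then obtain c where c: "c \<in> Z" "i = g c" unfolding R_def by auto
      have "adj n T S (g c) c" using g(2) c ZW(4) by auto
      then show "inv_into Z g i < 2 * n \<and> pN n T (\<lambda>_. False) i (inv_into Z g i)"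
        using c ginv[OF c(1)] Z2 unfolding adj_def pN_def by (auto split: if_splits)
    qed
    have "inv_into Z g ` R = Z" unfolding R_def using ginv by force
    then show "indep {..<n} (pvec n Q (\<lambda>_ _. 0)) (inv_into Z g ` R)" using Zind by simp
  qed
  moreover have "g ` W \<subseteq> S - R"
  proof
    fix i assume "i \<in> g ` W"
    then obtain c where c: "c \<in> W" "i = g c" by auto
    then have "i \<in> S" using g(2)[of c] unfolding W_def adj_def by (auto split: if_splits)
    moreover have "i \<notin> R"
    proof
      assume "i \<in> R"
      then obtain c' where "c' \<in> Z" "g c' = g c" using c unfolding R_def by auto
      then have "c' = c" using inj_onD[OF g(1)] ZW(4) c(1) by blast
      then show False using \<open>c' \<in> Z\<close> c(1) ZW(3) by blast
    qed
    ultimately show "i \<in> S - R" by simp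
  qed
  moreover have "family_rank ?U \<le> n + card (R \<union> S)"
  proof -
    have "card (X \<union> Y) \<le> card (B \<union> (Z \<union> W))"
      using B(1) fin ZW by (intro card_mono) (auto simp: Z_def W_def)
    also have "\<dots> \<le> card B + (card Z + card W)" by (meson add_left_mono card_Un_le le_trans)
    also have "card W = card (g ` W)" using g(1) ZW(4) by (intro card_image[symmetric]) (auto intro: inj_on_subset)
    also have "card Z = card R" unfolding R_def using gZ by (simp add: card_image)
    also have "card B + (card R + card (g ` W)) \<le> n + (card R + card (S - R))"
      using \<open>g ` W \<subseteq> S - R\<close> True B(4) by (simp add: card_mono)
    also have "card R + card (S - R) = card (R \<union> S)"
      using ZW(1) True unfolding R_def by (subst card_Un_disjoint[symmetric]) (auto intro: arg_cong[of _ _ card])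
    finally show ?thesis using XY(3) by simp
  qed
  ultimately show ?thesis by blast
qed

lemma append_cols_dim: "A \<in> carrier_mat n a \<Longrightarrow> B \<in> carrier_mat n b \<Longrightarrow> A @\<^sub>c B \<in> carrier_mat n (a + b)"
  unfolding append_cols_def by (auto intro!: carrier_matI)

lemma append_cols_index:
  assumes "A \<in> carrier_mat n a" "B \<in> carrier_mat n b" "r < n" "j < a + b"
  shows "(A @\<^sub>c B) $$ (r, j) = (if j < a then A $$ (r, j) else B $$ (r, j - a))"
  unfolding append_cols_def using assms by (subst index_mat_four_block) auto

lemma zero_column:
  assumes "indep P v J" "j \<in> J" "\<And>p. p \<in> P \<Longrightarrow> v j p = 0"
  shows False
proof -
  have "(\<Sum>a\<in>J. (if a = j then 1 else 0) * v a p) = 0" if "p \<in> P" for p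
    using assms(3)[OF that] by (intro sum.neutral) auto
  from indepD[OF assms(1) this assms(2)] show False by simp
qed

lemma lm_Q:
  fixes A :: "real mat"
  assumes A: "A \<in> carrier_mat n n"
  shows "linear_matroid (1\<^sub>m n @\<^sub>c A @\<^sub>c 0\<^sub>m n n) = I1 n (\<lambda>i j. A $$ (i, j))"
    and "linear_matroid (1\<^sub>m n @\<^sub>c A) = I1 n (\<lambda>i j. A $$ (i, j))"
proof -
  let ?Q = "\<lambda>i j. A $$ (i, j)"
  have c2: "A @\<^sub>c 0\<^sub>m n n \<in> carrier_mat n (n + n)" using append_cols_dim[OF A zero_carrier_mat] .
  let ?M = "1\<^sub>m n @\<^sub>c A @\<^sub>c 0\<^sub>m n n"
  have c3: "?M \<in> carrier_mat n (n + (n + n))" using append_cols_dim[OF one_carrier_mat c2] .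
  have ent: "?M $$ (r, j) = colv n ?Q j r" if "r < n" "j < 3 * n" for r j
    using that append_cols_index[OF one_carrier_mat c2, of r j] append_cols_index[OF A zero_carrier_mat[of n n], of r "j - n"]
    by (auto simp: colv_def)
  show "linear_matroid ?M = I1 n ?Q"
  proof (rule Set.set_eqI)
    fix J
    have "J \<in> linear_matroid ?M \<longleftrightarrow> J \<subseteq> {..<3 * n} \<and> indep {..<n} (\<lambda>j r. ?M $$ (r, j)) J"
      unfolding linear_matroid_iff using c3 by auto
    also have "\<dots> \<longleftrightarrow> J \<subseteq> {..<3 * n} \<and> indep {..<n} (colv n ?Q) J"
      using indep_cong[of J "{..<n}" "\<lambda>j r. ?M $$ (r, j)" "colv n ?Q"] ent by (auto simp: subset_iff)
    also have "\<dots> \<longleftrightarrow> J \<in> I1 n ?Q"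
    proof -
      have "j < 2 * n" if "indep {..<n} (colv n ?Q) J" "j \<in> J" for j
      proof (rule ccontr)
        assume "\<not> j < 2 * n"
        then have "colv n ?Q j p = 0" for p by (simp add: colv_def)
        then show False using zero_column[OF that] by blast
      qed
      then show ?thesis unfolding I1_def by fastforce
    qed
    finally show "J \<in> linear_matroid ?M \<longleftrightarrow> J \<in> I1 n ?Q" .
  qed
  let ?M = "1\<^sub>m n @\<^sub>c A"
  have c3: "?M \<in> carrier_mat n (n + n)" using append_cols_dim[OF one_carrier_mat A] .
  have ent: "?M $$ (r, j) = colv n ?Q j r" if "r < n" "j < 2 * n" for r j
    using that append_cols_index[OF one_carrier_mat A, of r j]
    by (auto simp: colv_def)
  show "linear_matroid ?M = I1 n ?Q"
  proof (rule Set.set_eqI)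
    fix J
    have "J \<in> linear_matroid ?M \<longleftrightarrow> J \<subseteq> {..<2 * n} \<and> indep {..<n} (\<lambda>j r. ?M $$ (r, j)) J"
      unfolding linear_matroid_iff using c3 by auto
    also have "\<dots> \<longleftrightarrow> J \<in> I1 n ?Q"
      using indep_cong[of J "{..<n}" "\<lambda>j r. ?M $$ (r, j)" "colv n ?Q"] ent unfolding I1_def by (auto simp: subset_iff)
    finally show "J \<in> linear_matroid ?M \<longleftrightarrow> J \<in> I1 n ?Q" .
  qed
qed

lemma lm_T:
  assumes n: "dim sys = n"
  shows "linear_matroid (1\<^sub>m n @\<^sub>c TA_mat sys @\<^sub>c TB_mat sys S) = I2 n (TA sys) S"
    and "linear_matroid (1\<^sub>m n @\<^sub>c TA_mat sys) = I2 n (TA sys) {}"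
proof -
  have A: "TA_mat sys \<in> carrier_mat n n" and B: "TB_mat sys S \<in> carrier_mat n n" unfolding TA_mat_def TB_mat_def n by auto
  have par: "param k = to_fract (Poly_Mapping.single (Poly_Mapping.single k 1) 1)" for k
    unfolding param_def to_fract_def ..
  have c2: "TA_mat sys @\<^sub>c TB_mat sys S \<in> carrier_mat n (n + n)" using append_cols_dim[OF A B] .
  let ?M = "1\<^sub>m n @\<^sub>c TA_mat sys @\<^sub>c TB_mat sys S"
  have c3: "?M \<in> carrier_mat n (n + (n + n))" using append_cols_dim[OF one_carrier_mat c2] .
  have ent: "?M $$ (r, j) = to_fract (gent n (TA sys) S j r)" if r: "r < n" "j < 3 * n" for r j
  proof -
    consider "j < n" | "n \<le> j" "j < 2 * n" | "2 * n \<le> j" by linarith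
    then show ?thesis
    proof cases
      case 1 then show ?thesis using r append_cols_index[OF one_carrier_mat c2, of r j] by (auto simp: gent_def adj_def)
    next
      case 2 then show ?thesis
        using r append_cols_index[OF one_carrier_mat c2, of r j] append_cols_index[OF A B, of r "j - n"]
        by (auto simp: gent_def adj_def TA_mat_def n par par_def)
    next
      case 3 
      have "j - n - n = j - 2 * n" by simp
      then show ?thesis
        using 3 r append_cols_index[OF one_carrier_mat c2, of r j] append_cols_index[OF A B, of r "j - n"]
        by (auto simp: gent_def adj_def TB_mat_def n par par_def)
    qed
  qed
  show "linear_matroid ?M = I2 n (TA sys) S"
  proof (rule Set.set_eqI)
    fix J
    have "J \<in> linear_matroid ?M \<longleftrightarrow> J \<subseteq> {..<3 * n} \<and> indep {..<n} (\<lambda>j r. ?M $$ (r, j)) J"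
      unfolding linear_matroid_iff using c3 by auto
    also have "\<dots> \<longleftrightarrow> J \<subseteq> {..<3 * n} \<and> indep {..<n} (\<lambda>j r. to_fract (gent n (TA sys) S j r)) J"
      using indep_cong[of J "{..<n}" "\<lambda>j r. ?M $$ (r, j)" "\<lambda>j r. to_fract (gent n (TA sys) S j r)"] ent by (auto simp: subset_iff)
    also have "\<dots> \<longleftrightarrow> J \<in> I2 n (TA sys) S"
      unfolding I2_def using T_indep_iff[of J n "TA sys" S] by auto
    finally show "J \<in> linear_matroid ?M \<longleftrightarrow> J \<in> I2 n (TA sys) S" .
  qed
  let ?M = "1\<^sub>m n @\<^sub>c TA_mat sys"
  have c3: "?M \<in> carrier_mat n (n + n)" using append_cols_dim[OF one_carrier_mat A] .
  have ent: "?M $$ (r, j) = to_fract (gent n (TA sys) {} j r)" if r: "r < n" "j < 2 * n" for r j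
    using r append_cols_index[OF one_carrier_mat A, of r j]
    by (auto simp: gent_def adj_def TA_mat_def n par par_def)
  show "linear_matroid ?M = I2 n (TA sys) {}"
  proof (rule Set.set_eqI)
    fix J
    have "J \<in> linear_matroid ?M \<longleftrightarrow> J \<subseteq> {..<2 * n} \<and> indep {..<n} (\<lambda>j r. ?M $$ (r, j)) J"
      unfolding linear_matroid_iff using c3 by auto
    also have "\<dots> \<longleftrightarrow> J \<subseteq> {..<2 * n} \<and> indep {..<n} (\<lambda>j r. to_fract (gent n (TA sys) {} j r)) J"
      using indep_cong[of J "{..<n}" "\<lambda>j r. ?M $$ (r, j)" "\<lambda>j r. to_fract (gent n (TA sys) {} j r)"] ent by (auto simp: subset_iff)
    also have "\<dots> \<longleftrightarrow> J \<in> I2 n (TA sys) {}"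
    proof (cases "J \<subseteq> {..<2 * n}")
      case True
      then have "J \<subseteq> {..<3 * n}" by auto
      then show ?thesis using True unfolding I2_def using T_indep_iff[of J n "TA sys" "{}"] by auto
    next
      case False
      then obtain c where "c \<in> J" "\<not> c < 2 * n" by auto
      then have "J \<notin> I2 n (TA sys) {}" unfolding I2_def adj_def by auto
      then show ?thesis using False by simp
    qed
    finally show "J \<in> linear_matroid ?M \<longleftrightarrow> J \<in> I2 n (TA sys) {}" .
  qed
qed

theorem dual_M1:
  assumes wf: "wf_system sys" and n: "n = dim sys"
  shows "R \<in> dual (states sys) (M1 sys) \<longleftrightarrow> matchA n (TA sys) (\<lambda>i j. QA sys $$ (i, j)) R"
proof -
  let ?Q = "\<lambda>i j. QA sys $$ (i, j)"
  let ?m = "matchA n (TA sys) ?Q"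
  let ?r = "\<lambda>S. family_rank (matroid_union (I1 n ?Q) (I2 n (TA sys) S))"
  have QA: "QA sys \<in> carrier_mat n n" using wf n unfolding wf_system_def by simp
  have V: "states sys = {..<n}" unfolding states_def n by auto
  have rho: "rho1 sys S = ?r S - ?r {}" for S
    unfolding rho1_def Let_def n[symmetric] lm_Q[OF QA] lm_T[OF n[symmetric]] ..
  have "finite {R. ?m R}" by (rule finite_subset[of _ "Pow {..<n}"]) (auto dest: matchA_sub)
  from ex_max_card[OF this, of "{}"] obtain B0 where B0: "?m B0" "\<And>R. ?m R \<Longrightarrow> card R \<le> card B0"
    using matchA_empty by auto
  define k where "k = card B0"
  have r0: "?r {} = n + k"
  proof (rule antisym)
    obtain R where "?m R" "?r {} \<le> n + card (R \<union> {})" using union_rank_upper[of "{}" n "TA sys" ?Q] by auto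
    then show "?r {} \<le> n + k" using B0(2)[of R] unfolding k_def by simp
    show "n + k \<le> ?r {}" using union_rank_lower[OF B0(1), of "{}"] unfolding k_def by simp
  qed
  have M1: "S \<in> M1 sys \<longleftrightarrow> S \<subseteq> {..<n} \<and> (\<exists>R. ?m R \<and> card R = k \<and> R \<inter> S = {})" for S
  proof (cases "S \<subseteq> {..<n}")
    case True
    have fS: "finite S" using True finite_subset by blast
    have "rho1 sys S = card S \<longleftrightarrow> (\<exists>R. ?m R \<and> card R = k \<and> R \<inter> S = {})"
    proof
      assume a: "rho1 sys S = card S"
      have "n + k \<le> ?r S"
      proof -
        have "card B0 \<le> card (B0 \<union> S)" using matchA_finite[OF B0(1)] fS by (intro card_mono) auto
        then show ?thesis using union_rank_lower[OF B0(1) True] unfolding k_def by simp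
      qed
      then have rS: "?r S = n + k + card S" using a unfolding rho r0 by simp
      obtain R where R: "?m R" "?r S \<le> n + card (R \<union> S)" using union_rank_upper[OF fS, of n "TA sys" ?Q] by auto
      have fR: "finite R" by (rule matchA_finite[OF R(1)])
      have "card (R \<union> S) + card (R \<inter> S) = card R + card S" using card_Un_Int[OF fR fS] by simp
      moreover have "card R \<le> k" using B0(2)[OF R(1)] unfolding k_def .
      ultimately have "card R = k" "card (R \<inter> S) = 0" using R(2) rS by auto
      then show "\<exists>R. ?m R \<and> card R = k \<and> R \<inter> S = {}" using R(1) fR by auto
    next
      assume "\<exists>R. ?m R \<and> card R = k \<and> R \<inter> S = {}"
      then obtain R where R: "?m R" "card R = k" "R \<inter> S = {}" by blast
      have fR: "finite R" by (rule matchA_finite[OF R(1)])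
      have "n + (k + card S) \<le> ?r S" using union_rank_lower[OF R(1) True] R fR fS by (simp add: card_Un_disjoint)
      moreover obtain R' where R': "?m R'" "?r S \<le> n + card (R' \<union> S)" using union_rank_upper[OF fS, of n "TA sys" ?Q] by auto
      moreover have "card (R' \<union> S) \<le> k + card S" using card_Un_le[of R' S] B0(2)[OF R'(1)] unfolding k_def by simp
      ultimately show "rho1 sys S = card S" unfolding rho r0 by simp
    qed
    then show ?thesis using True unfolding M1_def matroid_of_rank_def V by simp
  next
    case False then show ?thesis unfolding M1_def matroid_of_rank_def V by simp
  qed
  have compl: "{..<n} - R \<in> bases (M1 sys)" if R: "?m R" "card R = k" for R
    unfolding bases_def
  proof (intro CollectI conjI ballI impI)
    show "{..<n} - R \<in> M1 sys" unfolding M1 using R by auto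
    fix X assume X: "X \<in> M1 sys" "{..<n} - R \<subseteq> X"
    obtain R' where R': "?m R'" "card R' = k" "R' \<inter> X = {}" using X(1) unfolding M1 by blast
    have "R' \<subseteq> R" using R'(3) X(2) matchA_sub[OF R'(1)] by blast
    then have "R' = R" using R R'(2) matchA_finite[OF R(1)] by (simp add: card_subset_eq)
    then show "X = {..<n} - R" using R'(3) X unfolding M1 by blast
  qed
  show ?thesis
  proof
    assume "R \<in> dual (states sys) (M1 sys)"
    then obtain B where B: "R \<subseteq> {..<n}" "B \<in> bases (M1 sys)" "R \<inter> B = {}" unfolding dual_def V by blast
    then have BM: "B \<in> M1 sys" unfolding bases_def by blast
    obtain R' where R': "?m R'" "card R' = k" "R' \<inter> B = {}" "B \<subseteq> {..<n}" using BM unfolding M1 by blast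
    have "{..<n} - R' \<in> M1 sys" using compl[OF R'(1,2)] unfolding bases_def by blast
    moreover have "\<forall>X\<in>M1 sys. B \<subseteq> X \<longrightarrow> X = B" using B(2) unfolding bases_def by simp
    moreover have "B \<subseteq> {..<n} - R'" using R'(3,4) by blast
    ultimately have "{..<n} - R' = B" by simp
    then have "R \<subseteq> R'" using B by blast
    then show "?m R" using matchA_subset[OF R'(1)] by blast
  next
    assume R: "?m R"
    let ?F = "{R'. ?m R' \<and> R \<subseteq> R'}"
    have "finite ?F" by (rule finite_subset[of _ "Pow {..<n}"]) (auto dest: matchA_sub)
    from ex_max_card[OF this, of R] obtain R' where R': "?m R'" "R \<subseteq> R'" "\<And>X. ?m X \<Longrightarrow> R \<subseteq> X \<Longrightarrow> card X \<le> card R'"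
      using R by auto
    have "card R' = k"
    proof (rule ccontr)
      assume "card R' \<noteq> k"
      then have "card R' < card B0" using B0(2)[OF R'(1)] unfolding k_def by simp
      from matchA_augment[OF R'(1) B0(1) this] obtain i where i: "i \<notin> R'" "?m (insert i R')" by blast
      then show False using R'(3)[OF i(2)] R'(2) i matchA_finite[OF R'(1)] by auto
    qed
    from compl[OF R'(1) this] show "R \<in> dual (states sys) (M1 sys)"
      unfolding dual_def V using R'(2) matchA_sub[OF R] by blast
  qed
qed

definition tightP :: "nat \<Rightarrow> (nat \<times> nat) set \<Rightarrow> (nat \<Rightarrow> nat \<Rightarrow> real) \<Rightarrow> nat set \<Rightarrow> bool" where
  "tightP n T Q X \<longleftrightarrow> (\<forall>A. A \<subseteq> {a. a < 2 * n \<and> (\<exists>k\<in>X. pN n T (\<lambda>_. False) k a)} \<longrightarrow>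
     indep {..<n} (pvec n Q (\<lambda>_ _. 0)) A \<longrightarrow> card A \<le> card X)"

lemma tight_iff:
  "rado.tight n (3 * n) (2 * n) (pN n T (\<lambda>_. False)) (pvec n Q (\<lambda>_ _. 0)) X \<longleftrightarrow> tightP n T Q X"
proof -
  interpret A: rado n "3 * n" n "2 * n" "pN n T (\<lambda>_. False)" "pvec n Q (\<lambda>_ _. 0)" "\<lambda>_. False"
    by (rule rado_0)
  have "indep {..<A.D} (pvec n Q (\<lambda>_ _. 0)) B = indep {..<n} (pvec n Q (\<lambda>_ _. 0)) B" for B
    by (rule indep_restrict) (auto simp: pvec_def)
  moreover have "A.nbrs X = {a. a < 2 * n \<and> (\<exists>k\<in>X. pN n T (\<lambda>_. False) k a)}"
    unfolding A.nbrs_def pN_def by auto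
  ultimately show ?thesis unfolding A.tight_def tightP_def by simp
qed

definition least_tight :: "nat \<Rightarrow> (nat \<times> nat) set \<Rightarrow> (nat \<Rightarrow> nat \<Rightarrow> real) \<Rightarrow> nat \<Rightarrow> nat set \<Rightarrow> bool" where
  "least_tight n T Q i X \<longleftrightarrow> X \<subseteq> {..<n} \<and> i \<in> X \<and> tightP n T Q X \<and>
     (\<forall>Y \<subseteq> {..<n}. i \<in> Y \<longrightarrow> tightP n T Q Y \<longrightarrow> X \<subseteq> Y)"

lemma least_tight_unique: "least_tight n T Q i X \<Longrightarrow> least_tight n T Q i Y \<Longrightarrow> X = Y"
  unfolding least_tight_def by (simp add: subset_antisym)

text \<open>Abstract classes\<close>

definition snk :: "(nat \<Rightarrow> nat set) \<Rightarrow> (nat \<Rightarrow> bool) \<Rightarrow> nat \<Rightarrow> bool" where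
  "snk R dead i \<longleftrightarrow> (\<forall>k\<in>R i. i \<in> R k \<and> \<not> dead k)"

definition reach_family :: "nat \<Rightarrow> (nat \<Rightarrow> nat set) \<Rightarrow> bool" where
  "reach_family n R \<longleftrightarrow> (\<forall>i<n. i \<in> R i \<and> R i \<subseteq> {..<n} \<and> (\<forall>k\<in>R i. R k \<subseteq> R i))"

lemma least_tight_family:
  assumes "\<And>i. i < n \<Longrightarrow> least_tight n T Q i (R i)"
  shows "reach_family n R"
  using assms unfolding reach_family_def least_tight_def by (meson lessThan_iff subsetD)

lemma snk_class:
  assumes R: "reach_family n R" and i: "i < n" "snk R dead i" and k: "k \<in> R i"
  shows "R k = R i" "snk R dead k" "k < n"
proof -
  have kn: "k < n" using R i k unfolding reach_family_def by auto
  have eq: "R l = R i" if "l \<in> R i" for l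
  proof
    show "R l \<subseteq> R i" using R i that unfolding reach_family_def by blast
    have "l < n" "i \<in> R l" using R i that unfolding reach_family_def snk_def by auto
    then show "R i \<subseteq> R l" using R unfolding reach_family_def by blast
  qed
  show "R k = R i" "k < n" by (fact eq[OF k] kn)+
  show "snk R dead k" unfolding snk_def
  proof
    fix l assume "l \<in> R k"
    then have "l \<in> R i" using eq[OF k] by simp
    then show "k \<in> R l \<and> \<not> dead l" using eq[of l] k i(2) unfolding snk_def by auto
  qed
qed

theorem dual_classes:
  assumes R: "reach_family n R"
    and M: "M = {X. X \<subseteq> {..<n} \<and> card (R ` {i \<in> X. snk R dead i}) = card X}"
  shows "Y \<in> dual {..<n} M \<longleftrightarrow> Y \<subseteq> {..<n} \<and> (\<forall>i<n. snk R dead i \<longrightarrow> \<not> R i \<subseteq> Y)"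
proof -
  let ?s = "snk R dead"
  have M': "X \<in> M \<longleftrightarrow> X \<subseteq> {..<n} \<and> (\<forall>i\<in>X. ?s i) \<and> inj_on R X" for X
  proof (cases "X \<subseteq> {..<n}")
    case True
    have f: "finite X" using True by (rule finite_subset) simp
    have "card (R ` {i \<in> X. ?s i}) = card X \<longleftrightarrow> (\<forall>i\<in>X. ?s i) \<and> inj_on R X"
    proof
      assume c: "card (R ` {i \<in> X. ?s i}) = card X"
      have "card (R ` {i \<in> X. ?s i}) \<le> card {i \<in> X. ?s i}" using f by (intro card_image_le) simp
      then have "card X \<le> card {i \<in> X. ?s i}" using c by simp
      then have "{i \<in> X. ?s i} = X" using f by (intro card_seteq) auto
      then show "(\<forall>i\<in>X. ?s i) \<and> inj_on R X" using c f by (metis (mono_tags, lifting) eq_card_imp_inj_on mem_Collect_eq)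
    next
      assume a: "(\<forall>i\<in>X. ?s i) \<and> inj_on R X"
      then have "{i \<in> X. ?s i} = X" by auto
      then show "card (R ` {i \<in> X. ?s i}) = card X" using a by (simp add: card_image)
    qed
    then show ?thesis using True unfolding M by simp
  next
    case False then show ?thesis unfolding M by simp
  qed
  have refl: "i \<in> R i" if "i < n" for i using R that unfolding reach_family_def by blast
  show ?thesis
  proof
    assume "Y \<in> dual {..<n} M"
    then obtain B where B: "Y \<subseteq> {..<n}" "B \<in> bases M" "Y \<inter> B = {}" unfolding dual_def by blast
    then have BM: "B \<in> M" and max: "\<forall>X\<in>M. B \<subseteq> X \<longrightarrow> X = B" unfolding bases_def by auto
    have "\<not> R i \<subseteq> Y" if i: "i < n" "?s i" for i
    proof -
      have "\<exists>b\<in>B. R b = R i"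
      proof (rule ccontr)
        assume no: "\<not> ?thesis"
        then have "insert i B \<in> M" using BM i unfolding M' by (auto simp: inj_on_def)
        then have "insert i B = B" using max by blast
        then show False using no by blast
      qed
      then obtain b where b: "b \<in> B" "R b = R i" ..
      then have "b \<in> R i" using refl[of b] BM unfolding M' by auto
      then show ?thesis using b B(3) by blast
    qed
    then show "Y \<subseteq> {..<n} \<and> (\<forall>i<n. ?s i \<longrightarrow> \<not> R i \<subseteq> Y)" using B(1) by blast
  next
    assume Y: "Y \<subseteq> {..<n} \<and> (\<forall>i<n. ?s i \<longrightarrow> \<not> R i \<subseteq> Y)"
    define h where "h c = (SOME k. k \<in> c \<and> k \<notin> Y)" for c
    have h: "h (R i) \<in> R i" "h (R i) \<notin> Y" if "i < n" "?s i" for i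
    proof -
      have "\<exists>k. k \<in> R i \<and> k \<notin> Y" using Y that by blast
      from someI_ex[OF this] show "h (R i) \<in> R i" "h (R i) \<notin> Y" unfolding h_def by auto
    qed
    define B where "B = (\<lambda>i. h (R i)) ` {i. i < n \<and> ?s i}"
    have B: "b < n \<and> ?s b \<and> b \<notin> Y \<and> h (R b) = b" if b: "b \<in> B" for b
    proof -
      obtain i where i: "i < n" "?s i" "b = h (R i)" using b unfolding B_def by auto
      note c = snk_class[OF R i(1,2) h(1)[OF i(1,2)]]
      show ?thesis using c h(2)[OF i(1,2)] i(3) by simp
    qed
    have "B \<in> M" unfolding M' using B by (auto intro!: inj_onI) metis
    moreover have "X = B" if X: "X \<in> M" "B \<subseteq> X" for X
    proof
      show "X \<subseteq> B"
      proof
        fix x assume x: "x \<in> X"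
        then have xs: "x < n" "?s x" using X(1) unfolding M' by auto
        then have "h (R x) \<in> B" unfolding B_def by blast
        moreover have "R (h (R x)) = R x" using snk_class(1)[OF R xs h(1)[OF xs]] .
        ultimately have "h (R x) = x" using X x unfolding M' by (auto dest: inj_onD)
        then show "x \<in> B" using \<open>h (R x) \<in> B\<close> by simp
      qed
    qed (fact X(2))
    ultimately have "B \<in> bases M" unfolding bases_def by blast
    moreover have "Y \<inter> B = {}" using B by blast
    ultimately show "Y \<in> dual {..<n} M" using Y unfolding dual_def by blast
  qed
qed

locale matched_system =
  fixes sys :: descriptor_system and m :: "nat \<Rightarrow> node" and n :: nat
  assumes wf: "wf_system sys" and adm: "admissible_matching sys m" and n: "n = dim sys"
begin

abbreviation "T \<equiv> pattern sys"
definition Q :: "nat \<Rightarrow> nat \<Rightarrow> real" where "Q i j = QA sys $$ (i, j) - QF sys $$ (i, j)"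
abbreviation "pv \<equiv> pvec n Q (\<lambda>_ _. 0)"
abbreviation "N \<equiv> pN n T (\<lambda>_. False)"
definition dead :: "nat \<Rightarrow> bool" where "dead k \<longleftrightarrow> (\<forall>p<n. Q k p = 0)"

lemma V: "states sys = {..<n}" unfolding states_def n by auto

lemma carriers: "QA sys \<in> carrier_mat n n" "QF sys \<in> carrier_mat n n"
  using wf unfolding wf_system_def n by auto

lemma T_sub: "(i, j) \<in> T \<Longrightarrow> i < n \<and> j < n"
  using wf unfolding wf_system_def pattern_def V by auto

definition nd :: "nat \<Rightarrow> node" where "nd a = (if a < n then WQ a else XQ (a - n))"
definition ix :: "nat \<Rightarrow> nat" where "ix i = row_index sys (m i)"

lemma m_cases:
  assumes "i < n"
  obtains "m i = WQ i" "ix i = i" | j where "(i, j) \<in> T" "m i = XQ j" "ix i = n + j" "j < n"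
proof -
  have "m i = WQ i \<or> (\<exists>j. (i, j) \<in> T \<and> m i = XQ j)"
    using adm assms unfolding admissible_matching_def V by simp
  then show thesis
  proof
    assume "m i = WQ i"
    then show thesis using that(1) by (simp add: ix_def)
  next
    assume "\<exists>j. (i, j) \<in> T \<and> m i = XQ j"
    then obtain j where "(i, j) \<in> T" "m i = XQ j" by auto
    then show thesis using that(2)[of j] T_sub[of i j] by (simp add: ix_def n[symmetric])
  qed
qed

lemma ix: "i < n \<Longrightarrow> ix i < 2 * n \<and> N i (ix i) \<and> nd (ix i) = m i"
proof -
  assume i: "i < n"
  from m_cases[OF i] show ?thesis by cases (use i in \<open>auto simp: pN_def nd_def\<close>)
qed

lemma m_inj: "i < n \<Longrightarrow> k < n \<Longrightarrow> m i = m k \<Longrightarrow> i = k"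
  using adm unfolding admissible_matching_def V by (auto dest: inj_onD)

lemma ix_inj: "inj_on ix {..<n}"
  by (intro inj_onI) (metis ix lessThan_iff m_inj)

lemma nd_inj: "a < 2 * n \<Longrightarrow> b < 2 * n \<Longrightarrow> nd a = nd b \<Longrightarrow> a = b"
  unfolding nd_def by (auto split: if_splits)

lemma row_index_nd: "a < 2 * n \<Longrightarrow> row_index sys (nd a) = a"
  by (auto simp: nd_def n[symmetric])

lemma Omega_carrier: "Omega sys \<in> carrier_mat (2 * n) n"
  unfolding Omega_def using carriers n by (auto simp: append_rows_def intro!: carrier_matI)

lemma Omega_index: "a < 2 * n \<Longrightarrow> p < n \<Longrightarrow> Omega sys $$ (a, p) = pv a p"
  unfolding Omega_def append_rows_def using carriers n
  by (subst index_mat_four_block) (auto simp: pvec_def Q_def)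

lemma indep_J: "indep {..<n} pv (ix ` {..<n})"
proof -
  have "ix ` {..<n} = row_index sys ` m ` states sys" unfolding ix_def V by auto
  then have "ix ` {..<n} \<in> linear_matroid (transpose_mat (Omega sys))" using adm unfolding admissible_matching_def by simp
  then have "indep {..<n} (\<lambda>j r. transpose_mat (Omega sys) $$ (r, j)) (ix ` {..<n})"
    unfolding linear_matroid_iff using Omega_carrier by simp
  moreover have "indep {..<n} (\<lambda>j r. transpose_mat (Omega sys) $$ (r, j)) (ix ` {..<n}) = indep {..<n} pv (ix ` {..<n})"
    by (rule indep_cong) (use ix Omega_carrier Omega_index in auto)
  ultimately show ?thesis by simp
qed

lemma all_matchable: "matchA n T Q {..<n}"
  unfolding matchA_def by (rule exI[of _ ix]) (use ix ix_inj indep_J in auto)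

lemma OJ: "Omega_J sys m \<in> carrier_mat n n" 
  "\<And>i p. i < n \<Longrightarrow> p < n \<Longrightarrow> Omega_J sys m $$ (i, p) = pv (ix i) p"
proof -
  show c: "Omega_J sys m \<in> carrier_mat n n" unfolding Omega_J_def n by auto
  show "Omega_J sys m $$ (i, p) = pv (ix i) p" if "i < n" "p < n" for i p
  proof -
    have "row (Omega sys) (row_index sys (m i)) $ p = Omega sys $$ (ix i, p)"
      using Omega_carrier ix[OF that(1)] that by (simp add: ix_def)
    then show ?thesis using that ix[OF that(1)] Omega_index[of "ix i" p]
      unfolding Omega_J_def n[symmetric] by (simp add: mat_of_rows_index)
  qed
qed

lemma det_OJ: "det (Omega_J sys m) \<noteq> 0"
proof
  assume "det (Omega_J sys m) = 0"
  then have "det (transpose_mat (Omega_J sys m)) = 0" using det_transpose[OF OJ(1)] by simp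
  then obtain v where v: "v \<in> carrier_vec n" "v \<noteq> 0\<^sub>v n" "transpose_mat (Omega_J sys m) *\<^sub>v v = 0\<^sub>v n"
    using det_0_iff_vec_prod_zero_field[of "transpose_mat (Omega_J sys m)" n] OJ(1) by auto
  let ?c = "\<lambda>a. v $ (inv_into {..<n} ix a)"
  have inv: "inv_into {..<n} ix (ix i) = i" if "i < n" for i using ix_inj that by simp
  have "(\<Sum>a\<in>ix ` {..<n}. ?c a * pv a p) = 0" if p: "p \<in> {..<n}" for p
  proof -
    have "(\<Sum>a\<in>ix ` {..<n}. ?c a * pv a p) = (\<Sum>i\<in>{..<n}. v $ i * pv (ix i) p)"
      using ix_inj inv by (simp add: sum.reindex)
    also have "\<dots> = (transpose_mat (Omega_J sys m) *\<^sub>v v) $ p"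
      using p v(1) OJ by (auto simp: scalar_prod_def atLeast0LessThan mult.commute intro!: sum.cong)
    finally show ?thesis using v(3) p by simp
  qed
  then have c0: "?c a = 0" if "a \<in> ix ` {..<n}" for a using indepD[OF indep_J _ that, of ?c] by blast
  have "v = 0\<^sub>v n"
  proof (rule eq_vecI)
    show "dim_vec v = dim_vec (0\<^sub>v n)" using v(1) by simp
    fix i assume "i < dim_vec (0\<^sub>v n :: real vec)"
    then have "i < n" by simp
    then show "v $ i = 0\<^sub>v n $ i" using c0[of "ix i"] inv by simp
  qed
  then show False using v(2) by simp
qed

definition Oi where "Oi = the (mat_inverse (Omega_J sys m))"

lemma Oi: "Oi \<in> carrier_mat n n" "Omega_J sys m * Oi = 1\<^sub>m n" "Oi * Omega_J sys m = 1\<^sub>m n"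
proof -
  have "mat_inverse (Omega_J sys m) \<noteq> None"
    using mat_inverse(1)[OF OJ(1), where b = "()"] det_non_zero_imp_unit[OF OJ(1) det_OJ, where b = "()"] by blast
  then obtain B where "mat_inverse (Omega_J sys m) = Some B" by blast
  with mat_inverse(2)[OF OJ(1) this] show "Oi \<in> carrier_mat n n" "Omega_J sys m * Oi = 1\<^sub>m n" "Oi * Omega_J sys m = 1\<^sub>m n"
    unfolding Oi_def by auto
qed

definition Ot :: "nat \<Rightarrow> nat \<Rightarrow> real" where "Ot a k = Omega_tilde sys m $$ (a, k)"

lemma Ot_carrier: "Omega_tilde sys m \<in> carrier_mat (2 * n) n"
  unfolding Omega_tilde_def Oi_def[symmetric] using Omega_carrier Oi(1) by simp

lemma Ot_sum: "a < 2 * n \<Longrightarrow> k < n \<Longrightarrow> Ot a k = (\<Sum>p\<in>{..<n}. pv a p * Oi $$ (p, k))"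
  unfolding Ot_def Omega_tilde_def Oi_def[symmetric] using Omega_carrier Oi(1) Omega_index
  by (auto simp: scalar_prod_def atLeast0LessThan intro!: sum.cong)

lemma pv_sum:
  assumes "a < 2 * n" "p < n"
  shows "pv a p = (\<Sum>k\<in>{..<n}. Ot a k * pv (ix k) p)"
proof -
  have "Omega sys = Omega_tilde sys m * Omega_J sys m"
    unfolding Omega_tilde_def Oi_def[symmetric]
    using assoc_mult_mat[OF Omega_carrier Oi(1) OJ(1)] Oi(3) Omega_carrier by simp
  then have "Omega sys $$ (a, p) = (\<Sum>k\<in>{..<n}. Ot a k * pv (ix k) p)"
    unfolding Ot_def using assms Ot_carrier OJ by (auto simp: scalar_prod_def atLeast0LessThan intro!: sum.cong)
  then show ?thesis using Omega_index assms by simp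
qed

lemma Ot_J: "i < n \<Longrightarrow> k < n \<Longrightarrow> Ot (ix i) k = (if i = k then 1 else 0)"
proof -
  assume ik: "i < n" "k < n"
  have "Ot (ix i) k = (Omega_J sys m * Oi) $$ (i, k)"
    using Ot_sum[of "ix i" k] ix[OF ik(1)] ik OJ Oi(1) by (auto simp: scalar_prod_def atLeast0LessThan intro!: sum.cong)
  then show ?thesis using ik unfolding Oi(2) by simp
qed

lemma indep_Ot:
  assumes "A \<subseteq> {..<2 * n}"
  shows "indep {..<n} Ot A = indep {..<n} pv A"
proof -
  have 1: "(\<Sum>a\<in>A. c a * Ot a k) = (\<Sum>p\<in>{..<n}. (\<Sum>a\<in>A. c a * pv a p) * Oi $$ (p, k))" if "k < n" for c k
  proof -
    have "(\<Sum>a\<in>A. c a * Ot a k) = (\<Sum>a\<in>A. \<Sum>p\<in>{..<n}. c a * pv a p * Oi $$ (p, k))"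
      using assms that by (intro sum.cong) (auto simp: Ot_sum sum_distrib_left mult.assoc)
    also have "\<dots> = (\<Sum>p\<in>{..<n}. \<Sum>a\<in>A. c a * pv a p * Oi $$ (p, k))" by (rule sum.swap)
    finally show ?thesis by (simp add: sum_distrib_right)
  qed
  have 2: "(\<Sum>a\<in>A. c a * pv a p) = (\<Sum>k\<in>{..<n}. (\<Sum>a\<in>A. c a * Ot a k) * pv (ix k) p)" if "p < n" for c p
  proof -
    have "(\<Sum>a\<in>A. c a * pv a p) = (\<Sum>a\<in>A. \<Sum>k\<in>{..<n}. c a * Ot a k * pv (ix k) p)"
    proof (rule sum.cong)
      fix a assume "a \<in> A"
      then have "a < 2 * n" using assms by auto
      from pv_sum[OF this that] show "c a * pv a p = (\<Sum>k\<in>{..<n}. c a * Ot a k * pv (ix k) p)"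
        by (simp add: sum_distrib_left mult.assoc)
    qed simp
    also have "\<dots> = (\<Sum>k\<in>{..<n}. \<Sum>a\<in>A. c a * Ot a k * pv (ix k) p)" by (rule sum.swap)
    finally show ?thesis by (simp add: sum_distrib_right)
  qed
  have "(\<forall>p\<in>{..<n}. (\<Sum>a\<in>A. c a * Ot a p) = 0) = (\<forall>p\<in>{..<n}. (\<Sum>a\<in>A. c a * pv a p) = 0)" for c
  proof (intro iffI ballI)
    fix p assume a: "\<forall>p\<in>{..<n}. (\<Sum>a\<in>A. c a * Ot a p) = 0" and p: "p \<in> {..<n}"
    then have "p < n" by simp
    show "(\<Sum>a\<in>A. c a * pv a p) = 0" unfolding 2[OF \<open>p < n\<close>] by (rule sum.neutral) (use a in auto)
  next
    fix p assume a: "\<forall>p\<in>{..<n}. (\<Sum>a\<in>A. c a * pv a p) = 0" and p: "p \<in> {..<n}"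
    then have "p < n" by simp
    show "(\<Sum>a\<in>A. c a * Ot a p) = 0" unfolding 1[OF \<open>p < n\<close>] by (rule sum.neutral) (use a in auto)
  qed
  then show ?thesis unfolding indep_def by simp
qed

definition step :: "nat \<Rightarrow> nat \<Rightarrow> bool" where
  "step i k \<longleftrightarrow> (\<exists>a < 2 * n. N i a \<and> Ot a k \<noteq> 0)"

lemma tight_step:
  assumes X: "X \<subseteq> {..<n}"
  shows "tightP n T Q X \<longleftrightarrow> (\<forall>i\<in>X. \<forall>k<n. step i k \<longrightarrow> k \<in> X)"
proof -
  interpret A: rado n "3 * n" n "2 * n" N pv "\<lambda>_. False"
    by (rule rado_0)
  define tab where "tab a p = (if a < 2 * n \<and> p < n then Ot a p else 0)" for a p
  define own where "own p = (if p < n then Some (p, False) else None)" for p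
  have eqD: "indep {..<A.D} tab B = indep {..<A.D} pv B" if B: "B \<subseteq> {..<3 * n}" for B
  proof (cases "B \<subseteq> {..<2 * n}")
    case True
    have "indep {..<A.D} tab B = indep {..<n} tab B" by (rule indep_restrict) (auto simp: tab_def)
    also have "\<dots> = indep {..<n} Ot B" using True by (intro indep_cong) (auto simp: tab_def)
    also have "\<dots> = indep {..<n} pv B" by (rule indep_Ot[OF True])
    also have "\<dots> = indep {..<A.D} pv B" by (rule indep_restrict[symmetric]) (auto simp: pvec_def)
    finally show ?thesis .
  next
    case False
    then obtain b where b: "b \<in> B" "\<not> b < 2 * n" by auto
    have "\<not> indep {..<A.D} tab B" using zero_column[of _ tab B b] b by (auto simp: tab_def)
    moreover have "\<not> indep {..<A.D} pv B" using zero_column[of _ pv B b] b by (auto simp: pvec_def)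
    ultimately show ?thesis by simp
  qed
  have tb: "A.tableau tab own" unfolding A.tableau_def
  proof (intro conjI allI impI)
    show "indep {..<A.D} tab B = indep {..<A.D} pv B" if "B \<subseteq> {..<3 * n}" for B by (rule eqD[OF that])
    show "\<exists>a<3 * n. N k a \<and> t = False \<and> (\<forall>q<A.D. tab a q = (if q = p then 1 else 0))"
      if "p < n" "own p = Some (k, t)" for p k t
      using that ix[of p] Ot_J[of p] by (intro exI[of _ "ix p"]) (auto simp: own_def tab_def)
  qed (auto simp: own_def tab_def split: if_splits)
  have full: "{..<n} \<subseteq> A.rows own" unfolding A.rows_def own_def by auto
  have C: "{p. p < A.D \<and> (\<exists>k\<in>X. \<exists>t. own p = Some (k, t))} = X" using X unfolding own_def by auto
  have touch: "A.touch tab own p q \<longleftrightarrow> p < n \<and> q < n \<and> step p q" for p q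
    unfolding A.touch_def own_def tab_def step_def by (auto simp: pN_def)
  show ?thesis
    using A.full_closed_tight[OF tb full X] unfolding C touch tight_iff using X by auto
qed


abbreviation "G \<equiv> aux_graph sys m"

lemma arc_wt: "i < n \<Longrightarrow> a < 2 * n \<Longrightarrow> N i a \<Longrightarrow> m i \<noteq> nd a \<Longrightarrow> (WT i, nd a) \<in> parcs G"
  unfolding aux_graph_def by (auto simp: pN_def nd_def V split: if_splits)

lemma arc_m: "k < n \<Longrightarrow> (m k, WT k) \<in> parcs G"
proof -
  assume k: "k < n"
  from m_cases[OF k] show ?thesis by cases (use k in \<open>auto simp: aux_graph_def V\<close>)
qed

lemma nd_Q: "a < 2 * n \<Longrightarrow> nd a \<in> Q_nodes sys"
  unfolding Q_nodes_def V nd_def by auto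

lemma arc_q: "a < 2 * n \<Longrightarrow> nd a \<notin> m ` {..<n} \<Longrightarrow> k < n \<Longrightarrow> Ot a k \<noteq> 0 \<Longrightarrow> (nd a, m k) \<in> parcs G"
  unfolding aux_graph_def using nd_Q[of a] row_index_nd[of a] by (auto simp: V Ot_def)

lemma arc_cases:
  assumes "(u, v) \<in> parcs G"
  obtains i a where "i < n" "a < 2 * n" "N i a" "m i \<noteq> nd a" "u = WT i" "v = nd a"
  | k where "k < n" "u = m k" "v = WT k"
  | a k where "a < 2 * n" "nd a \<notin> m ` {..<n}" "k < n" "Ot a k \<noteq> 0" "u = nd a" "v = m k"
proof -
  from assms consider
      (1) i j where "(i, j) \<in> T" "m i \<noteq> XQ j" "u = WT i" "v = XQ j"
    | (2) i j where "(i, j) \<in> T" "m i = XQ j" "u = XQ j" "v = WT i"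
    | (3) i where "i < n" "m i \<noteq> WQ i" "u = WT i" "v = WQ i"
    | (4) i where "i < n" "m i = WQ i" "u = WQ i" "v = WT i"
    | (5) a i where "a \<in> Q_nodes sys" "a \<notin> m ` {..<n}" "i < n" "Omega_tilde sys m $$ (row_index sys a, i) \<noteq> 0" "u = a" "v = m i"
    unfolding aux_graph_def V by auto
  then show thesis
  proof cases
    case 1
    then have "i < n" "j < n" using T_sub by auto
    then show thesis using that(1)[of i "n + j"] 1 by (auto simp: pN_def nd_def)
  next
    case 2 then show thesis using that(2)[of i] T_sub by auto
  next
    case 3 then show thesis using that(1)[of i i] by (auto simp: pN_def nd_def)
  next
    case 4 then show thesis using that(2)[of i] by auto
  next
    case 5
    obtain b where b: "b < 2 * n" "a = nd b"
    proof -
      from 5(1) consider i where "i < n" "a = WQ i" | i where "i < n" "a = XQ i" unfolding Q_nodes_def V by auto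
      then show thesis
      proof cases
        case (1 i) then show thesis using that[of i] by (auto simp: nd_def)
      next
        case (2 i) then show thesis using that[of "n + i"] by (auto simp: nd_def)
      qed
    qed
    then show thesis using that(3)[of b i] 5 row_index_nd[OF b(1)] by (auto simp: Ot_def)
  qed
qed

lemma verts_G: "i < n \<Longrightarrow> WT i \<in> pverts G" "a < 2 * n \<Longrightarrow> nd a \<in> pverts G" "k < n \<Longrightarrow> m k \<in> pverts G"
proof -
  show a: "a < 2 * n \<Longrightarrow> nd a \<in> pverts G" for a unfolding aux_graph_def nd_def V by auto
  show "i < n \<Longrightarrow> WT i \<in> pverts G" unfolding aux_graph_def V by auto
  show "k < n \<Longrightarrow> m k \<in> pverts G" using a[of "ix k"] ix[of k] by auto
qed

lemma arc_verts: "(u, v) \<in> parcs G \<Longrightarrow> u \<in> pverts G \<and> v \<in> pverts G"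
  by (erule arc_cases) (auto simp: verts_G)

lemma reachable_G: "u \<rightarrow>\<^sup>*\<^bsub>with_proj G\<^esub> v \<longleftrightarrow> u \<in> pverts G \<and> (u, v) \<in> (parcs G)\<^sup>*"
proof
  assume "u \<rightarrow>\<^sup>*\<^bsub>with_proj G\<^esub> v"
  then have "(u, v) \<in> rtrancl_on (pverts G) (parcs G)" unfolding reachable_def by (simp add: arcs_ends_conv)
  then show "u \<in> pverts G \<and> (u, v) \<in> (parcs G)\<^sup>*"
    by (induction rule: rtrancl_on.induct) auto
next
  assume a: "u \<in> pverts G \<and> (u, v) \<in> (parcs G)\<^sup>*"
  then have "(u, v) \<in> (parcs G)\<^sup>*" by simp
  then have "(u, v) \<in> rtrancl_on (pverts G) (parcs G)"
  proof (induction rule: rtrancl_induct)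
    case base then show ?case using a by (intro rtrancl_on_refl) simp
  next
    case (step y z)
    show ?case using arc_verts[OF step(2)] by (intro rtrancl_on_into_rtrancl_on[OF step(3) step(2)]) simp
  qed
  then show "u \<rightarrow>\<^sup>*\<^bsub>with_proj G\<^esub> v" unfolding reachable_def by (simp add: arcs_ends_conv)
qed

lemma in_J: "a < 2 * n \<Longrightarrow> k < n \<Longrightarrow> nd a = m k \<Longrightarrow> a = ix k"
  using nd_inj[of a "ix k"] ix[of k] by simp

lemma step_reach:
  assumes i: "i < n" and k: "k < n" and st: "step i k"
  shows "(WT i, WT k) \<in> (parcs G)\<^sup>*"
proof -
  obtain a where a: "a < 2 * n" "N i a" "Ot a k \<noteq> 0" using st unfolding step_def by blast
  show ?thesis
  proof (cases "nd a \<in> m ` {..<n}")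
    case True
    then obtain l where l: "l < n" "nd a = m l" by auto
    then have "a = ix l" using in_J[OF a(1)] by simp
    then have "l = k" using a(3) Ot_J[OF l(1) k] by (auto split: if_splits)
    show ?thesis
    proof (cases "i = k")
      case False
      then have "m i \<noteq> nd a" using m_inj[OF i k] l \<open>l = k\<close> by auto
      then show ?thesis using arc_wt[OF i a(1,2)] arc_m[OF k] l \<open>l = k\<close> by (auto intro: converse_rtrancl_into_rtrancl)
    qed simp
  next
    case False
    then have "m i \<noteq> nd a" using i by (metis imageI lessThan_iff)
    then show ?thesis using arc_wt[OF i a(1,2)] arc_q[OF a(1) False k a(3)] arc_m[OF k]
      by (meson converse_rtrancl_into_rtrancl r_into_rtrancl)
  qed
qed

definition R :: "nat \<Rightarrow> nat set" where "R i = {k. k < n \<and> (WT i, WT k) \<in> (parcs G)\<^sup>*}"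

lemma reach_closed:
  assumes X: "\<forall>i\<in>X. \<forall>k<n. step i k \<longrightarrow> k \<in> X" and i: "i \<in> X" and v: "(WT i, v) \<in> (parcs G)\<^sup>*"
  shows "v \<in> WT ` X \<union> {v. \<exists>a < 2 * n. v = nd a \<and> (\<forall>k<n. Ot a k \<noteq> 0 \<longrightarrow> k \<in> X)}"
  using v
proof (induction rule: rtrancl_induct)
  case base then show ?case using i by simp
next
  case (step y z)
  have nWT: "nd a \<noteq> WT x" "WT x \<noteq> nd a" for a x unfolding nd_def by auto
  from step(2) show ?case
  proof (cases rule: arc_cases)
    case (1 i a)
    then have "i \<in> X" using step(3) nWT by auto
    then have "\<forall>k<n. Ot a k \<noteq> 0 \<longrightarrow> k \<in> X" using X 1 unfolding step_def by blast
    then show ?thesis using 1 by auto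
  next
    case (2 k)
    have "m k = nd (ix k)" using ix[OF 2(1)] by simp
    then obtain a where a: "a < 2 * n" "m k = nd a" "\<forall>k<n. Ot a k \<noteq> 0 \<longrightarrow> k \<in> X" using step(3) 2 nWT by auto
    then have "a = ix k" using in_J[OF a(1) 2(1)] by simp
    then have "k \<in> X" using a(3) Ot_J[OF 2(1) 2(1)] 2(1) by auto
    then show ?thesis using 2 by simp
  next
    case (3 a k)
    obtain b where b: "b < 2 * n" "nd a = nd b" "\<forall>k<n. Ot b k \<noteq> 0 \<longrightarrow> k \<in> X" using step(3) 3 nWT by auto
    then have "b = a" using nd_inj 3(1) by blast
    then have "k \<in> X" using b 3 by auto
    then have "\<forall>l<n. Ot (ix k) l \<noteq> 0 \<longrightarrow> l \<in> X" using Ot_J[OF 3(3)] by (auto split: if_splits)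
    then show ?thesis using ix[OF 3(3)] 3(6) by auto
  qed
qed

lemma R_least:
  assumes i: "i < n"
  shows "least_tight n T Q i (R i)"
  unfolding least_tight_def
proof (intro conjI allI impI)
  show sub: "R i \<subseteq> {..<n}" unfolding R_def by auto
  show "i \<in> R i" unfolding R_def using i by simp
  show "tightP n T Q (R i)" unfolding tight_step[OF sub]
  proof (intro ballI allI impI)
    fix j k assume "j \<in> R i" "k < n" "step j k"
    then show "k \<in> R i" using step_reach[of j k] unfolding R_def by auto
  qed
  fix Y assume Y: "Y \<subseteq> {..<n}" "i \<in> Y" "tightP n T Q Y"
  have cl: "\<forall>i\<in>Y. \<forall>k<n. step i k \<longrightarrow> k \<in> Y" using Y(3) unfolding tight_step[OF Y(1)] .
  show "R i \<subseteq> Y"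
  proof
    fix k assume "k \<in> R i"
    then have "(WT i, WT k) \<in> (parcs G)\<^sup>*" unfolding R_def by simp
    from reach_closed[OF cl Y(2) this] show "k \<in> Y" by (auto simp: nd_def split: if_splits)
  qed
qed

lemma row_nonzero: "a < 2 * n \<Longrightarrow> \<not> (a < n \<and> dead a) \<Longrightarrow> \<exists>k<n. Ot a k \<noteq> 0"
proof (rule ccontr)
  assume a: "a < 2 * n" "\<not> (a < n \<and> dead a)" and no: "\<not> (\<exists>k<n. Ot a k \<noteq> 0)"
  have z: "pv a p = 0" if "p < n" for p using pv_sum[OF a(1) that] no by simp
  show False
  proof (cases "a < n")
    case True
    then have "dead a" using z unfolding dead_def by (auto simp: pvec_def)
    then show False using a True by simp
  next
    case False
    then have "a - n < n" using a(1) by linarith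
    then show False using z[of "a - n"] a(1) False by (auto simp: pvec_def)
  qed
qed

lemma dead_Ot: "a < n \<Longrightarrow> dead a \<Longrightarrow> k < n \<Longrightarrow> Ot a k = 0"
  using Ot_sum[of a k] unfolding dead_def by (auto simp: pvec_def)

lemma dead_not_J: "a < n \<Longrightarrow> dead a \<Longrightarrow> nd a \<notin> m ` {..<n}"
proof
  assume a: "a < n" "dead a" "nd a \<in> m ` {..<n}"
  then obtain k where k: "k < n" "nd a = m k" by auto
  then have "a = ix k" using in_J[of a k] a(1) by simp
  then show False using dead_Ot[OF a(1,2) k(1)] Ot_J[OF k(1) k(1)] by simp
qed

definition Cc :: "nat \<Rightarrow> node set" where "Cc i = {v. (WT i, v) \<in> (parcs G)\<^sup>*}"

lemma R_Cc: "R i = {k. k < n \<and> WT k \<in> Cc i}"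
  unfolding R_def Cc_def by simp

lemma Cc_verts: "i < n \<Longrightarrow> v \<in> Cc i \<Longrightarrow> v \<in> pverts G"
  unfolding Cc_def using verts_G(1)[of i] by (auto elim: rtranclE dest: arc_verts)

lemma Cc_back:
  assumes i: "i < n" "snk R dead i" and v: "v \<in> Cc i"
  shows "(v, WT i) \<in> (parcs G)\<^sup>*"
proof -
  have wt: "(WT k, WT i) \<in> (parcs G)\<^sup>*" "\<not> dead k" if "k < n" "(WT i, WT k) \<in> (parcs G)\<^sup>*" for k
    using i(2) that unfolding snk_def R_def by auto
  have mk: "(m k, WT i) \<in> (parcs G)\<^sup>*" if k: "k < n" "(WT i, m k) \<in> (parcs G)\<^sup>*" for k
    using wt(1)[OF k(1) rtrancl_into_rtrancl[OF k(2) arc_m[OF k(1)]]] arc_m[OF k(1)] by (rule converse_rtrancl_into_rtrancl[rotated])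
  have r: "(WT i, v) \<in> (parcs G)\<^sup>*" using v unfolding Cc_def by simp
  then show ?thesis
  proof (cases rule: rtranclE)
    case base then show ?thesis by simp
  next
    case (step u)
    from step(2) show ?thesis
    proof (cases rule: arc_cases)
      case (1 j a)
      show ?thesis
      proof (cases "nd a \<in> m ` {..<n}")
        case True then show ?thesis using mk 1 r by auto
      next
        case False
        have "\<not> (a < n \<and> dead a)"
        proof
          assume "a < n \<and> dead a"
          then have "a = j" using 1(3) by (simp add: pN_def)
          then show False using wt(2)[of j] 1 step(1) \<open>a < n \<and> dead a\<close> by auto
        qed
        from row_nonzero[OF 1(2) this] obtain k where k: "k < n" "Ot a k \<noteq> 0" by blast
        note arc = arc_q[OF 1(2) False k]
        have "(WT i, m k) \<in> (parcs G)\<^sup>*" using r arc 1 by (auto intro: rtrancl_into_rtrancl)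
        from mk[OF k(1) this] show ?thesis using arc 1 by (auto intro: converse_rtrancl_into_rtrancl)
      qed
    next
      case (2 k) then show ?thesis using wt r by auto
    next
      case (3 a k) then show ?thesis using mk r by auto
    qed
  qed
qed

lemma Cc_closed: "u \<in> Cc i \<Longrightarrow> (u, v) \<in> (parcs G)\<^sup>* \<Longrightarrow> v \<in> Cc i"
  unfolding Cc_def by (auto intro: rtrancl_trans)

lemma Cc_sink:
  assumes i: "i < n" "snk R dead i"
  shows "Cc i \<in> sink_components G"
  unfolding sink_components_def pre_digraph.sccs_verts_def
proof (intro CollectI conjI ballI allI impI)
  show "Cc i \<noteq> {}" unfolding Cc_def by auto
  show "u \<rightarrow>\<^sup>*\<^bsub>with_proj G\<^esub> v" if "u \<in> Cc i" "v \<in> Cc i" for u v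
    unfolding reachable_G using Cc_verts[OF i(1) that(1)] Cc_back[OF i that(1)] that(2)
    unfolding Cc_def by (auto intro: rtrancl_trans)
  show "\<not> u \<rightarrow>\<^sup>*\<^bsub>with_proj G\<^esub> v \<or> \<not> v \<rightarrow>\<^sup>*\<^bsub>with_proj G\<^esub> u" if "u \<in> Cc i" "v \<notin> Cc i" for u v
    unfolding reachable_G using Cc_closed that by blast
  show "\<not> (\<exists>u\<in>Cc i. \<exists>v. v \<notin> Cc i \<and> (u, v) \<in> parcs G)"
    using Cc_closed by blast
qed

lemma sink_Cc:
  assumes K: "K \<in> sink_components G" and i: "i < n" "WT i \<in> K"
  shows "snk R dead i" "K = Cc i"
proof -
  have scc: "\<And>u v. u \<in> K \<Longrightarrow> v \<in> K \<Longrightarrow> (u, v) \<in> (parcs G)\<^sup>*"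
    and sink: "\<And>u v. u \<in> K \<Longrightarrow> (u, v) \<in> parcs G \<Longrightarrow> v \<in> K"
    using K unfolding sink_components_def pre_digraph.sccs_verts_def reachable_G by blast+
  have "v \<in> K" if "(WT i, v) \<in> (parcs G)\<^sup>*" for v
    using that by (induction rule: rtrancl_induct) (use i sink in auto)
  then show KC: "K = Cc i" using scc i unfolding Cc_def by blast
  show "snk R dead i" unfolding snk_def
  proof
    fix k assume "k \<in> R i"
    then have k: "k < n" "WT k \<in> K" unfolding R_Cc KC by auto
    then have "i \<in> R k" using scc i unfolding R_def by blast
    moreover have "\<not> dead k"
    proof
      assume d: "dead k"
      note nJ = dead_not_J[OF k(1) d]
      then have "m k \<noteq> nd k" using k(1) by (metis imageI lessThan_iff)
      then have "(WT k, nd k) \<in> parcs G" using arc_wt[of k k] k(1) by (auto simp: pN_def)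
      then have "nd k \<in> K" using sink k(2) by blast
      then have "(nd k, WT i) \<in> (parcs G)\<^sup>*" using scc i by blast
      then show False
      proof (cases rule: converse_rtranclE)
        case base then show False by (simp add: nd_def split: if_splits)
      next
        case (step y)
        from step(1) show False
        proof (cases rule: arc_cases)
          case (1 j a) then show False by (simp add: nd_def split: if_splits)
        next
          case (2 l)
          then have "nd k \<in> m ` {..<n}" by (metis imageI lessThan_iff)
          then show False using nJ by contradiction
        next
          case (3 a l)
          have k2: "k < 2 * n" using k(1) by simp
          have "a = k" by (rule nd_inj[OF 3(1) k2 3(5)[symmetric]])
          then show False using dead_Ot[OF k(1) d 3(3)] 3(4) by blast
        qed
      qed
    qed
    ultimately show "i \<in> R k \<and> \<not> dead k" by simp
  qed
qed

lemma rho2_eq: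
  assumes S: "S \<subseteq> {..<n}"
  shows "rho2 sys m S = card (R ` {i \<in> S. snk R dead i})"
proof -
  let ?Z = "{i \<in> S. snk R dead i}"
  have eq: "{C \<in> sink_components G. C \<inter> WT ` S \<noteq> {}} = Cc ` ?Z"
  proof
    show "Cc ` ?Z \<subseteq> {C \<in> sink_components G. C \<inter> WT ` S \<noteq> {}}"
    proof
      fix K assume "K \<in> Cc ` ?Z"
      then obtain i where i: "i \<in> S" "snk R dead i" "K = Cc i" by auto
      moreover have "WT i \<in> Cc i" unfolding Cc_def by simp
      ultimately show "K \<in> {C \<in> sink_components G. C \<inter> WT ` S \<noteq> {}}" using Cc_sink[of i] S by auto
    qed
    show "{C \<in> sink_components G. C \<inter> WT ` S \<noteq> {}} \<subseteq> Cc ` ?Z"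
    proof
      fix K assume "K \<in> {C \<in> sink_components G. C \<inter> WT ` S \<noteq> {}}"
      then obtain i where i: "K \<in> sink_components G" "i \<in> S" "WT i \<in> K" by auto
      then have "i < n" using S by auto
      then show "K \<in> Cc ` ?Z" using sink_Cc[OF i(1) _ i(3)] i(2) by auto
    qed
  qed
  let ?h = "\<lambda>K. {k. k < n \<and> WT k \<in> K}"
  have "inj_on ?h (Cc ` ?Z)"
  proof (rule inj_onI)
    fix K L assume "K \<in> Cc ` ?Z" "L \<in> Cc ` ?Z" and h: "?h K = ?h L"
    then obtain i j where ij: "i < n" "snk R dead i" "K = Cc i" "j < n" "snk R dead j" "L = Cc j" using S by auto
    have "WT i \<in> K" unfolding ij Cc_def by simp
    then have "WT i \<in> L" using h ij(1) by blast
    then show "K = L" using sink_Cc(2)[OF Cc_sink[OF ij(4,5)] ij(1)] ij by simp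
  qed
  then have "card (?h ` Cc ` ?Z) = card (Cc ` ?Z)" by (rule card_image)
  moreover have "?h ` Cc ` ?Z = R ` ?Z" unfolding image_image R_Cc ..
  ultimately show ?thesis unfolding rho2_def eq by simp
qed

theorem dual_M2: "Y \<in> dual (states sys) (M2 sys m) \<longleftrightarrow> Y \<subseteq> {..<n} \<and> (\<forall>i<n. snk R dead i \<longrightarrow> \<not> R i \<subseteq> Y)"
  unfolding V
proof (rule dual_classes)
  show "reach_family n R" by (rule least_tight_family[OF R_least])
  show "M2 sys m = {X. X \<subseteq> {..<n} \<and> card (R ` {i \<in> X. snk R dead i}) = card X}"
    unfolding M2_def matroid_of_rank_def V using rho2_eq by auto
qed

end

definition ind :: "(nat \<Rightarrow> nat set) \<Rightarrow> nat \<Rightarrow> nat \<Rightarrow> real" where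
  "ind R k p = (if p \<in> R k then 1 else 0)"

definition valid :: "nat \<Rightarrow> (nat \<times> nat) set \<Rightarrow> (nat \<Rightarrow> nat \<Rightarrow> real) \<Rightarrow> (nat \<Rightarrow> nat set) \<Rightarrow> (nat \<Rightarrow> bool) \<Rightarrow> nat set \<Rightarrow> bool" where
  "valid n T Q R dead X \<longleftrightarrow> matchA n T Q X \<and> (\<forall>i<n. snk R dead i \<longrightarrow> \<not> R i \<subseteq> X)"

definition sink_classes :: "nat \<Rightarrow> (nat \<Rightarrow> nat set) \<Rightarrow> (nat \<Rightarrow> bool) \<Rightarrow> nat set set" where
  "sink_classes n R dead = R ` {i. i < n \<and> snk R dead i}"

locale second_phase =
  fixes n :: nat and T :: "(nat \<times> nat) set" and Q :: "nat \<Rightarrow> nat \<Rightarrow> real" and R :: "nat \<Rightarrow> nat set" and dead :: "nat \<Rightarrow> bool"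
  assumes R: "reach_family n R"
begin

abbreviation "Cl \<equiv> sink_classes n R dead"
abbreviation "N2 \<equiv> pN n T (snk R dead)"
abbreviation "v2 \<equiv> pvec n Q (ind R)"

sublocale rado n "3 * n" "2 * n" "2 * n" N2 v2 "\<lambda>a. 2 * n \<le> a"
  by (rule rado_Y)

lemma finite_Cl: "finite Cl" unfolding sink_classes_def by simp

lemma class_of:
  assumes "c \<in> Cl" "x \<in> c"
  shows "x < n" "snk R dead x" "R x = c"
proof -
  obtain i where i: "i < n" "snk R dead i" "c = R i" using assms(1) unfolding sink_classes_def by auto
  show "x < n" "snk R dead x" "R x = c" using snk_class[OF R i(1,2)] assms(2) i(3) by auto
qed

lemma self: "i < n \<Longrightarrow> i \<in> R i" using R unfolding reach_family_def by blast

lemma upper_bound: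
  assumes X: "valid n T Q R dead X"
    and P: "matchable P" "\<And>i. i < n \<Longrightarrow> i \<notin> P \<Longrightarrow> \<not> matchable (insert i P)"
  shows "card X + card Cl \<le> card P"
proof -
  have mX: "matchA n T Q X" and hX: "\<And>i. i < n \<Longrightarrow> snk R dead i \<Longrightarrow> \<not> R i \<subseteq> X" using X unfolding valid_def by auto
  obtain f where f: "X \<subseteq> {..<n}" "inj_on f X" "\<And>i. i \<in> X \<Longrightarrow> f i < 2 * n \<and> pN n T (\<lambda>_. False) i (f i)"
     "indep {..<n} (pvec n Q (\<lambda>_ _. 0)) (f ` X)" using mX unfolding matchA_def by blast
  have fin: "finite X" using f(1) by (rule finite_subset) simp
  define h where "h c = (SOME x. x \<in> c \<and> x \<notin> X)" for c
  have h: "h c \<in> c" "h c \<notin> X" if c: "c \<in> Cl" for c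
  proof -
    have "\<exists>x. x \<in> c \<and> x \<notin> X" using hX c unfolding sink_classes_def by auto
    from someI_ex[OF this] show "h c \<in> c" "h c \<notin> X" unfolding h_def by auto
  qed
  have hc: "h c < n" "snk R dead (h c)" "R (h c) = c" if "c \<in> Cl" for c using class_of[OF that h(1)[OF that]] by auto
  have hinj: "inj_on h Cl" by (rule inj_onI) (metis hc(3))
  define H where "H = h ` Cl"
  have finH: "finite H" unfolding H_def using finite_Cl by simp
  have XH: "X \<inter> H = {}" unfolding H_def using h(2) by auto
  define g where "g k = (if k \<in> X then f k else 2 * n + k)" for k
  have gX: "g ` X = f ` X" unfolding g_def by auto
  have gH: "g k = 2 * n + k" if "k \<in> H" for k using that XH unfolding g_def by auto
  have ginj: "inj_on g (X \<union> H)"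
  proof (rule inj_onI)
    fix x y assume xy: "x \<in> X \<union> H" "y \<in> X \<union> H" "g x = g y"
    show "x = y"
    proof (cases "x \<in> X"; cases "y \<in> X")
      assume "x \<in> X" "y \<in> X" then show ?thesis using xy(3) f(2) unfolding g_def by (auto dest: inj_onD)
    next
      assume "x \<in> X" "y \<notin> X" then show ?thesis using xy(3) f(3)[of x] unfolding g_def by auto
    next
      assume "x \<notin> X" "y \<in> X" then show ?thesis using xy(3) f(3)[of y] unfolding g_def by auto
    next
      assume "x \<notin> X" "y \<notin> X" then show ?thesis using xy(3) unfolding g_def by auto
    qed
  qed
  have "transversal (X \<union> H) g"
    unfolding transversal_def
  proof (intro conjI ballI)
    show "X \<union> H \<subseteq> {..<n}" using f(1) hc(1) unfolding H_def by auto
    show "inj_on g (X \<union> H)" by fact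
    fix k assume k: "k \<in> X \<union> H"
    have "g k < 3 * n \<and> N2 k (g k)"
    proof (cases "k \<in> X")
      case True
      then show ?thesis using f(3)[OF True] unfolding g_def pN_def by (auto split: if_splits)
    next
      case False
      then obtain c where "c \<in> Cl" "k = h c" using k unfolding H_def by auto
      then show ?thesis using False hc[of c] unfolding g_def pN_def by auto
    qed
    then show "g k < 3 * n" "N2 k (g k)" by auto
  next
    show "indep {..<D} v2 (g ` (X \<union> H))" unfolding indep_def
    proof (intro conjI allI impI ballI)
      show "finite (g ` (X \<union> H))" using fin finH by simp
      fix c a assume c: "\<forall>p\<in>{..<D}. (\<Sum>a\<in>g ` (X \<union> H). c a * v2 a p) = 0" and a: "a \<in> g ` (X \<union> H)"
      have split: "(\<Sum>a\<in>g ` (X \<union> H). c a * v2 a p) = (\<Sum>a\<in>f ` X. c a * v2 a p) + (\<Sum>k\<in>H. c (2 * n + k) * v2 (2 * n + k) p)" for p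
      proof -
        have "(\<Sum>a\<in>g ` (X \<union> H). c a * v2 a p) = (\<Sum>k\<in>X \<union> H. c (g k) * v2 (g k) p)"
          using ginj by (simp add: sum.reindex)
        also have "\<dots> = (\<Sum>k\<in>X. c (g k) * v2 (g k) p) + (\<Sum>k\<in>H. c (g k) * v2 (g k) p)"
          using fin finH XH by (rule sum.union_disjoint)
        also have "(\<Sum>k\<in>X. c (g k) * v2 (g k) p) = (\<Sum>a\<in>f ` X. c a * v2 a p)"
          using f(2) by (simp add: sum.reindex g_def)
        also have "(\<Sum>k\<in>H. c (g k) * v2 (g k) p) = (\<Sum>k\<in>H. c (2 * n + k) * v2 (2 * n + k) p)"
          by (rule sum.cong) (simp_all add: gH)
        finally show ?thesis .
      qed
      have cf: "c b = 0" if b: "b \<in> f ` X" for b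
      proof (rule indepD[OF f(4) _ b])
        fix p assume p: "p \<in> {..<n}"
        have "(\<Sum>k\<in>H. c (2 * n + k) * v2 (2 * n + k) p) = 0" using p by (intro sum.neutral) (auto simp: pvec_def)
        then have "(\<Sum>a\<in>f ` X. c a * v2 a p) = 0" using c[rule_format, of p] split[of p] p by simp
        moreover have "(\<Sum>a\<in>f ` X. c a * v2 a p) = (\<Sum>a\<in>f ` X. c a * pvec n Q (\<lambda>_ _. 0) a p)"
          using f(3) by (intro sum.cong) (auto simp: pvec_def)
        ultimately show "(\<Sum>a\<in>f ` X. c a * pvec n Q (\<lambda>_ _. 0) a p) = 0" by simp
      qed
      have cH: "c (2 * n + x) = 0" if x: "x \<in> H" for x
      proof -
        obtain e where e: "e \<in> Cl" "x = h e" using x unfolding H_def by auto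
        have xn: "x < n" using hc(1)[OF e(1)] e(2) by simp
        have "0 = (\<Sum>k\<in>H. c (2 * n + k) * v2 (2 * n + k) (n + x))"
          using c[rule_format, of "n + x"] split[of "n + x"] cf xn by simp
        also have "\<dots> = (\<Sum>k\<in>H. if k = x then c (2 * n + k) else 0)"
        proof (rule sum.cong)
          fix k assume "k \<in> H"
          then obtain e' where e': "e' \<in> Cl" "k = h e'" unfolding H_def by auto
          have "x \<in> R k \<longleftrightarrow> k = x"
          proof
            assume "x \<in> R k"
            then have "R x = e'" using hc(3)[OF e'(1)] e' class_of(3)[OF e'(1)] by auto
            then show "k = x" using hc(3)[OF e(1)] e e' by simp
          next
            assume "k = x" then show "x \<in> R k" using self xn by simp
          qed
          then show "c (2 * n + k) * v2 (2 * n + k) (n + x) = (if k = x then c (2 * n + k) else 0)"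
            using hc(1)[OF e'(1)] e'(2) xn by (simp add: pvec_def ind_def)
        qed simp
        also have "\<dots> = c (2 * n + x)" using x finH by simp
        finally show ?thesis by simp
      qed
      obtain k where k: "k \<in> X \<union> H" "a = g k" using a by auto
      show "c a = 0"
      proof (cases "k \<in> X")
        case True then show ?thesis using cf k gX by auto
      next
        case False then show ?thesis using cH[of k] gH[of k] k by auto
      qed
    qed
  qed
  then have mXH: "matchable (X \<union> H)" unfolding matchable_def by blast
  have "\<not> card P < card (X \<union> H)" using matchable_augment[OF P(1) mXH] P(2) by blast
  moreover have "card (X \<union> H) = card X + card Cl"
    using fin finH XH hinj unfolding H_def by (simp add: card_Un_disjoint card_image)
  ultimately show ?thesis by simp
qed

theorem optimum:
  assumes tb: "tableau tab own" and max: "\<And>i. i < n \<Longrightarrow> i \<notin> rows own \<Longrightarrow> \<not> matchable (insert i (rows own))"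
    and S0: "S0 = {k. k < n \<and> \<not> (\<exists>p. own p = Some (k, False))}"
    and S: "S0 \<subseteq> S" "S \<subseteq> {..<n}" "\<And>i. i < n \<Longrightarrow> snk R dead i \<Longrightarrow> R i \<inter> S \<noteq> {}"
    and card: "card S \<le> card S0 + card {c \<in> Cl. c \<inter> S0 = {}}"
  shows "valid n T Q R dead ({..<n} - S)" "\<And>X. valid n T Q R dead X \<Longrightarrow> card X \<le> card ({..<n} - S)"
proof -
  note I = invD[OF tb]
  obtain f where f: "transversal (rows own) f" "\<And>k. k \<in> rows own \<Longrightarrow> \<exists>p<2 * n. own p = Some (k, 2 * n \<le> f k)"
    using matchable_rows[OF tb] by blast
  let ?P = "rows own"
  have Pn: "?P \<subseteq> {..<n}" and finj: "inj_on f ?P" and fN: "\<And>k. k \<in> ?P \<Longrightarrow> f k < 3 * n \<and> N2 k (f k)"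
    and find: "indep {..<D} v2 (f ` ?P)" using f(1) unfolding transversal_def by auto
  have fP: "finite ?P" using Pn by (rule finite_subset) simp
  define A where "A = {k \<in> ?P. f k < 2 * n}"
  define Py where "Py = {k \<in> ?P. 2 * n \<le> f k}"
  have AP: "?P = A \<union> Py" "A \<inter> Py = {}" unfolding A_def Py_def by auto
  have finA: "finite A" "finite Py" using fP unfolding A_def Py_def by auto
  have A: "{k. k < n \<and> (\<exists>p. own p = Some (k, False))} = A"
  proof (rule Set.set_eqI, rule iffI)
    fix k assume "k \<in> {k. k < n \<and> (\<exists>p. own p = Some (k, False))}"
    then obtain p where p: "own p = Some (k, False)" by auto
    have "p < 2 * n" using I(6)[OF p] by (meson not_le)
    then have kP: "k \<in> ?P" using p unfolding rows_def by blast
    obtain p' where p': "own p' = Some (k, 2 * n \<le> f k)" using f(2)[OF kP] by blast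
    have "p = p'" using I(4)[OF p p'] .
    then show "k \<in> A" using p p' kP unfolding A_def by simp
  next
    fix k assume k: "k \<in> A"
    then obtain p where "own p = Some (k, 2 * n \<le> f k)" using f(2)[of k] unfolding A_def by auto
    then show "k \<in> {k. k < n \<and> (\<exists>p. own p = Some (k, False))}" using k Pn unfolding A_def by auto
  qed
  have S0A: "S0 = {..<n} - A" unfolding S0 A[symmetric] by auto
  have mA: "matchA n T Q A" unfolding matchA_def
  proof (intro exI[of _ f] conjI ballI)
    show "A \<subseteq> {..<n}" using Pn unfolding A_def by auto
    show "inj_on f A" by (rule inj_on_subset[OF finj]) (auto simp: A_def)
    show "f i < 2 * n" "pN n T (\<lambda>_. False) i (f i)" if "i \<in> A" for i
      using that fN[of i] unfolding A_def pN_def by (auto split: if_splits)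
    have "indep {..<D} v2 (f ` A)" by (rule indep_subset[OF find]) (auto simp: A_def)
    also have "indep {..<D} v2 (f ` A) = indep {..<n} v2 (f ` A)" by (rule indep_restrict) (auto simp: A_def pvec_def)
    also have "\<dots> = indep {..<n} (pvec n Q (\<lambda>_ _. 0)) (f ` A)" by (rule indep_cong) (auto simp: A_def pvec_def)
    finally show "indep {..<n} (pvec n Q (\<lambda>_ _. 0)) (f ` A)" .
  qed
  have VS: "{..<n} - S \<subseteq> A" using S(1) unfolding S0A by auto
  show valid: "valid n T Q R dead ({..<n} - S)" unfolding valid_def
  proof (intro conjI allI impI)
    show "matchA n T Q ({..<n} - S)" by (rule matchA_subset[OF mA VS])
    show "\<not> R i \<subseteq> {..<n} - S" if "i < n" "snk R dead i" for i using S(3)[OF that] by blast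
  qed
  have fY: "f k = 2 * n + k" "snk R dead k" if "k \<in> Py" for k
    using that fN[of k] unfolding Py_def pN_def by (auto split: if_splits)
  have injR: "inj_on R Py"
  proof (rule inj_onI, rule ccontr)
    fix k l assume kl: "k \<in> Py" "l \<in> Py" "R k = R l" "k \<noteq> l"
    have n: "k < n" "l < n" using kl Pn unfolding Py_def by auto
    let ?c = "\<lambda>a. if a = 2 * n + k then 1 else if a = 2 * n + l then -1 else (0::real)"
    have inP: "2 * n + k \<in> f ` ?P" "2 * n + l \<in> f ` ?P" using kl(1,2) fY unfolding Py_def by (metis (no_types, lifting) imageI mem_Collect_eq kl(1) kl(2) Py_def)+
    have "(\<Sum>a\<in>f ` ?P. ?c a * v2 a p) = 0" for p
    proof -
      have "(\<Sum>a\<in>f ` ?P. ?c a * v2 a p) = (\<Sum>a\<in>{2 * n + k, 2 * n + l}. ?c a * v2 a p)"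
        using inP fP by (intro sum.mono_neutral_right) auto
      also have "\<dots> = v2 (2 * n + k) p - v2 (2 * n + l) p" using kl(4) by simp
      also have "\<dots> = 0" using n kl(3) by (simp add: pvec_def ind_def)
      finally show ?thesis .
    qed
    from indepD[OF find this inP(1)] show False by simp
  qed
  have RPy: "R ` Py \<subseteq> Cl" using fY(2) Pn unfolding sink_classes_def Py_def by auto
  have "{c \<in> Cl. c \<inter> S0 = {}} \<subseteq> Cl - R ` Py"
  proof
    fix c assume c: "c \<in> {c \<in> Cl. c \<inter> S0 = {}}"
    have "c \<notin> R ` Py"
    proof
      assume "c \<in> R ` Py"
      then obtain k where k: "k \<in> Py" "c = R k" by auto
      then have "k < n" "k \<notin> A" using Pn AP(2) unfolding Py_def by auto
      then have "k \<in> c \<inter> S0" using k self unfolding S0A by auto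
      then show False using c by auto
    qed
    then show "c \<in> Cl - R ` Py" using c by simp
  qed
  then have "card {c \<in> Cl. c \<inter> S0 = {}} \<le> card (Cl - R ` Py)" using finite_Cl by (intro card_mono) auto
  also have "\<dots> = card Cl - card Py" using RPy finA(2) injR by (simp add: card_Diff_subset card_image)
  finally have 1: "card {c \<in> Cl. c \<inter> S0 = {}} \<le> card Cl - card Py" .
  have 2: "card Py \<le> card Cl" using card_mono[OF finite_Cl RPy] injR by (simp add: card_image)
  have An: "A \<subseteq> {..<n}" using Pn unfolding A_def by auto
  have 3: "card S0 = n - card A" unfolding S0A using finA(1) An by (simp add: card_Diff_subset)
  have 4: "card A \<le> n" using card_mono[OF _ An] by simp
  have 5: "card ({..<n} - S) = n - card S" using S(2) by (simp add: card_Diff_subset finite_subset)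
  have 6: "card S \<le> n" using card_mono[OF _ S(2)] by simp
  have 7: "card ?P = card A + card Py" unfolding AP(1) using card_Un_disjoint[OF finA AP(2)] .
  have "card ?P \<le> card ({..<n} - S) + card Cl" using 1 2 3 4 5 6 7 card by linarith
  then show "card X \<le> card ({..<n} - S)" if "valid n T Q R dead X" for X
    using upper_bound[OF that _ max] f(1) unfolding matchable_def by fastforce
qed

end

datatype ty = Any | Nul | Lst nat ty | Pr ty ty

datatype trm =
    V nat | Nil0 | Zr | On
  | Op1 prim1 trm
  | Op2 prim2 trm trm
  | Ite trm trm trm
  | Let1 trm trm
  | MapT trm trm trm
  | FoldT ty trm trm trm
  | AppT trm trm

primrec mapd :: "(data \<Rightarrow> data \<Rightarrow> data \<Rightarrow> data) \<Rightarrow> data \<Rightarrow> data \<Rightarrow> data \<Rightarrow> data" where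
  "mapd f Null ys i = Null"
| "mapd f (Atom r) ys i = Null"
| "mapd f (Cell x xs) ys i = Cell (f i x (apply1 Head ys)) (mapd f xs (apply1 Tail ys) (apply2 Add i (Atom 1)))"

primrec foldd :: "(data \<Rightarrow> data \<Rightarrow> data) \<Rightarrow> data \<Rightarrow> data \<Rightarrow> data" where
  "foldd f Null acc = acc"
| "foldd f (Atom r) acc = acc"
| "foldd f (Cell x xs) acc = foldd f xs (f x acc)"

primrec appd :: "data \<Rightarrow> data \<Rightarrow> data" where
  "appd Null ys = ys"
| "appd (Atom r) ys = ys"
| "appd (Cell x xs) ys = Cell x (appd xs ys)"

primrec sem :: "trm \<Rightarrow> data \<Rightarrow> data" where
  "sem (V i) d = apply1 Head ((apply1 Tail ^^ i) d)"
| "sem Nil0 d = Null"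
| "sem Zr d = Atom 0"
| "sem On d = Atom 1"
| "sem (Op1 p e) d = apply1 p (sem e d)"
| "sem (Op2 p e1 e2) d = apply2 p (sem e1 d) (sem e2 d)"
| "sem (Ite c e1 e2) d = (if sem c d = Null then sem e2 d else sem e1 d)"
| "sem (Let1 e1 e2) d = sem e2 (Cell (sem e1 d) d)"
| "sem (MapT xs ys b) d = mapd (\<lambda>i x y. sem b (Cell i (Cell x (Cell y d)))) (sem xs d) (sem ys d) (Atom 0)"
| "sem (FoldT T xs e b) d = foldd (\<lambda>x acc. sem b (Cell x (Cell acc d))) (sem xs d) (sem e d)"
| "sem (AppT xs ys) d = appd (sem xs d) (sem ys d)"

text \<open>Types\<close>

primrec has_ty :: "nat \<Rightarrow> ty \<Rightarrow> data \<Rightarrow> bool" where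
  "has_ty N Any = (\<lambda>d. True)"
| "has_ty N Nul = (\<lambda>d. d = Null)"
| "has_ty N (Lst k T) = (\<lambda>d. \<exists>ds. d = list_data ds \<and> length ds \<le> k * N \<and> (\<forall>x\<in>set ds. has_ty N T x))"
| "has_ty N (Pr S T) = (\<lambda>d. has_ty N S (apply1 Head d) \<and> has_ty N T (apply1 Tail d))"

fun sub_ty :: "ty \<Rightarrow> ty \<Rightarrow> bool" where
  "sub_ty S Any \<longleftrightarrow> True"
| "sub_ty Nul T \<longleftrightarrow> True"
| "sub_ty (Lst k S) (Lst l T) \<longleftrightarrow> k \<le> l \<and> sub_ty S T"
| "sub_ty (Pr S S') (Pr T T') \<longleftrightarrow> sub_ty S T \<and> sub_ty S' T'"
| "sub_ty _ _ \<longleftrightarrow> False"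

fun join_ty :: "ty \<Rightarrow> ty \<Rightarrow> ty" where
  "join_ty Nul T = T"
| "join_ty S Nul = S"
| "join_ty (Lst k S) (Lst l T) = Lst (max k l) (join_ty S T)"
| "join_ty (Pr S S') (Pr T T') = Pr (join_ty S T) (join_ty S' T')"
| "join_ty _ _ = Any"

fun op1_ty :: "prim1 \<Rightarrow> ty \<Rightarrow> ty" where
  "op1_ty p Nul = Nul"
| "op1_ty Head (Lst k T) = T"
| "op1_ty Tail (Lst k T) = Lst k T"
| "op1_ty Head (Pr S T) = S"
| "op1_ty Tail (Pr S T) = T"
| "op1_ty p Any = Any"

fun op2_ty :: "prim2 \<Rightarrow> ty \<Rightarrow> ty \<Rightarrow> ty" where
  "op2_ty Pair S T = Pr S T"
| "op2_ty _ _ _ = Any"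

fun len_ty :: "ty \<Rightarrow> nat option" where
  "len_ty Nul = Some 0"
| "len_ty (Lst k T) = Some k"
| "len_ty _ = None"

fun elem_ty :: "ty \<Rightarrow> ty" where
  "elem_ty Nul = Nul"
| "elem_ty (Lst k T) = T"
| "elem_ty _ = Any"

primrec ty_of :: "trm \<Rightarrow> ty \<Rightarrow> ty option" where
  "ty_of (V i) G = Some (op1_ty Head ((op1_ty Tail ^^ i) G))"
| "ty_of Nil0 G = Some Nul"
| "ty_of Zr G = Some Any"
| "ty_of On G = Some Any"
| "ty_of (Op1 p e) G = (case ty_of e G of None \<Rightarrow> None | Some T \<Rightarrow> Some (op1_ty p T))"
| "ty_of (Op2 p e1 e2) G = (case ty_of e1 G of None \<Rightarrow> None | Some T1 \<Rightarrow>
     (case ty_of e2 G of None \<Rightarrow> None | Some T2 \<Rightarrow> Some (op2_ty p T1 T2)))"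
| "ty_of (Ite e e1 e2) G = (case ty_of e G of None \<Rightarrow> None | Some T \<Rightarrow>
     (case ty_of e1 G of None \<Rightarrow> None | Some T1 \<Rightarrow>
     (case ty_of e2 G of None \<Rightarrow> None | Some T2 \<Rightarrow> Some (join_ty T1 T2))))"
| "ty_of (Let1 e1 e2) G = (case ty_of e1 G of None \<Rightarrow> None | Some T1 \<Rightarrow> ty_of e2 (Pr T1 G))"
| "ty_of (MapT xs ys b) G = (case ty_of xs G of None \<Rightarrow> None | Some S \<Rightarrow>
     (case len_ty S of None \<Rightarrow> None | Some k \<Rightarrow>
     (case ty_of ys G of None \<Rightarrow> None | Some T \<Rightarrow>
     (case len_ty T of None \<Rightarrow> None | Some l \<Rightarrow>
     (case ty_of b (Pr Any (Pr (elem_ty S) (Pr (elem_ty T) G))) of None \<Rightarrow> None | Some U \<Rightarrow>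
        if k \<le> 3 then Some (Lst k U) else None)))))"
| "ty_of (FoldT A xs e b) G = (case ty_of xs G of None \<Rightarrow> None | Some S \<Rightarrow>
     (case len_ty S of None \<Rightarrow> None | Some k \<Rightarrow>
     (case ty_of e G of None \<Rightarrow> None | Some T \<Rightarrow>
     (case ty_of b (Pr (elem_ty S) (Pr A G)) of None \<Rightarrow> None | Some U \<Rightarrow>
        if k \<le> 3 \<and> sub_ty T A \<and> sub_ty U A then Some A else None))))"
| "ty_of (AppT xs ys) G = (case ty_of xs G of None \<Rightarrow> None | Some S \<Rightarrow>
     (case len_ty S of None \<Rightarrow> None | Some k \<Rightarrow>
     (case ty_of ys G of None \<Rightarrow> None | Some T \<Rightarrow>
     (case len_ty T of None \<Rightarrow> None | Some l \<Rightarrow>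
        if k \<le> 3 then Some (Lst (k + l) (join_ty (elem_ty S) (elem_ty T))) else None))))"

definition passes :: "nat poly" where "passes = monom 3 1 + 1"

primrec cost :: "trm \<Rightarrow> nat poly" where
  "cost (V i) = of_nat (i + 2)"
| "cost Nil0 = 1"
| "cost Zr = 1"
| "cost On = 1"
| "cost (Op1 p e) = cost e + 1"
| "cost (Op2 p e1 e2) = cost e1 + cost e2 + 1"
| "cost (Ite e e1 e2) = cost e + cost e1 + cost e2 + 1"
| "cost (Let1 e1 e2) = cost e1 + cost e2 + 3"
| "cost (MapT xs ys b) = cost xs + cost ys + 20 + (cost b + 50) * passes"
| "cost (FoldT A xs e b) = cost xs + cost e + 20 + (cost b + 50) * passes"
| "cost (AppT xs ys) = cost xs + cost ys + 20 + 50 * passes"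

lemma poly_passes: "poly passes N = 3 * N + 1"
  unfolding passes_def by (simp add: poly_monom)

lemma list_data_Null[simp]: "(list_data ds = Null) = (ds = [])" "(Null = list_data ds) = (ds = [])"
  by (cases ds; simp)+

lemma has_ty_Null: "has_ty N T Null"
  by (induction T) auto

lemma sub_ty_sound: "sub_ty S T \<Longrightarrow> has_ty N S d \<Longrightarrow> has_ty N T d"
proof (induction S T arbitrary: d rule: sub_ty.induct)
  case (3 k S l T)
  then obtain ds where ds: "d = list_data ds" "length ds \<le> k * N" "\<forall>x\<in>set ds. has_ty N S x" by auto
  have "k * N \<le> l * N" using 3 by simp
  with ds(2) have "length ds \<le> l * N" by linarith
  moreover have "\<forall>x\<in>set ds. has_ty N T x" using ds 3 by auto
  ultimately show ?case using ds(1) by auto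
qed (auto simp: has_ty_Null)

lemma join_ty_sound: "has_ty N S d \<or> has_ty N T d \<Longrightarrow> has_ty N (join_ty S T) d"
proof (induction S T arbitrary: d rule: join_ty.induct)
  case (3 k S l T)
  from 3(2) show ?case
  proof
    assume "has_ty N (Lst k S) d"
    then obtain ds where ds: "d = list_data ds" "length ds \<le> k * N" "\<forall>x\<in>set ds. has_ty N S x" by auto
    have "length ds \<le> max k l * N" using ds(2) by (meson le_trans max.cobounded1 mult_le_mono1)
    then show ?thesis using ds 3(1) by (auto intro!: exI[of _ ds])
  next
    assume "has_ty N (Lst l T) d"
    then obtain ds where ds: "d = list_data ds" "length ds \<le> l * N" "\<forall>x\<in>set ds. has_ty N T x" by auto
    have "length ds \<le> max k l * N" using ds(2) by (meson le_trans max.cobounded2 mult_le_mono1)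
    then show ?thesis using ds 3(1) by (auto intro!: exI[of _ ds])
  qed
qed (auto simp: has_ty_Null)

lemma op1_ty_sound: "has_ty N T d \<Longrightarrow> has_ty N (op1_ty p T) (apply1 p d)"
proof (induction p T rule: op1_ty.induct)
  case (1 p) then show ?case by (cases p) auto
next
  case (2 k T)
  then obtain ds where ds: "d = list_data ds" "\<forall>x\<in>set ds. has_ty N T x" by auto
  then show ?case by (cases ds) (auto simp: has_ty_Null)
next
  case (3 k T)
  then obtain ds where ds: "d = list_data ds" "length ds \<le> k * N" "\<forall>x\<in>set ds. has_ty N T x" by auto
  then have "apply1 Tail d = list_data (tl ds)" by (cases ds) auto
  moreover have "length (tl ds) \<le> k * N" "\<forall>x\<in>set (tl ds). has_ty N T x"
    using ds by (auto dest: list.set_sel(2)[rotated]) (metis list.sel(2) list.set_sel(2))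
  ultimately show ?case by auto
qed auto

lemma op1_ty_pow_sound: "has_ty N T d \<Longrightarrow> has_ty N ((op1_ty p ^^ i) T) ((apply1 p ^^ i) d)"
  by (induction i) (auto intro: op1_ty_sound)

lemma op2_ty_sound: "has_ty N S d \<Longrightarrow> has_ty N T e \<Longrightarrow> has_ty N (op2_ty p S T) (apply2 p d e)"
  by (cases p) auto

lemma list_tyD: "has_ty N S d \<Longrightarrow> len_ty S = Some k \<Longrightarrow>
   \<exists>ds. d = list_data ds \<and> length ds \<le> k * N \<and> (\<forall>x\<in>set ds. has_ty N (elem_ty S) x)"
  by (cases S) auto

text \<open>Compilation\<close>

abbreviation hd1 where "hd1 \<equiv> Prim1 Head"
abbreviation tl1 where "tl1 \<equiv> Prim1 Tail"
abbreviation pr2 where "pr2 \<equiv> Prim2 Pair"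

definition map_fun :: "nat \<Rightarrow> expr \<Rightarrow> expr" where
  "map_fun f b = (let xs = hd1 (Var 0); ys = hd1 (tl1 (Var 0)); i = hd1 (tl1 (tl1 (Var 0)));
       env = tl1 (tl1 (tl1 (Var 0))) in
     If xs
       (pr2 (LetIn (pr2 i (pr2 (hd1 xs) (pr2 (hd1 ys) env))) b)
          (Call f (pr2 (tl1 xs) (pr2 (tl1 ys) (pr2 (Prim2 Add i One) env)))))
       NullE)"

definition fold_fun :: "nat \<Rightarrow> expr \<Rightarrow> expr" where
  "fold_fun f b = (let xs = hd1 (Var 0); acc = hd1 (tl1 (Var 0)); env = tl1 (tl1 (Var 0)) in
     If xs
       (Call f (pr2 (tl1 xs) (pr2 (LetIn (pr2 (hd1 xs) (pr2 acc env)) b) env)))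
       acc)"

definition app_fun :: "nat \<Rightarrow> expr" where
  "app_fun f = (let xs = hd1 (Var 0); ys = tl1 (Var 0) in
     If xs (pr2 (hd1 xs) (Call f (pr2 (tl1 xs) ys))) ys)"

primrec code_of :: "trm \<Rightarrow> nat \<Rightarrow> expr \<times> expr list" where
  "code_of (V i) k = (hd1 ((tl1 ^^ i) (Var 0)), [])"
| "code_of Nil0 k = (NullE, [])"
| "code_of Zr k = (Zero, [])"
| "code_of On k = (One, [])"
| "code_of (Op1 p e) k = (let (c, fs) = code_of e k in (Prim1 p c, fs))"
| "code_of (Op2 p e1 e2) k = (let (c1, fs1) = code_of e1 k; (c2, fs2) = code_of e2 (k + length fs1)
     in (Prim2 p c1 c2, fs1 @ fs2))"
| "code_of (Ite e e1 e2) k = (let (c, fs) = code_of e k; (c1, fs1) = code_of e1 (k + length fs);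
       (c2, fs2) = code_of e2 (k + length fs + length fs1)
     in (If c c1 c2, fs @ fs1 @ fs2))"
| "code_of (Let1 e1 e2) k = (let (c1, fs1) = code_of e1 k; (c2, fs2) = code_of e2 (k + length fs1)
     in (LetIn (pr2 c1 (Var 0)) c2, fs1 @ fs2))"
| "code_of (MapT xs ys b) k = (let (c1, fs1) = code_of xs k; (c2, fs2) = code_of ys (k + length fs1);
       f = k + length fs1 + length fs2; (c3, fs3) = code_of b (Suc f)
     in (Call f (pr2 c1 (pr2 c2 (pr2 Zero (Var 0)))), fs1 @ fs2 @ map_fun f c3 # fs3))"
| "code_of (FoldT T xs e b) k = (let (c1, fs1) = code_of xs k; (c2, fs2) = code_of e (k + length fs1);
       f = k + length fs1 + length fs2; (c3, fs3) = code_of b (Suc f)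
     in (Call f (pr2 c1 (pr2 c2 (Var 0))), fs1 @ fs2 @ fold_fun f c3 # fs3))"
| "code_of (AppT xs ys) k = (let (c1, fs1) = code_of xs k; (c2, fs2) = code_of ys (k + length fs1);
       f = k + length fs1 + length fs2
     in (Call f (pr2 c1 c2), fs1 @ fs2 @ [app_fun f]))"

definition placed :: "program \<Rightarrow> nat \<Rightarrow> expr list \<Rightarrow> bool" where
  "placed P k fs \<longleftrightarrow> k + length fs \<le> length P \<and> (\<forall>j<length fs. P ! (k + j) = fs ! j)"

lemma placed_append: "placed P k (fs @ gs) \<longleftrightarrow> placed P k fs \<and> placed P (k + length fs) gs"
proof -
  have "(\<forall>j<length fs + length gs. P ! (k + j) = (fs @ gs) ! j) \<longleftrightarrow>
     (\<forall>j<length fs. P ! (k + j) = fs ! j) \<and> (\<forall>j<length gs. P ! (k + length fs + j) = gs ! j)" (is "?l = ?r")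
  proof
    assume l: ?l
    show ?r
    proof (intro conjI allI impI)
      fix j assume "j < length fs" then show "P ! (k + j) = fs ! j" using l[rule_format, of j] by (simp add: nth_append)
    next
      fix j assume "j < length gs" then show "P ! (k + length fs + j) = gs ! j"
        using l[rule_format, of "length fs + j"] by (simp add: nth_append add.assoc)
    qed
  next
    assume r: ?r
    show ?l
    proof (intro allI impI)
      fix j assume "j < length fs + length gs"
      then show "P ! (k + j) = (fs @ gs) ! j"
        using r[THEN conjunct1, rule_format, of j] r[THEN conjunct2, rule_format, of "j - length fs"]
        by (auto simp: nth_append)
    qed
  qed
  then show ?thesis unfolding placed_def by (auto simp: add.assoc)
qed

lemma placed_Cons: "placed P k (e # fs) \<longleftrightarrow> k < length P \<and> P ! k = e \<and> placed P (Suc k) fs"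
  unfolding placed_def by (auto simp: less_Suc_eq_0_disj)

definition evb :: "program \<Rightarrow> data list \<Rightarrow> expr \<Rightarrow> data \<Rightarrow> nat \<Rightarrow> bool" where
  "evb P env e v b \<longleftrightarrow> (\<exists>t\<le>b. evaluates P env e v t)"

lemma evb_mono: "evb P env e v b \<Longrightarrow> b \<le> b' \<Longrightarrow> evb P env e v b'"
  unfolding evb_def using le_trans by blast

lemma evb_eq: "evb P env e v b \<Longrightarrow> v = v' \<Longrightarrow> b \<le> b' \<Longrightarrow> evb P env e v' b'"
  using evb_mono by blast

lemma evb_Var: "i < length env \<Longrightarrow> evb P env (Var i) (env ! i) 1"
  unfolding evb_def using evaluates.intros(1) by blast
lemma evb_Var0: "evb P (v # env) (Var 0) v 1"
  using evb_Var[of 0 "v # env" P] by simp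
lemma evb_NullE: "evb P env NullE Null 1"
  unfolding evb_def using evaluates.intros(2) by blast
lemma evb_Zero: "evb P env Zero (Atom 0) 1"
  unfolding evb_def using evaluates.intros(3) by blast
lemma evb_One: "evb P env One (Atom 1) 1"
  unfolding evb_def using evaluates.intros(4) by blast
lemma evb_Prim1: "evb P env e v t \<Longrightarrow> evb P env (Prim1 p e) (apply1 p v) (t + 1)"
  unfolding evb_def using evaluates.intros(5) by (meson add_le_mono order_refl)
lemma evb_Prim2: "evb P env e1 v1 t1 \<Longrightarrow> evb P env e2 v2 t2 \<Longrightarrow>
    evb P env (Prim2 p e1 e2) (apply2 p v1 v2) (t1 + t2 + 1)"
  unfolding evb_def using evaluates.intros(6) by (meson add_le_mono order_refl)
lemma evb_If: "evb P env c b t1 \<Longrightarrow> (b \<noteq> Null \<Longrightarrow> evb P env e1 v1 t2) \<Longrightarrow> (b = Null \<Longrightarrow> evb P env e2 v2 t3) \<Longrightarrow>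
    evb P env (If c e1 e2) (if b = Null then v2 else v1) (t1 + t2 + t3 + 1)"
proof (cases "b = Null")
  case True
  assume a: "evb P env c b t1" "(b \<noteq> Null \<Longrightarrow> evb P env e1 v1 t2)" "(b = Null \<Longrightarrow> evb P env e2 v2 t3)"
  then obtain x y where "x \<le> t1" "evaluates P env c Null x" "y \<le> t3" "evaluates P env e2 v2 y"
    using True unfolding evb_def by auto
  then have "evaluates P env (If c e1 e2) v2 (x + y + 1)" "x + y + 1 \<le> t1 + t2 + t3 + 1"
    using evaluates.intros(8) by auto
  then show ?thesis unfolding evb_def using True by auto
next
  case False
  assume a: "evb P env c b t1" "(b \<noteq> Null \<Longrightarrow> evb P env e1 v1 t2)" "(b = Null \<Longrightarrow> evb P env e2 v2 t3)"
  then obtain x y where "x \<le> t1" "evaluates P env c b x" "y \<le> t2" "evaluates P env e1 v1 y"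
    using False unfolding evb_def by auto
  then have "evaluates P env (If c e1 e2) v1 (x + y + 1)" "x + y + 1 \<le> t1 + t2 + t3 + 1"
    using evaluates.intros(7) False by auto
  then show ?thesis unfolding evb_def using False by auto
qed
lemma evb_IfT: "evb P env c b t1 \<Longrightarrow> evb P env e1 v t2 \<Longrightarrow> b \<noteq> Null \<Longrightarrow>
    evb P env (If c e1 e2) v (t1 + t2 + 1)"
  using evb_If[of P env c b t1 e1 v t2 e2 v 0] by simp
lemma evb_IfF: "evb P env c Null t1 \<Longrightarrow> evb P env e2 v t2 \<Longrightarrow> evb P env (If c e1 e2) v (t1 + t2 + 1)"
  using evb_If[of P env c Null t1 e1 v 0 e2 v t2] by simp
lemma evb_LetIn: "evb P env e1 v1 t1 \<Longrightarrow> evb P (v1 # env) e2 v t2 \<Longrightarrow> evb P env (LetIn e1 e2) v (t1 + t2 + 1)"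
  unfolding evb_def using evaluates.intros(9) by (meson add_le_mono order_refl)
lemma evb_Call: "evb P env e v1 t1 \<Longrightarrow> f < length P \<Longrightarrow> evb P [v1] (P ! f) v t2 \<Longrightarrow> evb P env (Call f e) v (t1 + t2 + 1)"
  unfolding evb_def using evaluates.intros(10) by (meson add_le_mono order_refl)

lemma evb_pow: "evb P (d # rho) ((tl1 ^^ i) (Var 0)) ((apply1 Tail ^^ i) d) (i + 1)"
proof (induction i)
  case 0 show ?case using evb_Var0[of P d rho] by simp
next
  case (Suc i) then show ?case using evb_Prim1[of P "d # rho" "(tl1 ^^ i) (Var 0)" _ _ Tail] by simp
qed

lemmas evb_prims = evb_Var0 evb_Prim1 evb_Prim2 evb_One evb_Zero evb_NullE

lemma evb_map:
  assumes f: "f < length P" "P ! f = map_fun f b"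
    and b: "\<And>i x y rho. x \<in> set ds \<Longrightarrow> (y = Null \<or> y \<in> Y) \<Longrightarrow> evb P (Cell i (Cell x (Cell y d)) # rho) b (g i x y) c"
    and Y: "\<And>j. apply1 Head ((apply1 Tail ^^ j) ys) \<in> Y"
  shows "evb P rho e (Cell (list_data ds) (Cell ys (Cell i d))) t \<Longrightarrow>
      evb P rho (Call f e) (mapd g (list_data ds) ys i) (t + (c + 49) * length ds + 20)"
  using b Y
proof (induction ds arbitrary: ys i rho e t)
  case Nil
  have "evb P [Cell Null (Cell ys (Cell i d))] (map_fun f b) Null 10"
    unfolding map_fun_def Let_def
    by (rule evb_eq, rule evb_IfF, (rule evb_eq, (rule evb_prims)+, simp, rule le_refl)+) (auto)
  from evb_Call[OF Nil(1)[simplified] f(1), unfolded f(2), OF this] show ?case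
    by (rule evb_eq) auto
next
  case (Cons x ds)
  let ?E = "[Cell (Cell x (list_data ds)) (Cell ys (Cell i d))]"
  let ?y = "apply1 Head ys"
  have y: "?y \<in> Y" using Cons.prems(3)[of 0] by simp
  have *: "evb P (Cell i (Cell x (Cell ?y d)) # ?E) b (g i x ?y) c"
    using Cons.prems(2) y by auto
  let ?arg = "pr2 (tl1 (hd1 (Var 0))) (pr2 (tl1 (hd1 (tl1 (Var 0)))) (pr2 (Prim2 Add (hd1 (tl1 (tl1 (Var 0)))) One) (tl1 (tl1 (tl1 (Var 0))))))"
  have arg: "evb P ?E ?arg (Cell (list_data ds) (Cell (apply1 Tail ys) (Cell (apply2 Add i (Atom 1)) d))) 22"
    by (rule evb_eq, (rule evb_prims)+) (auto)
  have rec: "evb P ?E (Call f ?arg) (mapd g (list_data ds) (apply1 Tail ys) (apply2 Add i (Atom 1)))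
      (22 + (c + 49) * length ds + 20)"
  proof (rule Cons.IH[OF arg])
    show "evb P (Cell i (Cell x (Cell y d)) # rho) b (g i x y) c" if "x \<in> set ds" "y = Null \<or> y \<in> Y" for i x y rho
      using Cons.prems(2) that by simp
    show "apply1 Head ((apply1 Tail ^^ j) (apply1 Tail ys)) \<in> Y" for j
      using Cons.prems(3)[of "Suc j"] by (simp add: funpow_swap1)
  qed
  have let1: "evb P ?E (LetIn (pr2 (hd1 (tl1 (tl1 (Var 0)))) (pr2 (hd1 (hd1 (Var 0))) (pr2 (hd1 (hd1 (tl1 (Var 0)))) (tl1 (tl1 (tl1 (Var 0))))))) b)
       (g i x ?y) (c + 20)"
    by (rule evb_eq, rule evb_LetIn, (rule evb_prims)+, simp, rule *) auto
  have body: "evb P ?E (map_fun f b) (Cell (g i x ?y) (mapd g (list_data ds) (apply1 Tail ys) (apply2 Add i (Atom 1))))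
     (c + 20 + (22 + (c + 49) * length ds + 20) + 6)"
    unfolding map_fun_def Let_def
    by (rule evb_eq, rule evb_IfT, rule evb_Prim1, rule evb_Var0, rule evb_Prim2[OF let1 rec])
      (auto)
  have "evb P rho (Call f e) (Cell (g i x ?y) (mapd g (list_data ds) (apply1 Tail ys) (apply2 Add i (Atom 1))))
       (t + (c + 20 + (22 + (c + 49) * length ds + 20) + 6) + 1)"
    by (rule evb_Call[OF Cons.prems(1) f(1), unfolded f(2) list_data.simps, OF body])
  then show ?case by (rule evb_eq) (simp_all add: algebra_simps)
qed

lemma evb_fold:
  assumes f: "f < length P" "P ! f = fold_fun f b"
    and b: "\<And>x acc rho. x \<in> set ds \<Longrightarrow> Q acc \<Longrightarrow> Q (g x acc) \<and> evb P (Cell x (Cell acc d) # rho) b (g x acc) c"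
  shows "Q acc \<Longrightarrow> evb P rho e (Cell (list_data ds) (Cell acc d)) t \<Longrightarrow>
      evb P rho (Call f e) (foldd g (list_data ds) acc) (t + (c + 49) * length ds + 20) \<and> Q (foldd g (list_data ds) acc)"
  using b
proof (induction ds arbitrary: acc rho e t)
  case Nil
  have "evb P [Cell Null (Cell acc d)] (fold_fun f b) acc 10"
    unfolding fold_fun_def Let_def
    by (rule evb_eq, rule evb_IfF, (rule evb_eq, (rule evb_prims)+, simp, rule le_refl)+) (auto)
  from evb_mono[OF evb_Call[OF Nil(2)[simplified] f(1), unfolded f(2), OF this], of "t + 20"]
  show ?case using Nil(1) by simp
next
  case (Cons x ds)
  let ?E = "[Cell (Cell x (list_data ds)) (Cell acc d)]"
  have *: "evb P (Cell x (Cell acc d) # ?E) b (g x acc) c" and Q: "Q (g x acc)"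
    using Cons.prems by auto
  let ?arg = "pr2 (tl1 (hd1 (Var 0))) (pr2 (LetIn (pr2 (hd1 (hd1 (Var 0))) (pr2 (hd1 (tl1 (Var 0))) (tl1 (tl1 (Var 0))))) b) (tl1 (tl1 (Var 0))))"
  have let1: "evb P ?E (LetIn (pr2 (hd1 (hd1 (Var 0))) (pr2 (hd1 (tl1 (Var 0))) (tl1 (tl1 (Var 0))))) b)
       (g x acc) (c + 20)"
    by (rule evb_eq, rule evb_LetIn, (rule evb_prims)+, simp, rule *) auto
  have arg: "evb P ?E ?arg (Cell (list_data ds) (Cell (g x acc) d)) (c + 28)"
    by (rule evb_eq, rule evb_Prim2[OF _ evb_Prim2[OF let1]], (rule evb_prims)+) (auto)
  have rec: "evb P ?E (Call f ?arg) (foldd g (list_data ds) (g x acc))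
      (c + 28 + (c + 49) * length ds + 20) \<and> Q (foldd g (list_data ds) (g x acc))"
  proof (rule Cons.IH[OF Q arg])
    show "Q (g x acc) \<and> evb P (Cell x (Cell acc d) # rho) b (g x acc) c" if "x \<in> set ds" "Q acc" for x acc rho
      using Cons.prems(3) that by simp
  qed
  have body: "evb P ?E (fold_fun f b) (foldd g (list_data ds) (g x acc)) (c + 28 + (c + 49) * length ds + 20 + 3)"
    unfolding fold_fun_def Let_def
    by (rule evb_eq, rule evb_IfT, (rule evb_prims)+, rule rec[THEN conjunct1])
      (auto)
  have "evb P rho (Call f e) (foldd g (list_data ds) (g x acc))
       (t + (c + 28 + (c + 49) * length ds + 20 + 3) + 1)"
    by (rule evb_Call[OF Cons.prems(2) f(1), unfolded f(2) list_data.simps, OF body])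
  then have "evb P rho (Call f e) (foldd g (list_data ds) (g x acc)) (t + (c + 49) * length (x # ds) + 20)"
    by (rule evb_mono) (simp add: algebra_simps)
  then show ?case using rec by simp
qed

lemma evb_app:
  assumes f: "f < length P" "P ! f = app_fun f"
  shows "evb P rho e (Cell (list_data ds) ys) t \<Longrightarrow>
      evb P rho (Call f e) (appd (list_data ds) ys) (t + 49 * length ds + 20)"
proof (induction ds arbitrary: rho e t)
  case Nil
  have "evb P [Cell Null ys] (app_fun f) ys 10"
    unfolding app_fun_def Let_def
    by (rule evb_eq, rule evb_IfF, (rule evb_eq, (rule evb_prims)+, simp, rule le_refl)+) (auto)
  from evb_Call[OF Nil(1)[simplified] f(1), unfolded f(2), OF this] show ?case
    by (rule evb_eq) auto
next
  case (Cons x ds)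
  let ?E = "[Cell (Cell x (list_data ds)) ys]"
  let ?arg = "pr2 (tl1 (hd1 (Var 0))) (tl1 (Var 0))"
  have arg: "evb P ?E ?arg (Cell (list_data ds) ys) 6"
    by (rule evb_eq, (rule evb_prims)+) (auto)
  note rec = Cons.IH[OF arg]
  have body: "evb P ?E (app_fun f) (Cell x (appd (list_data ds) ys)) (6 + 49 * length ds + 20 + 20)"
    unfolding app_fun_def Let_def
    by (rule evb_eq, rule evb_IfT, rule evb_Prim1, rule evb_Var0, rule evb_Prim2[OF _ rec], (rule evb_prims)+)
      (auto)
  have "evb P rho (Call f e) (Cell x (appd (list_data ds) ys)) (t + (6 + 49 * length ds + 20 + 20) + 1)"
    by (rule evb_Call[OF Cons.prems(1) f(1), unfolded f(2) list_data.simps, OF body])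
  then show ?case by (rule evb_eq) (simp_all add: algebra_simps)
qed


lemma mapd_list_data:
  assumes "\<And>i x y. x \<in> set ds \<Longrightarrow> y \<in> Y \<Longrightarrow> g i x y \<in> U"
    and "\<And>j. apply1 Head ((apply1 Tail ^^ j) ys) \<in> Y"
  shows "\<exists>es. mapd g (list_data ds) ys i = list_data es \<and> length es = length ds \<and> set es \<subseteq> U"
  using assms
proof (induction ds arbitrary: ys i)
  case Nil then show ?case by simp
next
  case (Cons x ds)
  have 1: "apply1 Head ((apply1 Tail ^^ j) (apply1 Tail ys)) \<in> Y" for j
    using Cons.prems(2)[of "Suc j"] by (simp add: funpow_swap1)
  have 2: "g i x (apply1 Head ys) \<in> U" using Cons.prems(1)[of x "apply1 Head ys" i] Cons.prems(2)[of 0] by simp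
  have 3: "g i x y \<in> U" if "x \<in> set ds" "y \<in> Y" for i x y using Cons.prems(1) that by simp
  obtain es where "mapd g (list_data ds) (apply1 Tail ys) (apply2 Add i (Atom 1)) = list_data es" "length es = length ds"
     "set es \<subseteq> U" using Cons.IH[OF 3 1] by blast
  then show ?case using 2 by (intro exI[of _ "g i x (apply1 Head ys) # es"]) simp
qed

lemma heads_typed:
  assumes "has_ty N T ys" "len_ty T = Some l"
  shows "has_ty N (elem_ty T) (apply1 Head ((apply1 Tail ^^ j) ys))"
proof -
  obtain ds where ds: "ys = list_data ds" "\<forall>x\<in>set ds. has_ty N (elem_ty T) x"
    using list_tyD[OF assms] by auto
  have "(apply1 Tail ^^ j) (list_data ds) = list_data (drop j ds)" for ds
  proof (induction j arbitrary: ds)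
    case (Suc j)
    have "apply1 Tail (list_data ds) = list_data (tl ds)" by (cases ds) auto
    then show ?case using Suc[of "tl ds"] by (simp add: funpow_swap1 drop_Suc)
  qed simp
  moreover have "has_ty N (elem_ty T) (apply1 Head (list_data (drop j ds)))"
  proof (cases "drop j ds")
    case Nil then show ?thesis by (simp add: has_ty_Null)
  next
    case (Cons a list)
    then have "a \<in> set ds" by (metis in_set_dropD list.set_intros(1))
    then show ?thesis using Cons ds by simp
  qed
  ultimately show ?thesis using ds(1) by simp
qed

lemma appd_list_data: "appd (list_data ds) (list_data es) = list_data (ds @ es)"
  by (induction ds) auto

lemma ty_of_MapTE:
  assumes "ty_of (MapT xs ys b) G = Some W"
  obtains S k T l U where "ty_of xs G = Some S" "len_ty S = Some k" "ty_of ys G = Some T" "len_ty T = Some l"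
    "ty_of b (Pr Any (Pr (elem_ty S) (Pr (elem_ty T) G))) = Some U" "k \<le> 3" "W = Lst k U"
proof -
  obtain S where 1: "ty_of xs G = Some S" using assms by (cases "ty_of xs G") auto
  obtain k where 2: "len_ty S = Some k" using assms by (cases "len_ty S") (auto simp: 1)
  obtain T where 3: "ty_of ys G = Some T" using assms by (cases "ty_of ys G") (auto simp: 1 2)
  obtain l where 4: "len_ty T = Some l" using assms by (cases "len_ty T") (auto simp: 1 2 3)
  obtain U where 5: "ty_of b (Pr Any (Pr (elem_ty S) (Pr (elem_ty T) G))) = Some U"
    using assms by (cases "ty_of b (Pr Any (Pr (elem_ty S) (Pr (elem_ty T) G)))") (auto simp: 1 2 3 4)
  have 6: "k \<le> 3" using assms by (rule contrapos_pp) (auto simp: 1 2 3 4 5)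
  show thesis using that[OF 1 2 3 4 5 6] assms 6 by (simp add: 1 2 3 4 5)
qed

lemma ty_of_FoldTE:
  assumes "ty_of (FoldT A xs e b) G = Some W"
  obtains S k T U where "ty_of xs G = Some S" "len_ty S = Some k" "ty_of e G = Some T"
    "ty_of b (Pr (elem_ty S) (Pr A G)) = Some U" "k \<le> 3" "sub_ty T A" "sub_ty U A" "W = A"
proof -
  obtain S where 1: "ty_of xs G = Some S" using assms by (cases "ty_of xs G") auto
  obtain k where 2: "len_ty S = Some k" using assms by (cases "len_ty S") (auto simp: 1)
  obtain T where 3: "ty_of e G = Some T" using assms by (cases "ty_of e G") (auto simp: 1 2)
  obtain U where 4: "ty_of b (Pr (elem_ty S) (Pr A G)) = Some U"
    using assms by (cases "ty_of b (Pr (elem_ty S) (Pr A G))") (auto simp: 1 2 3)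
  have 5: "k \<le> 3 \<and> sub_ty T A \<and> sub_ty U A" using assms by (rule contrapos_pp) (auto simp: 1 2 3 4)
  show thesis using that[OF 1 2 3 4] assms 5 by (simp add: 1 2 3 4)
qed

lemma ty_of_AppTE:
  assumes "ty_of (AppT xs ys) G = Some W"
  obtains S k T l where "ty_of xs G = Some S" "len_ty S = Some k" "ty_of ys G = Some T" "len_ty T = Some l"
    "k \<le> 3" "W = Lst (k + l) (join_ty (elem_ty S) (elem_ty T))"
proof -
  obtain S where 1: "ty_of xs G = Some S" using assms by (cases "ty_of xs G") auto
  obtain k where 2: "len_ty S = Some k" using assms by (cases "len_ty S") (auto simp: 1)
  obtain T where 3: "ty_of ys G = Some T" using assms by (cases "ty_of ys G") (auto simp: 1 2)
  obtain l where 4: "len_ty T = Some l" using assms by (cases "len_ty T") (auto simp: 1 2 3)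
  have 6: "k \<le> 3" using assms by (rule contrapos_pp) (auto simp: 1 2 3 4)
  show thesis using that[OF 1 2 3 4 6] assms 6 by (simp add: 1 2 3 4)
qed

theorem code_of_correct:
  "ty_of e G = Some T \<Longrightarrow> has_ty N G d \<Longrightarrow> placed P k (snd (code_of e k)) \<Longrightarrow>
    evb P (d # rho) (fst (code_of e k)) (sem e d) (poly (cost e) N) \<and> has_ty N T (sem e d)"
proof (induction e arbitrary: G T d k rho)
  case (V i)
  then show ?case using evb_Prim1[OF evb_pow[of P d rho i], of Head]
    by (auto intro!: op1_ty_sound op1_ty_pow_sound)
next
  case Nil0 then show ?case using evb_NullE[of P "d # rho"] by auto
next
  case Zr then show ?case using evb_Zero[of P "d # rho"] by auto
next
  case On then show ?case using evb_One[of P "d # rho"] by auto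
next
  case (Op1 p e)
  obtain T1 where ty: "ty_of e G = Some T1" and T: "T = op1_ty p T1"
    using Op1.prems(1) by (auto split: option.splits)
  obtain x1 fs1 where 1: "code_of e k = (x1, fs1)" by force
  have P: "placed P k fs1" using Op1.prems(3) by (simp add: 1)
  note I1 = Op1.IH[OF ty Op1.prems(2), of k rho, unfolded 1 fst_conv snd_conv, OF P]
  show ?case using evb_Prim1[OF I1[THEN conjunct1], of p] I1 by (auto simp: 1 T intro: op1_ty_sound)
next
  case (Op2 p e1 e2)
  obtain T1 T2 where ty: "ty_of e1 G = Some T1" "ty_of e2 G = Some T2"
    and T: "T = op2_ty p T1 T2"
    using Op2.prems(1) by (auto split: option.splits)
  obtain x1 fs1 where 1: "code_of e1 k = (x1, fs1)" by force
  obtain x2 fs2 where 2: "code_of e2 (k + length fs1) = (x2, fs2)" by force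
  have P: "placed P k fs1" "placed P (k + length fs1) fs2"
    using Op2.prems(3) by (auto simp: 1 2 placed_append)
  note I1 = Op2.IH(1)[OF ty(1) Op2.prems(2), of k rho, unfolded 1 fst_conv snd_conv, OF P(1)]
  note I2 = Op2.IH(2)[OF ty(2) Op2.prems(2), of "k + length fs1" rho, unfolded 2 fst_conv snd_conv, OF P(2)]
  show ?case using evb_Prim2[OF I1[THEN conjunct1] I2[THEN conjunct1], of p] I1 I2 
    by (auto simp: 1 2 T intro: op2_ty_sound)
next
  case (Ite e e1 e2)
  obtain T0 T1 T2 where ty: "ty_of e G = Some T0" "ty_of e1 G = Some T1" "ty_of e2 G = Some T2"
    and T: "T = join_ty T1 T2"
    using Ite.prems(1) by (auto split: option.splits)
  obtain x0 fs0 where 0: "code_of e k = (x0, fs0)" by force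
  obtain x1 fs1 where 1: "code_of e1 (k + length fs0) = (x1, fs1)" by force
  obtain x2 fs2 where 2: "code_of e2 (k + length fs0 + length fs1) = (x2, fs2)" by force
  have P: "placed P k fs0" "placed P (k + length fs0) fs1" "placed P (k + length fs0 + length fs1) fs2"
    using Ite.prems(3) by (auto simp: 0 1 2 placed_append)
  note I0 = Ite.IH(1)[OF ty(1) Ite.prems(2), of k rho, unfolded 0 fst_conv snd_conv, OF P(1)]
  note I1 = Ite.IH(2)[OF ty(2) Ite.prems(2), of "k + length fs0" rho, unfolded 1 fst_conv snd_conv, OF P(2)]
  note I2 = Ite.IH(3)[OF ty(3) Ite.prems(2), of "k + length fs0 + length fs1" rho, unfolded 2 fst_conv snd_conv, OF P(3)]
  show ?case using evb_If[OF I0[THEN conjunct1] I1[THEN conjunct1] I2[THEN conjunct1]] I0 I1 I2 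
    by (auto simp: 0 1 2 T intro: join_ty_sound)
next
  case (Let1 e1 e2)
  obtain T1 where ty: "ty_of e1 G = Some T1" "ty_of e2 (Pr T1 G) = Some T"
    using Let1.prems(1) by (auto split: option.splits)
  obtain x1 fs1 where 1: "code_of e1 k = (x1, fs1)" by force
  obtain x2 fs2 where 2: "code_of e2 (k + length fs1) = (x2, fs2)" by force
  have P: "placed P k fs1" "placed P (k + length fs1) fs2"
    using Let1.prems(3) by (auto simp: 1 2 placed_append)
  note I1 = Let1.IH(1)[OF ty(1) Let1.prems(2), of k rho, unfolded 1 fst_conv snd_conv, OF P(1)]
  have "has_ty N (Pr T1 G) (Cell (sem e1 d) d)" using I1 Let1.prems(2) by simp
  note I2 = Let1.IH(2)[OF ty(2) this, of "k + length fs1" "d # rho", unfolded 2 fst_conv snd_conv, OF P(2)]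
  have "evb P (d # rho) (LetIn (pr2 x1 (Var 0)) x2) (sem e2 (Cell (sem e1 d) d)) (poly (cost e1) N + 1 + 1 + poly (cost e2) N + 1)"
    by (rule evb_LetIn[OF _ I2[THEN conjunct1]])
      (rule evb_Prim2[OF I1[THEN conjunct1] evb_Var0, of Pair, simplified apply2.simps])
  from evb_mono[OF this, of "poly (cost (Let1 e1 e2)) N"] show ?case using I2 by (simp add: 1 2)
next
  case (MapT xs ys b)
  obtain S k1 T2 l U where ty: "ty_of xs G = Some S" "len_ty S = Some k1"
    "ty_of ys G = Some T2" "len_ty T2 = Some l"
    "ty_of b (Pr Any (Pr (elem_ty S) (Pr (elem_ty T2) G))) = Some U" and k3: "k1 \<le> 3" and T: "T = Lst k1 U"
    using MapT.prems(1) by (rule ty_of_MapTE)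
  obtain x1 fs1 where 1: "code_of xs k = (x1, fs1)" by force
  obtain x2 fs2 where 2: "code_of ys (k + length fs1) = (x2, fs2)" by force
  let ?f = "k + length fs1 + length fs2"
  obtain x3 fs3 where 3: "code_of b (Suc ?f) = (x3, fs3)" by force
  have P: "placed P k fs1" "placed P (k + length fs1) fs2" "placed P (Suc ?f) fs3" 
     and f: "?f < length P" "P ! ?f = map_fun ?f x3"
    using MapT.prems(3) by (auto simp: 1 2 3 placed_append placed_Cons Let_def)
  note I1 = MapT.IH(1)[OF ty(1) MapT.prems(2), of k rho, unfolded 1 fst_conv snd_conv, OF P(1)]
  note I2 = MapT.IH(2)[OF ty(3) MapT.prems(2), of "k + length fs1" rho, unfolded 2 fst_conv snd_conv, OF P(2)]
  obtain ds where ds: "sem xs d = list_data ds" "length ds \<le> k1 * N" "\<forall>x\<in>set ds. has_ty N (elem_ty S) x"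
    using list_tyD I1 ty(2) by blast
  let ?g = "\<lambda>i x y. sem b (Cell i (Cell x (Cell y d)))"
  let ?Y = "{y. has_ty N (elem_ty T2) y}"
  have ev: "evb P (Cell i (Cell x (Cell y d)) # rho) x3 (?g i x y) (poly (cost b) N) \<and> has_ty N U (?g i x y)" 
    if "x \<in> set ds" "y = Null \<or> y \<in> ?Y" for i x y rho
  proof -
    have "has_ty N (Pr Any (Pr (elem_ty S) (Pr (elem_ty T2) G))) (Cell i (Cell x (Cell y d)))"
      using that ds MapT.prems(2) by (auto simp: has_ty_Null)
    from MapT.IH(3)[OF ty(5) this, of "Suc ?f" rho, unfolded 3 fst_conv snd_conv, OF P(3)] show ?thesis .
  qed
  have heads: "apply1 Head ((apply1 Tail ^^ j) (sem ys d)) \<in> ?Y" for j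
    using heads_typed I2 ty(4) by blast
  have "evb P (d # rho) (pr2 x1 (pr2 x2 (pr2 Zero (Var 0)))) 
     (Cell (list_data ds) (Cell (sem ys d) (Cell (Atom 0) d))) (poly (cost xs) N + poly (cost ys) N + 5)"
    by (rule evb_eq, rule evb_Prim2, rule I1[THEN conjunct1], rule evb_Prim2, rule I2[THEN conjunct1], (rule evb_prims)+) 
      (auto simp: ds)
  from evb_map[OF f ev[THEN conjunct1] heads this]
  have E: "evb P (d # rho) (Call ?f (pr2 x1 (pr2 x2 (pr2 Zero (Var 0))))) (mapd ?g (list_data ds) (sem ys d) (Atom 0))
     (poly (cost xs) N + poly (cost ys) N + 5 + (poly (cost b) N + 49) * length ds + 20)" .
  have "(poly (cost b) N + 49) * length ds \<le> (poly (cost b) N + 50) * (3 * N)"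
    using ds(2) mult_le_mono1[OF k3, of N] by (intro mult_le_mono) linarith+
  then have le: "poly (cost xs) N + poly (cost ys) N + 5 + (poly (cost b) N + 49) * length ds + 20 \<le> poly (cost (MapT xs ys b)) N"
    by (simp add: poly_passes algebra_simps)
  have "has_ty N (Lst k1 U) (mapd ?g (list_data ds) (sem ys d) (Atom 0))"
  proof -
    obtain es where es: "mapd ?g (list_data ds) (sem ys d) (Atom 0) = list_data es" "length es = length ds"
       "set es \<subseteq> {x. has_ty N U x}"
      using mapd_list_data[of ds ?Y ?g "{x. has_ty N U x}" "sem ys d" "Atom 0"] ev heads by blast
    then have "length es \<le> k1 * N" "\<forall>x\<in>set es. has_ty N U x" using ds(2) by auto
    then show ?thesis using es(1) by auto
  qed
  then show ?case using evb_mono[OF E le] by (simp add: 1 2 3 T ds(1) Let_def del: has_ty.simps)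
next
  case (FoldT A xs e b)
  obtain S k1 T2 U where ty: "ty_of xs G = Some S" "len_ty S = Some k1"
    "ty_of e G = Some T2" "ty_of b (Pr (elem_ty S) (Pr A G)) = Some U" and k3: "k1 \<le> 3"
    and sub: "sub_ty T2 A" "sub_ty U A" and T: "T = A"
    using FoldT.prems(1) by (rule ty_of_FoldTE)
  obtain x1 fs1 where 1: "code_of xs k = (x1, fs1)" by force
  obtain x2 fs2 where 2: "code_of e (k + length fs1) = (x2, fs2)" by force
  let ?f = "k + length fs1 + length fs2"
  obtain x3 fs3 where 3: "code_of b (Suc ?f) = (x3, fs3)" by force
  have P: "placed P k fs1" "placed P (k + length fs1) fs2" "placed P (Suc ?f) fs3" 
     and f: "?f < length P" "P ! ?f = fold_fun ?f x3"
    using FoldT.prems(3) by (auto simp: 1 2 3 placed_append placed_Cons Let_def)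
  note I1 = FoldT.IH(1)[OF ty(1) FoldT.prems(2), of k rho, unfolded 1 fst_conv snd_conv, OF P(1)]
  note I2 = FoldT.IH(2)[OF ty(3) FoldT.prems(2), of "k + length fs1" rho, unfolded 2 fst_conv snd_conv, OF P(2)]
  obtain ds where ds: "sem xs d = list_data ds" "length ds \<le> k1 * N" "\<forall>x\<in>set ds. has_ty N (elem_ty S) x"
    using list_tyD I1 ty(2) by blast
  let ?g = "\<lambda>x acc. sem b (Cell x (Cell acc d))"
  have ev: "has_ty N A (?g x acc) \<and> evb P (Cell x (Cell acc d) # rho) x3 (?g x acc) (poly (cost b) N)" 
    if "x \<in> set ds" "has_ty N A acc" for x acc rho
  proof -
    have "has_ty N (Pr (elem_ty S) (Pr A G)) (Cell x (Cell acc d))"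
      using that ds FoldT.prems(2) by auto
    from FoldT.IH(3)[OF ty(4) this, of "Suc ?f" rho, unfolded 3 fst_conv snd_conv, OF P(3)] sub_ty_sound[OF sub(2)]
    show ?thesis by blast
  qed
  have "evb P (d # rho) (pr2 x1 (pr2 x2 (Var 0))) 
     (Cell (list_data ds) (Cell (sem e d) d)) (poly (cost xs) N + poly (cost e) N + 5)"
    by (rule evb_eq, rule evb_Prim2, rule I1[THEN conjunct1], rule evb_Prim2, rule I2[THEN conjunct1], (rule evb_prims)+) 
      (auto simp: ds)
  from evb_fold[OF f ev sub_ty_sound[OF sub(1) I2[THEN conjunct2]] this]
  have *: "evb P (d # rho) (Call ?f (pr2 x1 (pr2 x2 (Var 0)))) (foldd ?g (list_data ds) (sem e d))
     (poly (cost xs) N + poly (cost e) N + 5 + (poly (cost b) N + 49) * length ds + 20) \<and> has_ty N A (foldd ?g (list_data ds) (sem e d))" .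
  have "(poly (cost b) N + 49) * length ds \<le> (poly (cost b) N + 50) * (3 * N)"
    using ds(2) mult_le_mono1[OF k3, of N] by (intro mult_le_mono) linarith+
  then have le: "poly (cost xs) N + poly (cost e) N + 5 + (poly (cost b) N + 49) * length ds + 20 \<le> poly (cost (FoldT A xs e b)) N"
    by (simp add: poly_passes algebra_simps)
  from evb_mono[OF *[THEN conjunct1] le] *[THEN conjunct2] show ?case
    by (simp add: 1 2 3 T ds(1) Let_def del: has_ty.simps)
next
  case (AppT xs ys)
  obtain S k1 T2 l where ty: "ty_of xs G = Some S" "len_ty S = Some k1"
    "ty_of ys G = Some T2" "len_ty T2 = Some l" and k3: "k1 \<le> 3" and T: "T = Lst (k1 + l) (join_ty (elem_ty S) (elem_ty T2))"
    using AppT.prems(1) by (rule ty_of_AppTE)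
  obtain x1 fs1 where 1: "code_of xs k = (x1, fs1)" by force
  obtain x2 fs2 where 2: "code_of ys (k + length fs1) = (x2, fs2)" by force
  let ?f = "k + length fs1 + length fs2"
  have P: "placed P k fs1" "placed P (k + length fs1) fs2"
     and f: "?f < length P" "P ! ?f = app_fun ?f"
    using AppT.prems(3) by (auto simp: 1 2 placed_append placed_Cons Let_def)
  note I1 = AppT.IH(1)[OF ty(1) AppT.prems(2), of k rho, unfolded 1 fst_conv snd_conv, OF P(1)]
  note I2 = AppT.IH(2)[OF ty(3) AppT.prems(2), of "k + length fs1" rho, unfolded 2 fst_conv snd_conv, OF P(2)]
  obtain ds where ds: "sem xs d = list_data ds" "length ds \<le> k1 * N" "\<forall>x\<in>set ds. has_ty N (elem_ty S) x"
    using list_tyD I1 ty(2) by blast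
  obtain es where es: "sem ys d = list_data es" "length es \<le> l * N" "\<forall>x\<in>set es. has_ty N (elem_ty T2) x"
    using list_tyD I2 ty(4) by blast
  have "evb P (d # rho) (pr2 x1 x2) (Cell (list_data ds) (sem ys d)) (poly (cost xs) N + poly (cost ys) N + 1)"
    by (rule evb_eq, rule evb_Prim2, rule I1[THEN conjunct1], rule I2[THEN conjunct1]) 
      (auto simp: ds)
  from evb_app[OF f this]
  have *: "evb P (d # rho) (Call ?f (pr2 x1 x2)) (appd (list_data ds) (sem ys d))
     (poly (cost xs) N + poly (cost ys) N + 1 + 49 * length ds + 20)" .
  have le: "poly (cost xs) N + poly (cost ys) N + 1 + 49 * length ds + 20 \<le> poly (cost (AppT xs ys)) N"
  proof -
    have "length ds \<le> 3 * N" using ds(2) mult_le_mono1[OF k3, of N] by linarith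
    then show ?thesis by (simp add: poly_passes)
  qed
  have "has_ty N T (appd (list_data ds) (sem ys d))"
  proof -
    have "length (ds @ es) \<le> (k1 + l) * N" using ds(2) es(2) by (simp add: add_mult_distrib)
    moreover have "\<forall>x\<in>set (ds @ es). has_ty N (join_ty (elem_ty S) (elem_ty T2)) x"
      using ds(3) es(3) by (auto intro: join_ty_sound)
    ultimately show ?thesis unfolding T ds(1) es(1) appd_list_data has_ty.simps by blast
  qed
  then show ?case using evb_mono[OF * le] by (simp add: 1 2 ds(1) Let_def del: has_ty.simps)
qed

definition compile :: "trm \<Rightarrow> program" where
  "compile e = (let (c, fs) = code_of e 1 in c # fs)"

theorem compile_correct:
  assumes "ty_of e G = Some T" "has_ty N G d"
  shows "\<exists>t \<le> poly (cost e + 2) N. runs (compile e) d (sem e d) t"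
proof -
  obtain x fs where x: "code_of e (Suc 0) = (x, fs)" by force
  have P: "placed (compile e) (Suc 0) fs" using x by (simp add: compile_def placed_def)
  have "evb (compile e) [d] x (sem e d) (poly (cost e) N)"
    using code_of_correct[OF assms, of "compile e" "Suc 0" "[]"] P x by simp
  from evb_Call[OF evb_Var0, of 0 "compile e" d "sem e d" "poly (cost e) N" "[]"] this
  have "evb (compile e) [d] (Call 0 (Var 0)) (sem e d) (1 + poly (cost e) N + 1)"
    using x by (simp add: compile_def)
  then show ?thesis unfolding evb_def runs_def by simp
qed

definition vecD :: "nat \<Rightarrow> (nat \<Rightarrow> data) \<Rightarrow> data" where
  "vecD n f = list_data (map f [0..<n])"

definition bd :: "bool \<Rightarrow> data" where "bd b = (if b then Cell Null Null else Null)"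

lemma bd_Null[simp]: "bd b = Null \<longleftrightarrow> \<not> b" by (simp add: bd_def)
lemma bd_False[simp]: "bd False = Null" by (simp add: bd_def)

lemma vecD_cong[cong]: "n = n' \<Longrightarrow> (\<And>i. i < n' \<Longrightarrow> f i = g i) \<Longrightarrow> vecD n f = vecD n' g"
  unfolding vecD_def by (auto intro: arg_cong[of _ _ list_data])

lemma vecD_0[simp]: "vecD 0 f = Null" by (simp add: vecD_def)

lemma mapd_list:
  "length xs \<le> length ys \<Longrightarrow> mapd h (list_data xs) (list_data ys) (Atom r) =
     list_data (map (\<lambda>i. h (Atom (r + real i)) (xs ! i) (ys ! i)) [0..<length xs])"
proof (induction xs arbitrary: ys r)
  case Nil then show ?case by simp
next
  case (Cons x xs)
  obtain y ys' where ys: "ys = y # ys'" using Cons.prems by (cases ys) auto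
  have "map (\<lambda>i. h (Atom (r + real i)) ((x # xs) ! i) (ys ! i)) [0..<length (x # xs)] =
     h (Atom r) x y # map (\<lambda>i. h (Atom (r + 1 + real i)) (xs ! i) (ys' ! i)) [0..<length xs]"
    unfolding ys by (subst upt_conv_Cons) (simp_all add: map_Suc_upt[symmetric] add.assoc del: upt_Suc)
  then show ?case using Cons.IH[of ys' "r + 1"] Cons.prems unfolding ys by simp
qed

lemma mapd_vecD[simp]:
  "n \<le> n' \<Longrightarrow> mapd h (vecD n f) (vecD n' g) (Atom 0) = vecD n (\<lambda>i. h (Atom (real i)) (f i) (g i))"
  unfolding vecD_def by (subst mapd_list) (auto intro!: arg_cong[of _ _ list_data])

lemma mapd_Null[simp]: "mapd h Null ys i = Null" by simp

lemma foldd_list: "foldd h (list_data xs) a = fold h xs a"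
  by (induction xs arbitrary: a) auto

lemma foldd_vecD[simp]: "foldd h (vecD n f) a = fold (\<lambda>i. h (f i)) [0..<n] a"
  unfolding vecD_def foldd_list by (simp add: fold_map o_def)

lemma appd_vecD[simp]: "appd (vecD n f) (vecD m g) = vecD (n + m) (\<lambda>i. if i < n then f i else g (i - n))"
proof -
  have "[n..<m + n] = map (\<lambda>i. i + n) [0..<m]" by (rule map_add_upt[symmetric])
  then have "[0..<n + m] = [0..<n] @ map (\<lambda>i. i + n) [0..<m]"
    using upt_add_eq_append[of 0 n m] by (simp only: add.commute[of n m])
  then have "map (\<lambda>i. if i < n then f i else g (i - n)) [0..<n + m] = map f [0..<n] @ map g [0..<m]" by simp
  then show ?thesis unfolding vecD_def appd_list_data by simp
qed

lemma sem_V0[simp]: "sem (V 0) (Cell a d) = a" by simp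
lemma sem_VSuc[simp]: "sem (V (Suc i)) (Cell a d) = sem (V i) d"
  by (simp add: funpow_swap1)
lemma sem_Vnum[simp]: "sem (V (numeral k)) (Cell a d) = sem (V (pred_numeral k)) d"
  unfolding numeral_eq_Suc by (rule sem_VSuc)
lemma sem_V1[simp]: "sem (V 1) (Cell a d) = sem (V 0) d"
  unfolding One_nat_def by (rule sem_VSuc)
declare sem.simps(1)[simp del]

definition firstD :: "nat \<Rightarrow> (nat \<Rightarrow> data) \<Rightarrow> data" where
  "firstD n g = fold (\<lambda>i acc. if acc = Null then g i else acc) [0..<n] Null"

lemma firstD_0[simp]: "firstD 0 g = Null" by (simp add: firstD_def)
lemma firstD_Suc: "firstD (Suc n) g = (if firstD n g = Null then g n else firstD n g)"
  by (simp add: firstD_def)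

lemma firstD_Null[simp]: "firstD n g = Null \<longleftrightarrow> (\<forall>i<n. g i = Null)"
  by (induction n) (auto simp: firstD_Suc less_Suc_eq)

lemma firstD_some: "firstD n g \<noteq> Null \<Longrightarrow> \<exists>i<n. firstD n g = g i"
  by (induction n) (auto simp: firstD_Suc less_Suc_eq)

lemma firstD_pick: "j < n \<Longrightarrow> firstD n (\<lambda>i. if i = j then f i else Null) = f j"
proof -
  assume j: "j < n"
  show ?thesis
  proof (cases "f j = Null")
    case True then show ?thesis by (subst True, subst firstD_Null) auto
  next
    case False
    then have "firstD n (\<lambda>i. if i = j then f i else Null) \<noteq> Null" using j by auto
    then obtain i where "firstD n (\<lambda>i. if i = j then f i else Null) = (if i = j then f i else Null)"
      using firstD_some by blast
    then show ?thesis using \<open>firstD n (\<lambda>i. if i = j then f i else Null) \<noteq> Null\<close> by (auto split: if_splits)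
  qed
qed

abbreviation hd_t where "hd_t \<equiv> Op1 Head"
abbreviation tl_t where "tl_t \<equiv> Op1 Tail"
abbreviation pair where "pair \<equiv> Op2 Pair"
definition tt where "tt = pair Nil0 Nil0"
definition eqT where "eqT a b = Ite (Op2 Le a b) (Op2 Le b a) Nil0"
definition Find where "Find T xs ys b = FoldT T (MapT xs ys b) Nil0 (Ite (V 1) (V 1) (V 0))"

lemma sem_tt[simp]: "sem tt d = Cell Null Null" by (simp add: tt_def)

definition eqd where "eqd a b = (if apply2 Le a b = Null then Null else apply2 Le b a)"

lemma eqd_Atom[simp]: "eqd (Atom x) (Atom y) = bd (x = y)"
  by (auto simp: eqd_def bd_def)

lemma sem_eqT[simp]: "sem (eqT a b) d = eqd (sem a d) (sem b d)"
  by (simp add: eqT_def eqd_def)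

definition findd where
  "findd h xs ys = foldd (\<lambda>x acc. if acc = Null then x else acc) (mapd h xs ys (Atom 0)) Null"

lemma findd_Null[simp]: "findd h Null ys = Null" by (simp add: findd_def)

lemma findd_vecD[simp]: "n \<le> n' \<Longrightarrow> findd h (vecD n f) (vecD n' g) = firstD n (\<lambda>i. h (Atom (real i)) (f i) (g i))"
  by (simp add: findd_def firstD_def)

lemma sem_Find[simp]: "sem (Find T xs ys b) d = findd (\<lambda>i x y. sem b (Cell i (Cell x (Cell y d)))) (sem xs d) (sem ys d)"
  by (simp add: Find_def findd_def if_distrib cong: if_cong)

lemma firstD_cong[cong]: "n = n' \<Longrightarrow> (\<And>i. i < n' \<Longrightarrow> f i = g i) \<Longrightarrow> firstD n f = firstD n' g"
  by (induction n' arbitrary: n) (auto simp: firstD_Suc)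

definition nthd where "nthd xs i = findd (\<lambda>k x y. if eqd k i = Null then Null else x) xs xs"

lemma nthd_vecD[simp]: "i < n \<Longrightarrow> nthd (vecD n f) (Atom (real i)) = f i"
proof -
  assume i: "i < n"
  have "nthd (vecD n f) (Atom (real i)) = firstD n (\<lambda>k. if k = i then f k else Null)"
    unfolding nthd_def by (auto intro!: firstD_cong)
  then show ?thesis using firstD_pick[OF i, of f] by simp
qed

definition NthT where "NthT T xs j = Find T xs xs (Ite (eqT (V 0) (V (j + 3))) (V 1) Nil0)"

lemma sem_NthT[simp]: "sem (NthT T xs j) d = nthd (sem xs d) (sem (V j) d)"
  by (simp add: NthT_def nthd_def numeral_3_eq_3 cong: if_cong)

text \<open>Encodings\<close>

definition elD :: "nat \<Rightarrow> (nat \<Rightarrow> bool) \<Rightarrow> (nat \<Rightarrow> nat \<Rightarrow> real) \<Rightarrow> nat \<Rightarrow> data" where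
  "elD D tg tab a = Cell (bd (tg a)) (vecD D (\<lambda>p. Atom (tab a p)))"
definition tabD where "tabD D tg tab = vecD D (elD D tg tab)"
definition oD :: "nat \<Rightarrow> (nat \<Rightarrow> nat \<Rightarrow> bool) \<Rightarrow> (nat \<times> bool) option \<Rightarrow> data" where
  "oD D N ob = (case ob of None \<Rightarrow> Null | Some (k, t) \<Rightarrow> Cell (bd t) (Cell (Atom (real k)) (vecD D (\<lambda>a. bd (N k a)))))"
definition ownD where "ownD D N own = vecD D (\<lambda>p. oD D N (own p))"
definition setD where "setD D P = vecD D (\<lambda>p. bd (p \<in> P))"

fun stD where "stD D N tg (tab, own, P0, P) = Cell (tabD D tg tab) (Cell (ownD D N own) (Cell (setD D P0) (setD D P)))"

lemma oD_Null[simp]: "oD D N ob = Null \<longleftrightarrow> ob = None"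
  by (auto simp: oD_def split: option.splits)

text \<open>Program pieces\<close>

definition elT where "elT = Pr Any (Lst 3 Any)"
definition oT where "oT = Pr Any (Pr Any (Lst 3 Any))"
definition fT where "fT = Pr Any (Pr oT (Pr Any elT))"
definition toT where "toT = Pr (Lst 3 elT) (Lst 3 oT)"
definition stT where "stT = Pr (Lst 3 elT) (Pr (Lst 3 oT) (Pr (Lst 3 Any) (Lst 3 Any)))"

definition touchT where
  "touchT = Find elT (tl_t (tl_t (V 0))) (V 2)
     (Ite (V 1) (Let1 (tl_t (V 2)) (Ite (eqT (NthT Any (V 0) 5) Zr) Nil0 (V 3))) Nil0)"

definition touchV where
  "touchV D N tg tab ob q = (case ob of None \<Rightarrow> Null | Some (k, t) \<Rightarrow>
     firstD D (\<lambda>a. if N k a \<and> tab a q \<noteq> 0 then elD D tg tab a else Null))"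

lemma elD_Null[simp]: "elD D tg tab a \<noteq> Null" by (simp add: elD_def)

lemma sem_touchT[simp]:
  assumes q: "q < D"
  shows "sem touchT (Cell (oD D N ob) (Cell (Atom (real q)) (Cell (tabD D tg tab) d))) = touchV D N tg tab ob q"
proof -
  show ?thesis
    by (cases ob) (use q in \<open>auto simp: touchT_def oD_def tabD_def elD_def touchV_def cong: if_cong intro!: firstD_cong\<close>)
qed

lemma touchV_Null: "touchV D N tg tab ob q = Null \<longleftrightarrow>
    \<not> (\<exists>k t a. ob = Some (k, t) \<and> a < D \<and> N k a \<and> tab a q \<noteq> 0)"
  unfolding touchV_def by (auto split: option.splits prod.splits)

lemma touchV_some:
  assumes "touchV D N tg tab (Some (k, t)) q \<noteq> Null"
  shows "\<exists>a<D. N k a \<and> tab a q \<noteq> 0 \<and> touchV D N tg tab (Some (k, t)) q = elD D tg tab a"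
proof -
  have *: "touchV D N tg tab (Some (k, t)) q = firstD D (\<lambda>a. if N k a \<and> tab a q \<noteq> 0 then elD D tg tab a else Null)"
    by (simp add: touchV_def)
  obtain a where a: "a < D" "touchV D N tg tab (Some (k, t)) q = (if N k a \<and> tab a q \<noteq> 0 then elD D tg tab a else Null)"
    using firstD_some assms unfolding * by blast
  then show ?thesis using assms by (intro exI[of _ a]) (auto split: if_splits)
qed

definition hitT where
  "hitT = Find fT (hd_t (tl_t (V 0))) (tl_t (tl_t (tl_t (V 0))))
     (Ite (V 2) (Find fT (hd_t (tl_t (V 3))) (hd_t (tl_t (V 3)))
        (Ite (V 1) Nil0 (Let1 (Let1 (hd_t (V 6)) (Let1 (V 1) (Let1 (V 6) touchT)))
           (Ite (V 0) (pair (V 4) (pair (V 5) (pair (V 1) (V 0)))) Nil0)))) Nil0)"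

definition moveT where
  "moveT = pair
     (MapT (hd_t (V 1)) (hd_t (V 1))
        (Let1 (hd_t (tl_t (tl_t (V 3)))) (Let1 (tl_t (tl_t (tl_t (tl_t (V 4)))))
          (Let1 (Op2 Div (NthT Any (tl_t (V 3)) 1) (NthT Any (V 0) 1))
            (pair (hd_t (V 4)) (MapT (tl_t (V 4)) (V 1) (Ite (eqT (V 0) (V 5)) (V 3) (Op2 Sub (V 1) (Op2 Mul (V 3) (V 2))))))))))
     (pair
       (MapT (hd_t (tl_t (V 1))) (hd_t (tl_t (V 1)))
         (Ite (eqT (V 0) (hd_t (tl_t (tl_t (V 3))))) (pair (hd_t (tl_t (tl_t (tl_t (V 3))))) (tl_t (hd_t (tl_t (V 3)))))
           (Ite (eqT (V 0) (hd_t (V 3))) Nil0 (V 1))))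
       (pair (hd_t (tl_t (tl_t (V 1)))) (hd_t (tl_t (tl_t (V 1))))))"

definition growT where
  "growT = pair (hd_t (V 0)) (pair (hd_t (tl_t (V 0))) (pair (hd_t (tl_t (tl_t (V 0))))
     (MapT (tl_t (tl_t (tl_t (V 0)))) (tl_t (tl_t (tl_t (V 0))))
        (Ite (V 1) tt (Ite (Find Any (hd_t (tl_t (V 3))) (tl_t (tl_t (tl_t (V 3))))
           (Ite (V 2) (Let1 (hd_t (V 6)) (Let1 (V 4) (Let1 (V 3) touchT))) Nil0)) tt Nil0)))))"

definition microT where "microT = Let1 hitT (Ite (V 0) moveT (Let1 (V 1) growT))"

definition hitV where
  "hitV D N tg tab own P = firstD D (\<lambda>p. if p \<in> P then firstD D (\<lambda>q.
     if own q \<noteq> None \<or> touchV D N tg tab (own p) q = Null then Null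
     else Cell (Atom (real p)) (Cell (oD D N (own p)) (Cell (Atom (real q)) (touchV D N tg tab (own p) q)))) else Null)"

lemma sem_hitT[simp]: "sem hitT (Cell (stD D N tg (tab, own, P0, P)) d) = hitV D N tg tab own P"
  unfolding hitT_def hitV_def
  by (auto simp: ownD_def setD_def cong: if_cong intro!: firstD_cong)

lemma hitV_Null: "hitV D N tg tab own P = Null \<longleftrightarrow>
   \<not> (\<exists>p<D. p \<in> P \<and> (\<exists>q<D. own q = None \<and> (\<exists>k t a. own p = Some (k, t) \<and> a < D \<and> N k a \<and> tab a q \<noteq> 0)))"
  unfolding hitV_def by (simp add: touchV_Null) blast

lemma hitV_some:
  assumes "hitV D N tg tab own P \<noteq> Null"
  shows "\<exists>p<D. \<exists>q<D. \<exists>k t a. p \<in> P \<and> own q = None \<and> own p = Some (k, t) \<and> a < D \<and> N k a \<and> tab a q \<noteq> 0 \<and>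
       hitV D N tg tab own P = Cell (Atom (real p)) (Cell (oD D N (Some (k, t))) (Cell (Atom (real q)) (elD D tg tab a)))"
proof -
  let ?B = "\<lambda>p q. if own q \<noteq> None \<or> touchV D N tg tab (own p) q = Null then Null
     else Cell (Atom (real p)) (Cell (oD D N (own p)) (Cell (Atom (real q)) (touchV D N tg tab (own p) q)))"
  have "\<exists>p<D. hitV D N tg tab own P = (if p \<in> P then firstD D (?B p) else Null)"
    using firstD_some assms unfolding hitV_def by blast
  then obtain p where p: "p < D" "p \<in> P" "hitV D N tg tab own P = firstD D (?B p)" using assms by (auto split: if_splits)
  have "\<exists>q<D. firstD D (?B p) = ?B p q" using firstD_some[of D "?B p"] assms p(3) by simp
  then obtain q where q: "q < D" "hitV D N tg tab own P = ?B p q" using p(3) by auto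
  have q2: "own q = None" "touchV D N tg tab (own p) q \<noteq> Null"
    using q(2) assms by (cases "own q = None \<and> touchV D N tg tab (own p) q \<noteq> Null"; auto)+
  then obtain k t where k: "own p = Some (k, t)" using touchV_Null[of D N tg tab "own p" q] by auto
  from touchV_some[OF q2(2)[unfolded k]] obtain a where "a < D" "N k a" "tab a q \<noteq> 0" "touchV D N tg tab (own p) q = elD D tg tab a"
    unfolding k by blast
  then show ?thesis using p q q2 k by (intro exI[of _ p] conjI exI[of _ q] exI[of _ k] exI[of _ t] exI[of _ a]) simp_all
qed

lemma sem_moveT:
  assumes q: "q < D" and p: "p < D" and pq: "p \<noteq> q"
  shows "sem moveT (Cell (Cell (Atom (real p)) (Cell (oD D N (Some (k, t))) (Cell (Atom (real q)) (elD D tg tab a))))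
      (Cell (stD D N tg (tab, own, P0, P)) d)) =
    stD D N tg (pivot tab a q, own(q := Some (k, tg a), p := None), P0, P0)"
proof -
  show ?thesis
    unfolding moveT_def using p q pq
    by (auto simp: ownD_def tabD_def elD_def oD_def pivot_def cong: if_cong intro!: vecD_cong)
qed

lemma sem_growT:
  "sem growT (Cell (stD D N tg (tab, own, P0, P)) d) =
    stD D N tg (tab, own, P0, P \<union> {q. \<exists>p<D. p \<in> P \<and> touchV D N tg tab (own p) q \<noteq> Null})"
  unfolding growT_def
  by (auto simp: ownD_def setD_def bd_def cong: if_cong intro!: vecD_cong)


text \<open>Micro steps\<close>

definition micro :: "data \<Rightarrow> data" where "micro s = sem microT (Cell s Null)"

lemma setD_cong: "P \<inter> {..<D} = Q \<inter> {..<D} \<Longrightarrow> setD D P = setD D Q"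
proof -
  assume e: "P \<inter> {..<D} = Q \<inter> {..<D}"
  have "(i \<in> P) = (i \<in> Q)" if "i < D" for i
  proof -
    have "i \<in> P \<inter> {..<D} \<longleftrightarrow> i \<in> Q \<inter> {..<D}" unfolding e ..
    then show ?thesis using that by simp
  qed
  then show ?thesis unfolding setD_def by (intro vecD_cong) simp_all
qed

fun pos_ok :: "nat \<Rightarrow> 'a \<times> 'b \<times> nat set \<times> nat set \<Rightarrow> bool" where
  "pos_ok D (tab, own, P0, P) \<longleftrightarrow> P0 \<subseteq> {..<D} \<and> P \<subseteq> {..<D}"

lemma sem_microT:
  assumes r: "rado D d vb w" and D: "vb + n = D" and P: "pos_ok D st"
  shows "\<exists>st'. rado.mstep n D vb N tg st st' \<and> micro (stD D N tg st) = stD D N tg st' \<and> pos_ok D st'"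
proof -
  interpret rado n D d vb N w tg by (rule r)
  obtain tab own P0 P where st: "st = (tab, own, P0, P)" by (cases st)
  have P0D: "P0 \<subseteq> {..<D}" and PD: "P \<subseteq> {..<D}" using P st by auto
  have m: "micro (stD D N tg (tab, own, P0, P)) = (if hitV D N tg tab own P = Null
      then sem growT (Cell (stD D N tg (tab, own, P0, P)) (Cell Null (Cell (stD D N tg (tab, own, P0, P)) Null)))
      else sem moveT (Cell (hitV D N tg tab own P) (Cell (stD D N tg (tab, own, P0, P)) Null)))"
    unfolding micro_def microT_def by (simp del: stD.simps cong: if_cong)
  have hit: "hitV D N tg tab own P = Null \<longleftrightarrow> \<not> hit tab own P"
    unfolding hitV_Null hit_def touch_def D using PD by blast
  show ?thesis
  proof (cases "hit tab own P")
    case True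
    then have "hitV D N tg tab own P \<noteq> Null" using hit by simp
    from hitV_some[OF this] obtain p q k t a where *: "p < D" "q < D" "p \<in> P" "own q = None" "own p = Some (k, t)" "a < D" "N k a" "tab a q \<noteq> 0"
      and h: "hitV D N tg tab own P = Cell (Atom (real p)) (Cell (oD D N (Some (k, t))) (Cell (Atom (real q)) (elD D tg tab a)))" by blast
    have "p \<noteq> q" using * by auto
    have "micro (stD D N tg st) = stD D N tg (pivot tab a q, own(q := Some (k, tg a), p := None), P0, P0)"
      using \<open>hitV D N tg tab own P \<noteq> Null\<close> unfolding st m h sem_moveT[OF *(2,1) \<open>p \<noteq> q\<close>] by simp
    moreover have "mstep st (pivot tab a q, own(q := Some (k, tg a), p := None), P0, P0)"
      unfolding st using True * D
      by (simp, intro bexI[of _ p] exI[of _ q] conjI exI[of _ k] exI[of _ t] exI[of _ a]) simp_all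
    ultimately show ?thesis using P0D by (intro exI[of _ "(pivot tab a q, own(q := Some (k, tg a), p := None), P0, P0)"]) simp
  next
    case False
    have "micro (stD D N tg st) = stD D N tg (tab, own, P0, P \<union> {q. \<exists>p<D. p \<in> P \<and> touchV D N tg tab (own p) q \<noteq> Null})"
      using False hit unfolding st m sem_growT by simp
    also have "\<dots> = stD D N tg (tab, own, P0, grow tab own P)"
      unfolding stD.simps
      by (intro arg_cong2[of _ _ _ _ Cell] refl setD_cong) (use PD D in \<open>auto simp: grow_def touch_def touchV_Null\<close>)
    finally have "micro (stD D N tg st) = stD D N tg (tab, own, P0, grow tab own P)" .
    moreover have "mstep st (tab, own, P0, grow tab own P)" unfolding st using False by simp
    moreover have "grow tab own P \<subseteq> {..<D}" using PD D unfolding grow_def by auto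
    ultimately show ?thesis using P0D by (intro exI[of _ "(tab, own, P0, grow tab own P)"]) simp
  qed
qed

lemma micro_run:
  assumes r: "rado D d vb w" and D: "vb + n = D" and P: "pos_ok D st"
  shows "\<exists>st'. (rado.mstep n D vb N tg ^^ T) st st' \<and> (micro ^^ T) (stD D N tg st) = stD D N tg st' \<and> pos_ok D st'"
proof (induction T)
  case 0 then show ?case using P by auto
next
  case (Suc T)
  then obtain st' where st': "(rado.mstep n D vb N tg ^^ T) st st'" "(micro ^^ T) (stD D N tg st) = stD D N tg st'" "pos_ok D st'" by blast
  from sem_microT[OF r D st'(3)] obtain st'' where st'': "rado.mstep n D vb N tg st' st''" "micro (stD D N tg st') = stD D N tg st''" "pos_ok D st''" by blast
  have "(rado.mstep n D vb N tg ^^ Suc T) st st''" using st'(1) st''(1) by (rule relpowp_Suc_I)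
  moreover have "(micro ^^ Suc T) (stD D N tg st) = stD D N tg st''" using st'(2) st''(2) by simp
  ultimately show ?case using st''(3) by blast
qed

definition searchT where
  "searchT = Let1 (MapT (tl_t (V 1)) (tl_t (V 1)) (Ite (V 1) (eqT (hd_t (tl_t (V 1))) (V 3)) Nil0))
     (FoldT stT (tl_t (V 2)) (pair (hd_t (V 2)) (pair (tl_t (V 2)) (pair (V 0) (V 0))))
        (FoldT stT (tl_t (V 4)) (V 1) (FoldT stT (tl_t (V 6)) (V 1) (Let1 (V 1) microT))))"

lemma fold_const: "fold (\<lambda>i. F) [0..<n] a = (F ^^ n) a"
  by (induction n arbitrary: a) auto

lemma sem_touchT_env: "sem touchT (Cell a (Cell b (Cell c d))) = sem touchT (Cell a (Cell b (Cell c d')))"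
  by (simp add: touchT_def cong: if_cong)

lemma sem_microT_env: "sem microT (Cell s d) = micro s"
  unfolding micro_def by (simp add: microT_def hitT_def moveT_def growT_def touchT_def cong: if_cong)

definition own_row :: "nat \<Rightarrow> (nat \<Rightarrow> (nat \<times> bool) option) \<Rightarrow> nat \<Rightarrow> nat set" where
  "own_row D own i = {p. p < D \<and> (\<exists>t. own p = Some (i, t))}"

lemma sem_searchT:
  "sem searchT (Cell (Atom (real i)) (Cell (Cell (tabD D tg tab) (ownD D N own)) d)) =
     (micro ^^ (D * D * D)) (stD D N tg (tab, own, own_row D own i, own_row D own i))"
proof -
  have *: "vecD D (\<lambda>p. if own p = None then Null else eqd (apply1 Head (apply1 Tail (oD D N (own p)))) (Atom (real i))) = setD D (own_row D own i)"
    unfolding setD_def own_row_def by (auto simp: oD_def intro!: vecD_cong)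
  show ?thesis
    unfolding searchT_def
    by (simp add: ownD_def sem_microT_env fold_const * funpow_mult cong: if_cong)
qed

definition zeros where "zeros = MapT (V 0) (V 0) Zr"

definition phaseT where
  "phaseT = Let1 zeros (FoldT toT (MapT (V 0) (V 0) (V 0))
     (pair
        (AppT (MapT (V 1) (V 1) (pair Nil0 (AppT (V 1) (AppT (V 3) (V 3)))))
        (AppT (MapT (V 1) (V 1) (pair Nil0 (AppT (MapT (V 3) (V 3) (Ite (eqT (V 0) (V 3)) On Zr)) (AppT (V 3) (V 3)))))
          (MapT (V 3) (V 3) (pair tt (AppT (V 3) (AppT (V 1) (V 3)))))))
        (AppT (MapT (V 0) (V 0) Nil0) (AppT (MapT (V 0) (V 0) Nil0)
          (MapT (V 2) (V 4) (pair tt (pair (V 0)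
             (AppT (MapT (V 3) (V 3) (eqT (V 0) (V 3))) (AppT (V 1)
               (MapT (V 3) (V 3) (Ite (V 5) (eqT (V 0) (V 3)) Nil0))))))))))
     (Let1 searchT (pair (hd_t (V 0)) (hd_t (tl_t (V 0))))))"

definition matD :: "nat \<Rightarrow> (nat \<Rightarrow> nat \<Rightarrow> real) \<Rightarrow> data" where
  "matD n Q = vecD n (\<lambda>i. vecD n (\<lambda>j. Atom (Q i j)))"
definition relD :: "nat \<Rightarrow> (nat \<Rightarrow> nat \<Rightarrow> bool) \<Rightarrow> data" where
  "relD n Q = vecD n (\<lambda>i. vecD n (\<lambda>j. bd (Q i j)))"

definition toD where "toD D N tg to = Cell (tabD D tg (fst to)) (ownD D N (snd to))"

definition rowstep :: "nat \<Rightarrow> data \<Rightarrow> data \<Rightarrow> data" where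
  "rowstep D x to = (let st = sem searchT (Cell x (Cell to Null)) in Cell (apply1 Head st) (apply1 Head (apply1 Tail st)))"

lemma sem_searchT_env: "sem searchT (Cell x (Cell to d)) = sem searchT (Cell x (Cell to Null))"
  unfolding searchT_def by (simp add: sem_microT_env cong: if_cong)

lemma sem_phaseT:
  fixes T :: "(nat \<times> nat) set"
  assumes "0 < n"
  shows "sem phaseT (Cell (matD n Q) (Cell (relD n (\<lambda>i j. (i, j) \<in> T)) (Cell (matD n Y) (Cell (vecD n (\<lambda>i. bd (Yf i))) d)))) =
    fold (\<lambda>i. rowstep (3 * n) (Atom (real i))) [0..<n]
      (toD (3 * n) (pN n T Yf) (\<lambda>a. 2 * n \<le> a) (pvec n Q Y, rado.own0 n (2 * n)))"
proof -
  have D: "n + (n + n) = 3 * n" by simp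
  show ?thesis
    unfolding phaseT_def zeros_def
    apply (simp add: matD_def relD_def D sem_searchT_env[of _ _ "Cell _ _"] cong: if_cong)
    unfolding rowstep_def Let_def toD_def fst_conv snd_conv tabD_def ownD_def
    apply (rule List.fold_cong[OF _ refl refl])
    apply (rule arg_cong2[where f = Cell]; rule vecD_cong[OF refl])
    subgoal premises i for i
    proof -
      consider "i < n" | "n \<le> i" "i < 2 * n" | "2 * n \<le> i" by linarith
      then show ?thesis
      proof cases
        case 1
        have "(if p < n then Atom (Q i p) else Atom 0) = Atom (pvec n Q Y i p)" for p
          using 1 unfolding pvec_def by simp
        then show ?thesis using 1 unfolding elD_def by simp
      next
        case 2
        have "(if p < n then if p \<noteq> i - n then Atom 0 else Atom 1 else Atom 0) = Atom (pvec n Q Y i p)" for p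
          using 2 unfolding pvec_def by simp
        moreover have "\<not> i < n" "i - n < n" using 2 by linarith+
        ultimately show ?thesis using 2 unfolding elD_def by simp
      next
        case 3
        have "(if p < n then Atom 0 else if p - n < n then Atom (Y (i - (n + n)) (p - n)) else Atom 0) = Atom (pvec n Q Y i p)" for p
        proof -
          have "n + n = 2 * n" by simp
          then show ?thesis using 3 i unfolding pvec_def by (simp only: if_distrib[of Atom]) auto
        qed
        moreover have "\<not> i < n" "\<not> i - n < n" using 3 i by linarith+
        ultimately show ?thesis using 3 unfolding elD_def by (simp add: bd_def)
      qed
    qed
    subgoal premises i for i
    proof (cases "2 * n \<le> i")
      case True
      have r: "real i - 2 * real n = real (i - 2 * n)" using True by (simp add: of_nat_diff)
      have o: "rado.own0 n (2 * n) i = Some (i - 2 * n, True)"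
        unfolding rado.own0_def[OF rado_Y] using True i by simp
      have "(if a < n then bd (a = i - (n + n)) else if a - n < n then bd ((i - (n + n), a - n) \<in> T)
          else if \<not> Yf (i - (n + n)) then Null else bd (a - (n + n) = i - (n + n))) = bd (pN n T Yf (i - 2 * n) a)" for a
      proof -
        have nn: "n + n = 2 * n" by simp
        have 1: "\<not> a < 2 * n \<Longrightarrow> (a - 2 * n = i - 2 * n) = (a = 2 * n + (i - 2 * n))" by linarith
        have 2: "a - n < n \<longleftrightarrow> a < 2 * n" if "\<not> a < n" using that by linarith
        show ?thesis unfolding pN_def nn using 1 2
          by (cases "a < n"; cases "a < 2 * n"; cases "Yf (i - 2 * n)") (simp_all add: bd_def)
      qed
      moreover have "\<not> i < n" "\<not> i - n < n" using True assms by linarith+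
      ultimately show ?thesis using r unfolding o oD_def by (simp add: bd_def)
    next
      case False
      then have "rado.own0 n (2 * n) i = None" unfolding rado.own0_def[OF rado_Y] by simp
      moreover have "i < n \<or> i - n < n" using False by linarith
      ultimately show ?thesis by (auto simp: oD_def)
    qed
    done
qed

lemma bound_cube: "3 \<le> D \<Longrightarrow> (D + 1) * (D + 1) \<le> D * D * (D::nat)"
proof -
  assume D: "3 \<le> D"
  have "(D + 1) * (D + 1) = D * D + 2 * D + 1" by simp
  also have "\<dots> \<le> D * D + D * D + D * D" using D mult_le_mono1[of 3 D D] by linarith
  also have "\<dots> = D * D * 3" by simp
  also have "\<dots> \<le> D * D * D" using D by (intro mult_le_mono2)
  finally show ?thesis .
qed

lemma rowstep_search:
  assumes r: "rado D d vb w" and D: "vb + n = D" and D3: "3 \<le> D" and tb: "rado.tableau n D d vb N w tg tab own"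
    and i: "i < n" "i \<notin> rado.rows d own"
  shows "\<exists>tab' own'. rowstep D (Atom (real i)) (toD D N tg (tab, own)) = toD D N tg (tab', own') \<and>
     rado.tableau n D d vb N w tg tab' own' \<and>
     (rado.rows d own' = insert i (rado.rows d own) \<or>
      own' = own \<and> \<not> rado.matchable n D vb N w (insert i (rado.rows d own)))"
proof -
  interpret rado n D d vb N w tg by (rule r)
  have vo: "own (vb + i) = Some (i, True)" by (rule virtual_owner[OF tb i])
  have own_row: "own_row D own i = {vb + i}"
    unfolding own_row_def using vo invD(4)[OF tb] D i(1) by auto
  have "pos_ok D (tab, own, {vb + i}, {vb + i})" using i D by auto
  from micro_run[OF r D this, where N = N and tg = tg and T = "D * D * D"] obtain st' where
    st': "(mstep ^^ (D * D * D)) (tab, own, {vb + i}, {vb + i}) st'" "(micro ^^ (D * D * D)) (stD D N tg (tab, own, {vb + i}, {vb + i})) = stD D N tg st'" by blast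
  obtain tab' own' P0' P' where eq: "st' = (tab', own', P0', P')" by (cases st')
  have rs: "rowstep D (Atom (real i)) (toD D N tg (tab, own)) = toD D N tg (tab', own')"
    unfolding rowstep_def toD_def fst_conv snd_conv sem_searchT own_row st'(2) eq by simp
  have "(vb + n + 1) * (vb + n + 1) \<le> D * D * D" using bound_cube[OF D3] D by simp
  note s = search[OF tb i this st'(1)[unfolded eq]]
  from s(2) show ?thesis
  proof
    assume "rows own' = insert i (rows own)"
    then show ?thesis using rs s(1) by blast
  next
    assume "own' = own \<and> (\<exists>C. closed tab own C \<and> i \<in> rows_of own C \<and> rows_of own C \<subseteq> insert i (rows own))"
    then have "own' = own" "\<not> matchable (insert i (rows own))" using not_matchable_closed[OF tb _ _ i(2)] by blast+
    then show ?thesis using rs s(1) by blast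
  qed
qed

lemma greedy_phase:
  assumes r: "rado D d vb w" and D: "vb + n = D" and D3: "3 \<le> D"
  shows "k \<le> n \<Longrightarrow> \<exists>tab own. fold (\<lambda>i. rowstep D (Atom (real i))) [0..<k] (toD D N tg (w, rado.own0 n vb)) = toD D N tg (tab, own) \<and>
     rado.tableau n D d vb N w tg tab own \<and> rado.rows d own \<subseteq> {..<k} \<and>
     (\<forall>i<k. i \<notin> rado.rows d own \<longrightarrow> \<not> rado.matchable n D vb N w (insert i (rado.rows d own)))"
proof (induction k)
  interpret rado n D d vb N w tg by (rule r)
  case 0
  show ?case using inv0 rows0 by (intro exI[of _ w] exI[of _ own0]) simp
next
  interpret rado n D d vb N w tg by (rule r)
  case (Suc k)
  then obtain tab own where st: "fold (\<lambda>i. rowstep D (Atom (real i))) [0..<k] (toD D N tg (w, own0)) = toD D N tg (tab, own)"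
    "tableau tab own" "rows own \<subseteq> {..<k}" "\<forall>i<k. i \<notin> rows own \<longrightarrow> \<not> matchable (insert i (rows own))" by auto
  have k: "k < n" "k \<notin> rows own" using Suc.prems st(3) by auto
  from rowstep_search[OF r D D3 st(2) k] obtain tab' own' where
    1: "rowstep D (Atom (real k)) (toD D N tg (tab, own)) = toD D N tg (tab', own')" "tableau tab' own'" and
    2: "rows own' = insert k (rows own) \<or> own' = own \<and> \<not> matchable (insert k (rows own))" by blast
  have f: "fold (\<lambda>i. rowstep D (Atom (real i))) [0..<Suc k] (toD D N tg (w, own0)) = toD D N tg (tab', own')"
    using st(1) 1(1) by simp
  have sub: "rows own \<subseteq> rows own'" "rows own' \<subseteq> {..<Suc k}" using 2 st(3) by auto
  have "\<not> matchable (insert i (rows own'))" if i: "i < Suc k" "i \<notin> rows own'" for i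
  proof (cases "i = k")
    case True
    then have "own' = own \<and> \<not> matchable (insert k (rows own))" using 2 i(2) by blast
    then show ?thesis using True by simp
  next
    case False
    then have "i < k" "i \<notin> rows own" using i sub(1) by auto
    then have "\<not> matchable (insert i (rows own))" using st(4) by blast
    then show ?thesis using matchable_subset[of "insert i (rows own')" "insert i (rows own)"] sub(1) by blast
  qed
  then show ?case using f 1(2) sub(2) by blast
qed

lemma reach_search:
  assumes r: "rado D n vb w" and D: "vb + n = D" and D3: "3 \<le> D" and tb: "rado.tableau n D n vb N w tg tab own"
    and full: "{..<n} \<subseteq> rado.rows n own" and i: "i < n"
  shows "\<exists>P P0. sem searchT (Cell (Atom (real i)) (Cell (toD D N tg (tab, own)) d)) = stD D N tg (tab, own, P0, P) \<and>
     P \<subseteq> {..<D} \<and> (let X = rado.rows_of own P in X \<subseteq> {..<n} \<and> i \<in> X \<and> rado.tight n D vb N w X \<and>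
       (\<forall>Y \<subseteq> {..<n}. i \<in> Y \<longrightarrow> rado.tight n D vb N w Y \<longrightarrow> X \<subseteq> Y))"
proof -
  interpret rado n D n vb N w tg by (rule r)
  obtain s t where s: "s < D" "own s = Some (i, t)" using invD(3)[OF tb i] D by auto
  have own_row: "own_row D own i = {s}"
    unfolding own_row_def using s invD(4)[OF tb] by auto
  have "pos_ok D (tab, own, {s}, {s})" using s by auto
  from micro_run[OF r D this, where N = N and tg = tg and T = "D * D * D"] obtain st' where
    st': "(mstep ^^ (D * D * D)) (tab, own, {s}, {s}) st'" "(micro ^^ (D * D * D)) (stD D N tg (tab, own, {s}, {s})) = stD D N tg st'" by blast
  have "D \<le> D * D * D" using D3 by simp
  then have "vb + n \<le> D * D * D" using D by simp
  from full_search[OF tb full refl i s(2) this st'(1)] obtain P where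
    P: "st' = (tab, own, {s}, P)" "P \<subseteq> {..<vb + n}" "rows_of own P \<subseteq> {..<n}" "i \<in> rows_of own P" "tight (rows_of own P)"
      "\<forall>X\<subseteq>{..<n}. i \<in> X \<longrightarrow> tight X \<longrightarrow> rows_of own P \<subseteq> X" by blast
  have "sem searchT (Cell (Atom (real i)) (Cell (toD D N tg (tab, own)) d)) = stD D N tg (tab, own, {s}, P)"
    unfolding toD_def fst_conv snd_conv sem_searchT own_row st'(2) P(1) ..
  then show ?thesis using P D unfolding Let_def by blast
qed

definition to1T where
  "to1T = Let1 (MapT (V 0) (V 0) Nil0) (Let1 (MapT (V 1) (V 1) (MapT (V 1) (V 1) Zr))
     (Let1 (MapT (V 5) (V 4) (MapT (V 1) (V 2) (Ite (eqT (V 1) Zr) (Ite (eqT (V 2) Zr) Nil0 tt) tt)))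
       (Let1 (MapT (V 4) (V 3) (MapT (V 1) (V 2) (Op2 Sub (V 1) (V 2)))) phaseT)))"

definition reachT where
  "reachT = MapT (V 1) (V 1) (Let1 (V 3) (Let1 (V 1) (Let1 searchT
     (MapT (V 7) (V 7) (Find Any (hd_t (tl_t (V 3))) (tl_t (tl_t (tl_t (V 3))))
        (Ite (V 2) (Ite (V 1) (eqT (hd_t (tl_t (V 1))) (V 3)) Nil0) Nil0))))))"

definition aliveT where "aliveT = MapT (V 3) (V 2) (Find Any (V 1) (V 2) (Ite (eqT (V 1) (V 2)) Nil0 tt))"

definition sinkT where
  "sinkT = MapT (V 1) (V 1) (Ite (Find Any (V 1) (V 4)
     (Ite (V 1) (Ite (NthT Any (V 2) 3) (Ite (NthT Any (V 6) 0) Nil0 tt) tt) Nil0)) Nil0 tt)"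

definition to2T where
  "to2T = Let1 (MapT (V 2) (V 2) (MapT (V 1) (V 1) (Ite (V 1) On Zr)))
     (Let1 (MapT (V 8) (V 8) (MapT (V 1) (V 1) (Ite (eqT (V 1) Zr) Nil0 tt))) (Let1 (V 7) phaseT))"

definition outT where
  "outT = MapT (V 1) (V 1) (Ite (Find Any (tl_t (V 3)) (tl_t (V 3))
     (Ite (V 1) (Ite (hd_t (V 1)) Nil0 (eqT (hd_t (tl_t (V 1))) (V 3))) Nil0)) Nil0 tt)"

definition greedyB where
  "greedyB = Ite (Ite (hd_t (tl_t (V 0))) (Ite (Find Any (tl_t (tl_t (V 0))) (V 1) (Ite (V 1) (V 2) Nil0)) Nil0 tt) Nil0)
        (MapT (V 1) (V 1) (Ite (V 1) tt (eqT (V 0) (hd_t (V 3)))))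
        (V 1)"

definition greedyT where
  "greedyT = FoldT (Lst 1 Any) (MapT (V 4) (V 2) (pair (V 0) (pair (V 2) (V 1)))) (V 0) greedyB"

definition mainT where
  "mainT = Let1 to1T (Let1 reachT (Let1 aliveT (Let1 sinkT (Let1 to2T (Let1 outT (Let1 greedyT
     (MapT (V 0) (V 0) (Ite (V 1) On Zr))))))))"

definition mT where "mT = Lst 1 (Lst 1 Any)"

lemma ty_mainT: "ty_of mainT (Pr mT (Pr mT (Pr mT (Pr mT Any)))) = Some (Lst 1 Any)"
  by code_simp

lemma firstD_bd[simp]: "firstD n (\<lambda>i. bd (b i)) = bd (\<exists>i<n. b i)"
proof (induction n)
  case (Suc n) then show ?case by (auto simp: firstD_Suc less_Suc_eq bd_def)
qed simp

lemma mat_data_matD: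
  assumes "M \<in> carrier_mat n n"
  shows "mat_data M = matD n (\<lambda>i j. M $$ (i, j))"
proof -
  have "rows M = map (\<lambda>i. row M i) [0..<n]" using assms unfolding rows_def by auto
  moreover have "list_of_vec (row M i) = map (\<lambda>j. M $$ (i, j)) [0..<n]" if "i < n" for i
    using that assms by (auto intro!: nth_equalityI)
  ultimately show ?thesis unfolding mat_data_def matD_def vecD_def
    by (auto intro!: arg_cong[of _ _ list_data] simp: o_def)
qed

definition patD where "patD n T = matD n (\<lambda>i j. if (i, j) \<in> T then 1 else 0)"

lemma pattern_data_patD: "pattern_data n T = patD n T"
  unfolding pattern_data_def patD_def by (subst mat_data_matD[of _ n]) (auto simp: matD_def intro!: vecD_cong)

lemma system_data_eq:
  assumes "wf_system sys" "n = dim sys"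
  shows "system_data sys = Cell (matD n (\<lambda>i j. QF sys $$ (i, j))) (Cell (matD n (\<lambda>i j. QA sys $$ (i, j)))
     (Cell (patD n (TF sys)) (Cell (patD n (TA sys)) Null)))"
  unfolding system_data_def pattern_data_patD using assms mat_data_matD unfolding wf_system_def by simp

lemma has_ty_matD: "has_ty n mT (matD n Q)"
proof -
  have v: "has_ty n (Lst 1 S) (vecD n f)" if "\<And>i. has_ty n S (f i)" for S f
    unfolding vecD_def has_ty.simps by (rule exI[of _ "map f [0..<n]"]) (use that in auto)
  show ?thesis unfolding mT_def matD_def by (intro v) simp
qed

lemma sem_to1T:
  assumes "0 < n"
  shows "sem to1T (Cell (matD n F) (Cell (matD n A) (Cell (patD n TF') (Cell (patD n TA') d)))) =
    fold (\<lambda>i. rowstep (3 * n) (Atom (real i))) [0..<n]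
      (toD (3 * n) (pN n (TA' \<union> TF') (\<lambda>_. False)) (\<lambda>a. 2 * n \<le> a) (pvec n (\<lambda>i j. A i j - F i j) (\<lambda>_ _. 0), rado.own0 n (2 * n)))"
proof -
  let ?d = "Cell (matD n F) (Cell (matD n A) (Cell (patD n TF') (Cell (patD n TA') d)))"
  have "sem to1T ?d = sem phaseT (Cell (matD n (\<lambda>i j. A i j - F i j)) (Cell (relD n (\<lambda>i j. (i, j) \<in> TA' \<union> TF'))
     (Cell (matD n (\<lambda>_ _. 0)) (Cell (vecD n (\<lambda>i. bd False)) ?d))))"
  proof -
    have e: "((if P then 1 else (0::real)) = 0) = (\<not> P)"
      "(if P then Cell Null Null else if P' then Cell Null Null else Null) = bd (P \<or> P')" for P P'
      by (auto simp: bd_def)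
    show ?thesis unfolding to1T_def by (simp add: matD_def relD_def patD_def e cong: if_cong)
  qed
  then show ?thesis
    unfolding sem_phaseT[OF assms, of "\<lambda>i j. A i j - F i j" "TA' \<union> TF'" "\<lambda>_ _. 0" "\<lambda>_. False" ?d] .
qed

definition greedy_step where
  "greedy_step n R b i S = (if b i \<and> R i \<inter> S = {} then insert i S else (S :: nat set))"

lemma sem_greedyT:
  assumes "\<And>i. i < n \<Longrightarrow> R i \<subseteq> {..<n}"
  shows "sem greedyT (Cell (setD n S) (Cell t (Cell (vecD n (\<lambda>i. bd (b i))) (Cell a (Cell (vecD n (\<lambda>i. setD n (R i))) d))))) =
    setD n (fold (greedy_step n R b) [0..<n] S)"
proof -
  have step: "sem greedyB (Cell (Cell (Atom (real i)) (Cell (bd (b i)) (setD n (R i)))) (Cell (setD n S) d)) = setD n (greedy_step n R b i S)"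
    if i: "i < n" for i S d
  proof -
    have "(\<exists>k<n. k \<in> R i \<and> k \<in> S) \<longleftrightarrow> R i \<inter> S \<noteq> {}" using assms[OF i] by auto
    then show ?thesis
      unfolding greedy_step_def setD_def greedyB_def
      by (auto simp: bd_def cong: if_cong intro!: vecD_cong)
  qed
  have "k \<le> n \<Longrightarrow> fold (\<lambda>i acc. sem greedyB (Cell (Cell (Atom (real i)) (Cell (bd (b i)) (setD n (R i)))) (Cell acc e))) [0..<k] (setD n S)
      = setD n (fold (greedy_step n R b) [0..<k] S)" for k e
    by (induction k) (simp_all add: step)
  then show ?thesis unfolding greedyT_def by simp
qed

definition body_reach where
  "body_reach = Let1 (V 3) (Let1 (V 1) (Let1 searchT
     (MapT (V 7) (V 7) (Find Any (hd_t (tl_t (V 3))) (tl_t (tl_t (tl_t (V 3))))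
        (Ite (V 2) (Ite (V 1) (eqT (hd_t (tl_t (V 1))) (V 3)) Nil0) Nil0)))))"

lemma sem_body_reach:
  assumes "sem searchT (Cell (Atom (real i)) (Cell to (Cell (Atom (real i)) (Cell x (Cell y (Cell to (Cell (vecD n f) d))))))) = stD D N tg (tab, own, P0, P)"
    and "P \<subseteq> {..<D}"
  shows "sem body_reach (Cell (Atom (real i)) (Cell x (Cell y (Cell to (Cell (vecD n f) d))))) =
    setD n {k. k < n \<and> (\<exists>p\<in>P. \<exists>t. own p = Some (k, t))}"
proof -
  have e: "(if p \<notin> P then Null else if own p = None then Null else eqd (apply1 Head (apply1 Tail (oD D N (own p)))) (Atom (real k)))
     = bd (p \<in> P \<and> (\<exists>t. own p = Some (k, t)))" for p k
    by (auto simp: oD_def bd_def split: option.splits)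
  have "(\<exists>p<D. p \<in> P \<and> (\<exists>t. own p = Some (k, t))) \<longleftrightarrow> (\<exists>p\<in>P. \<exists>t. own p = Some (k, t))" for k
    using assms(2) by auto
  then show ?thesis
    unfolding body_reach_def
    by (simp add: assms(1) ownD_def setD_def e cong: if_cong)
qed

lemma sem_reachT:
  assumes n: "0 < n" and tb: "rado.tableau n (3 * n) n (2 * n) (pN n T (\<lambda>_. False)) (pvec n Q (\<lambda>_ _. 0)) tg tab own"
  shows "\<exists>R. (\<forall>i<n. R i \<subseteq> {..<n}) \<and>
     sem reachT (Cell (toD (3 * n) (pN n T (\<lambda>_. False)) tg (tab, own)) (Cell (vecD n f) d)) = vecD n (\<lambda>i. setD n (R i)) \<and>
     ({..<n} \<subseteq> rado.rows n own \<longrightarrow> (\<forall>i<n. least_tight n T Q i (R i)))"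
proof -
  let ?N = "pN n T (\<lambda>_. False)" and ?D = "3 * n" and ?w = "pvec n Q (\<lambda>_ _. 0)"
  let ?to = "toD ?D ?N tg (tab, own)"
  let ?e = "\<lambda>i. Cell (Atom (real i)) (Cell (f i) (Cell (f i) (Cell ?to (Cell (vecD n f) d))))"
  have r: "rado ?D n (2 * n) ?w" by (rule rado_0)
  have D: "2 * n + n = ?D" "3 \<le> ?D" using n by simp_all
  have "\<exists>X \<subseteq> {..<n}. sem body_reach (?e i) = setD n X \<and> ({..<n} \<subseteq> rado.rows n own \<longrightarrow> least_tight n T Q i X)" if i: "i < n" for i
  proof (cases "{..<n} \<subseteq> rado.rows n own")
    case True
    from reach_search[OF r D tb True i, of "?e i"] obtain P P0 where
      s: "sem searchT (Cell (Atom (real i)) (Cell ?to (?e i))) = stD ?D ?N tg (tab, own, P0, P)"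
      and P: "P \<subseteq> {..<?D}" and X: "rado.rows_of own P \<subseteq> {..<n}" "i \<in> rado.rows_of own P"
        "tightP n T Q (rado.rows_of own P)"
        "\<forall>Y \<subseteq> {..<n}. i \<in> Y \<longrightarrow> tightP n T Q Y \<longrightarrow> rado.rows_of own P \<subseteq> Y"
      unfolding Let_def tight_iff by blast
    have "{k. k < n \<and> (\<exists>p\<in>P. \<exists>t. own p = Some (k, t))} = rado.rows_of own P"
      using X(1) unfolding rado.rows_of_def[OF r] by auto
    then have "sem body_reach (?e i) = setD n (rado.rows_of own P)" using sem_body_reach[OF s P] by simp
    moreover have "least_tight n T Q i (rado.rows_of own P)" using X unfolding least_tight_def by blast
    ultimately show ?thesis using X(1) by blast
  next
    case False
    have "pos_ok ?D (tab, own, own_row ?D own i, own_row ?D own i)" unfolding own_row_def by auto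
    from micro_run[OF r D(1) this, where N = ?N and tg = tg and T = "?D * ?D * ?D"] obtain st' where
      st': "(micro ^^ (?D * ?D * ?D)) (stD ?D ?N tg (tab, own, own_row ?D own i, own_row ?D own i)) = stD ?D ?N tg st'" "pos_ok ?D st'" by blast
    obtain tab' own' P0 P where eq: "st' = (tab', own', P0, P)" by (cases st')
    have s: "sem searchT (Cell (Atom (real i)) (Cell ?to (?e i))) = stD ?D ?N tg (tab', own', P0, P)"
      unfolding toD_def fst_conv snd_conv sem_searchT st'(1) eq ..
    have "P \<subseteq> {..<?D}" using st'(2) unfolding eq by simp
    from sem_body_reach[OF s this] have "sem body_reach (?e i) = setD n {k. k < n \<and> (\<exists>p\<in>P. \<exists>t. own' p = Some (k, t))}" .
    then show ?thesis using False by (intro exI[of _ "{k. k < n \<and> (\<exists>p\<in>P. \<exists>t. own' p = Some (k, t))}"]) auto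
  qed
  then obtain R where R: "\<And>i. i < n \<Longrightarrow> R i \<subseteq> {..<n} \<and> sem body_reach (?e i) = setD n (R i) \<and>
     ({..<n} \<subseteq> rado.rows n own \<longrightarrow> least_tight n T Q i (R i))" by metis
  have "reachT = MapT (V 1) (V 1) body_reach" unfolding reachT_def body_reach_def ..
  have "sem reachT (Cell ?to (Cell (vecD n f) d)) = vecD n (\<lambda>i. sem body_reach (?e i))" unfolding \<open>reachT = _\<close> by simp
  also have "\<dots> = vecD n (\<lambda>i. setD n (R i))" using R by (intro vecD_cong) auto
  finally show ?thesis using R by blast
qed

lemma sem_aliveT:
  "sem aliveT (Cell a (Cell b (Cell (matD n F) (Cell (matD n A) d)))) = vecD n (\<lambda>k. bd (\<exists>p<n. A k p - F k p \<noteq> 0))"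
proof -
  have e: "(if P then Cell Null Null else Null) = bd P" for P by (simp add: bd_def)
  show ?thesis unfolding aliveT_def by (simp add: matD_def e cong: if_cong)
qed

lemma sem_sinkT:
  assumes "\<And>i. i < n \<Longrightarrow> R i \<subseteq> {..<n}"
  shows "sem sinkT (Cell (vecD n (\<lambda>k. bd (\<not> dead k))) (Cell (vecD n (\<lambda>i. setD n (R i))) d)) = vecD n (\<lambda>i. bd (snk R dead i))"
proof -
  show ?thesis unfolding sinkT_def
    by (simp add: setD_def cong: if_cong) (intro vecD_cong refl; auto simp: bd_def snk_def dest: subsetD[OF assms])
qed

lemma sem_to2T:
  assumes "0 < n"
  shows "sem to2T (Cell (vecD n (\<lambda>i. bd (b i))) (Cell a (Cell (vecD n (\<lambda>i. setD n (R i))) (Cell t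
     (Cell (matD n F) (Cell (matD n A) (Cell z (Cell (patD n T) d)))))))) =
    fold (\<lambda>i. rowstep (3 * n) (Atom (real i))) [0..<n]
      (toD (3 * n) (pN n T b) (\<lambda>a. 2 * n \<le> a) (pvec n A (ind R), rado.own0 n (2 * n)))"
proof -
  let ?d = "Cell (vecD n (\<lambda>i. bd (b i))) (Cell a (Cell (vecD n (\<lambda>i. setD n (R i))) (Cell t
     (Cell (matD n F) (Cell (matD n A) (Cell z (Cell (patD n T) d)))))))"
  have e: "((if P then 1 else (0::real)) = 0) = (\<not> P)" "(if P then Cell Null Null else Null) = bd P" 
     "(if \<not> P then Atom 0 else Atom 1) = Atom (if P then 1 else 0)" for P
    by (auto simp: bd_def)
  have "sem to2T ?d = sem phaseT (Cell (matD n A) (Cell (relD n (\<lambda>i j. (i, j) \<in> T))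
     (Cell (matD n (ind R)) ?d)))"
    unfolding to2T_def by (simp add: matD_def relD_def patD_def setD_def ind_def e cong: if_cong)
  then show ?thesis using sem_phaseT[OF assms] by simp
qed

lemma sem_outT:
  assumes "\<And>p k t. own p = Some (k, t) \<Longrightarrow> p < D"
  shows "sem outT (Cell (toD D N tg (tab, own)) (Cell (vecD n f) d)) = setD n {k. k < n \<and> \<not> (\<exists>p. own p = Some (k, False))}"
proof -
  have e: "(if own p = None then Null else if apply1 Head (oD D N (own p)) = Null then eqd (apply1 Head (apply1 Tail (oD D N (own p)))) (Atom (real k)) else Null)
    = bd (own p = Some (k, False))" for p k
    by (auto simp: oD_def bd_def split: option.splits)
  have "(\<forall>p<D. own p \<noteq> Some (k, False)) = (\<forall>p. own p \<noteq> Some (k, False))" for k using assms by blast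
  then show ?thesis unfolding outT_def
    by (simp add: toD_def ownD_def e setD_def bd_def[of "\<forall>p. _ p"] cong: if_cong)
qed


lemma greedy_hits:
  assumes R: "reach_family n R" and S0: "S0 \<subseteq> {..<n}" and b: "b = snk R dead"
    and S: "S = fold (greedy_step n R b) [0..<n] S0"
  shows "S0 \<subseteq> S" "S \<subseteq> {..<n}" "\<And>i. i < n \<Longrightarrow> b i \<Longrightarrow> R i \<inter> S \<noteq> {}"
    "card S \<le> card S0 + card {c \<in> sink_classes n R dead. c \<inter> S0 = {}}"
proof -
  have self: "i \<in> R i" if "i < n" for i using R that unfolding reach_family_def by blast
  have "k \<le> n \<Longrightarrow> \<exists>A. fold (greedy_step n R b) [0..<k] S0 = S0 \<union> A \<and> A \<subseteq> {..<k} \<and> (\<forall>i\<in>A. b i \<and> R i \<inter> S0 = {}) \<and> inj_on R A \<and>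
      (\<forall>i<k. b i \<longrightarrow> R i \<inter> (S0 \<union> A) \<noteq> {})" for k
  proof (induction k)
    case 0 show ?case by (intro exI[of _ "{}"]) simp
  next
    case (Suc k)
    then obtain A where A: "fold (greedy_step n R b) [0..<k] S0 = S0 \<union> A" "A \<subseteq> {..<k}" "\<forall>i\<in>A. b i \<and> R i \<inter> S0 = {}" "inj_on R A"
      "\<forall>i<k. b i \<longrightarrow> R i \<inter> (S0 \<union> A) \<noteq> {}" by auto
    have f: "fold (greedy_step n R b) [0..<Suc k] S0 = greedy_step n R b k (S0 \<union> A)" using A(1) by simp
    show ?case
    proof (cases "b k \<and> R k \<inter> (S0 \<union> A) = {}")
      case True
      have "R a \<noteq> R k" if "a \<in> A" for a
      proof
        assume "R a = R k"
        moreover have "a \<in> R a" using self that A(2) Suc.prems by auto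
        ultimately show False using True that by blast
      qed
      then have "inj_on R (insert k A)" using A(4) by auto
      moreover have "fold (greedy_step n R b) [0..<Suc k] S0 = S0 \<union> insert k A"
        unfolding f greedy_step_def using True by simp
      moreover have "\<forall>i<Suc k. b i \<longrightarrow> R i \<inter> (S0 \<union> insert k A) \<noteq> {}"
      proof (intro allI impI)
        fix i assume i: "i < Suc k" "b i"
        show "R i \<inter> (S0 \<union> insert k A) \<noteq> {}"
        proof (cases "i = k")
          case True then show ?thesis using self[of k] Suc.prems by auto
        next
          case False then have "R i \<inter> (S0 \<union> A) \<noteq> {}" using A(5) i by simp
          then show ?thesis by blast
        qed
      qed
      moreover have "insert k A \<subseteq> {..<Suc k}" using A(2) by auto
      moreover have "\<forall>i\<in>insert k A. b i \<and> R i \<inter> S0 = {}" using A(3) True by auto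
      ultimately show ?thesis by (intro exI[of _ "insert k A"] conjI)
    next
      case False
      have "fold (greedy_step n R b) [0..<Suc k] S0 = S0 \<union> A" unfolding f greedy_step_def using False by auto
      moreover have "\<forall>i<Suc k. b i \<longrightarrow> R i \<inter> (S0 \<union> A) \<noteq> {}" using A(5) False by (auto simp: less_Suc_eq)
      moreover have "A \<subseteq> {..<Suc k}" using A(2) by auto
      ultimately show ?thesis using A(3,4) by (intro exI[of _ A] conjI)
    qed
  qed
  from this[of n] obtain A where A: "S = S0 \<union> A" "A \<subseteq> {..<n}" "\<forall>i\<in>A. b i \<and> R i \<inter> S0 = {}" "inj_on R A"
      "\<forall>i<n. b i \<longrightarrow> R i \<inter> S \<noteq> {}" unfolding S by auto
  show "S0 \<subseteq> S" "S \<subseteq> {..<n}" "\<And>i. i < n \<Longrightarrow> b i \<Longrightarrow> R i \<inter> S \<noteq> {}" using A S0 by auto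
  have "card S \<le> card S0 + card A" unfolding A(1) by (rule card_Un_le)
  also have "card A = card (R ` A)" using A(4) by (simp add: card_image)
  also have "card (R ` A) \<le> card {c \<in> sink_classes n R dead. c \<inter> S0 = {}}"
  proof (rule card_mono)
    show "finite {c \<in> sink_classes n R dead. c \<inter> S0 = {}}" unfolding sink_classes_def by simp
    show "R ` A \<subseteq> {c \<in> sink_classes n R dead. c \<inter> S0 = {}}"
      using A(2,3) unfolding sink_classes_def b by auto
  qed
  finally show "card S \<le> card S0 + card {c \<in> sink_classes n R dead. c \<inter> S0 = {}}" by simp
qed

theorem mainT_correct:
  assumes wf: "wf_system sys" and n: "n = dim sys"
  shows "\<exists>S \<subseteq> states sys. sem mainT (system_data sys) = set_data n S \<and>
    (\<forall>m. admissible_matching sys m \<longrightarrow> optimal_input_set sys m S)"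
proof -
  have n0: "0 < n" using wf n unfolding wf_system_def by simp
  have D: "2 * n + n = 3 * n" "3 \<le> 3 * n" using n0 by simp_all
  have V: "states sys = {..<n}" unfolding states_def n by auto
  let ?F = "\<lambda>i j. QF sys $$ (i, j)" and ?A = "\<lambda>i j. QA sys $$ (i, j)"
  let ?Q = "\<lambda>i j. ?A i j - ?F i j" and ?T = "TA sys \<union> TF sys"
  let ?tg = "\<lambda>a. 2 * n \<le> a"
  define dead where "dead k \<longleftrightarrow> (\<forall>p<n. ?Q k p = 0)" for k
  let ?N = "pN n ?T (\<lambda>_. False)" and ?w = "pvec n ?Q (\<lambda>_ _. 0)"
  let ?e = "Cell (matD n ?F) (Cell (matD n ?A) (Cell (patD n (TF sys)) (Cell (patD n (TA sys)) Null)))"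
  obtain tab own where to1: "sem to1T ?e = toD (3 * n) ?N ?tg (tab, own)"
    and tb: "rado.tableau n (3 * n) n (2 * n) ?N ?w ?tg tab own"
    and max: "\<And>i. i < n \<Longrightarrow> i \<notin> rado.rows n own \<Longrightarrow> \<not> rado.matchable n (3 * n) (2 * n) ?N ?w (insert i (rado.rows n own))"
  proof -
    from greedy_phase[OF rado_0[of n ?Q] D order_refl, where N = ?N and tg = ?tg] obtain tab own where
      "fold (\<lambda>i. rowstep (3 * n) (Atom (real i))) [0..<n] (toD (3 * n) ?N ?tg (?w, rado.own0 n (2 * n))) = toD (3 * n) ?N ?tg (tab, own) \<and>
        rado.tableau n (3 * n) n (2 * n) ?N ?w ?tg tab own \<and> rado.rows n own \<subseteq> {..<n} \<and>
        (\<forall>i<n. i \<notin> rado.rows n own \<longrightarrow> \<not> rado.matchable n (3 * n) (2 * n) ?N ?w (insert i (rado.rows n own)))"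
      by (elim exE) (rule that)
    then show thesis using that unfolding sem_to1T[OF n0] by simp
  qed
  obtain R where R: "\<And>i. i < n \<Longrightarrow> R i \<subseteq> {..<n}"
    and reach: "sem reachT (Cell (toD (3 * n) ?N ?tg (tab, own)) ?e) = vecD n (\<lambda>i. setD n (R i))"
    and full: "{..<n} \<subseteq> rado.rows n own \<Longrightarrow> \<forall>i<n. least_tight n ?T ?Q i (R i)"
  proof -
    from sem_reachT[OF n0 tb, where f = "\<lambda>i. vecD n (\<lambda>j. Atom (?F i j))"
        and d = "Cell (matD n ?A) (Cell (patD n (TF sys)) (Cell (patD n (TA sys)) Null))"]
    obtain R where "(\<forall>i<n. R i \<subseteq> {..<n}) \<and>
       sem reachT (Cell (toD (3 * n) ?N ?tg (tab, own)) ?e) = vecD n (\<lambda>i. setD n (R i)) \<and>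
       ({..<n} \<subseteq> rado.rows n own \<longrightarrow> (\<forall>i<n. least_tight n ?T ?Q i (R i)))"
      unfolding matD_def[symmetric] by (elim exE) (rule that)
    note r = this
    show thesis
      by (rule that[OF _ r[THEN conjunct2, THEN conjunct1]])
        (rule r[THEN conjunct1, rule_format] r[THEN conjunct2, THEN conjunct2, THEN mp]; assumption)+
  qed
  let ?b = "snk R dead"
  let ?N2 = "pN n (TA sys) ?b" and ?w2 = "pvec n ?A (ind R)"
  obtain tab2 own2 where to2: "fold (\<lambda>i. rowstep (3 * n) (Atom (real i))) [0..<n] (toD (3 * n) ?N2 ?tg (?w2, rado.own0 n (2 * n))) =
      toD (3 * n) ?N2 ?tg (tab2, own2)"
    and tb2: "rado.tableau n (3 * n) (2 * n) (2 * n) ?N2 ?w2 ?tg tab2 own2"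
    and max2: "\<And>i. i < n \<Longrightarrow> i \<notin> rado.rows (2 * n) own2 \<Longrightarrow>
       \<not> rado.matchable n (3 * n) (2 * n) ?N2 ?w2 (insert i (rado.rows (2 * n) own2))"
  proof -
    from greedy_phase[OF rado_Y[of n ?A "ind R"] D order_refl, where N = ?N2 and tg = ?tg] obtain tab own where
      "fold (\<lambda>i. rowstep (3 * n) (Atom (real i))) [0..<n] (toD (3 * n) ?N2 ?tg (?w2, rado.own0 n (2 * n))) = toD (3 * n) ?N2 ?tg (tab, own) \<and>
        rado.tableau n (3 * n) (2 * n) (2 * n) ?N2 ?w2 ?tg tab own \<and> rado.rows (2 * n) own \<subseteq> {..<n} \<and>
        (\<forall>i<n. i \<notin> rado.rows (2 * n) own \<longrightarrow> \<not> rado.matchable n (3 * n) (2 * n) ?N2 ?w2 (insert i (rado.rows (2 * n) own)))"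
      by (elim exE) (rule that)
    then show thesis using that by simp
  qed
  define S0 where "S0 = {k. k < n \<and> \<not> (\<exists>p. own2 p = Some (k, False))}"
  define S where "S = fold (greedy_step n R ?b) [0..<n] S0"
  have own2: "p < 3 * n" if "own2 p = Some (k, t)" for p k t
    using rado.invD(5)[OF rado_Y tb2 that] by simp
  have alive: "vecD n (\<lambda>k. bd (\<exists>p<n. ?Q k p \<noteq> 0)) = vecD n (\<lambda>k. bd (\<not> dead k))" unfolding dead_def by simp
  have sinks: "sem sinkT (Cell (vecD n (\<lambda>k. bd (\<not> dead k))) (Cell (vecD n (\<lambda>i. setD n (R i))) d)) = vecD n (\<lambda>i. bd (?b i))" for d
    by (rule sem_sinkT) (rule R)
  have out: "sem outT (Cell (toD (3 * n) ?N2 ?tg (tab2, own2)) (Cell (vecD n f) d)) = setD n S0" for f d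
    unfolding S0_def by (rule sem_outT) (rule own2)
  have greedy: "sem greedyT (Cell (setD n S0) (Cell t (Cell (vecD n (\<lambda>i. bd (?b i))) (Cell a (Cell (vecD n (\<lambda>i. setD n (R i))) d))))) = setD n S" for t a d
    unfolding S_def by (rule sem_greedyT) (rule R)
  have "sem mainT ?e = vecD n (\<lambda>i. if i \<in> S then Atom 1 else Atom 0)"
    unfolding mainT_def sem.simps(8) to1 reach sem_aliveT alive sinks sem_to2T[OF n0] to2 out greedy
    by (simp add: setD_def cong: if_cong) (auto intro!: vecD_cong)
  also have "\<dots> = set_data n S" unfolding set_data_def vecD_def by (auto intro!: arg_cong[of _ _ list_data])
  finally have result: "sem mainT (system_data sys) = set_data n S" unfolding system_data_eq[OF wf n] .
  have S0n: "S0 \<subseteq> {..<n}" unfolding S0_def by auto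
  have Sn: "S \<subseteq> {..<n}"
  proof -
    have "k \<le> n \<Longrightarrow> fold (greedy_step n R ?b) [0..<k] S0 \<subseteq> {..<n}" for k
      by (induction k) (use S0n in \<open>auto simp: greedy_step_def\<close>)
    then show ?thesis unfolding S_def by blast
  qed
  have "optimal_input_set sys m S" if m: "admissible_matching sys m" for m
  proof -
    interpret M: matched_system sys m n by unfold_locales (use wf n m in auto)
    have MQ: "M.Q = ?Q" by (intro ext) (simp add: M.Q_def)
    have pat: "pattern sys = ?T" unfolding pattern_def ..
    have all: "rado.matchable n (3 * n) (2 * n) ?N ?w {..<n}"
      using M.all_matchable unfolding MQ pat matchable_iff .
    have rows: "{..<n} \<subseteq> rado.rows n own"
    proof
      fix i assume i: "i \<in> {..<n}"
      interpret P1: rado n "3 * n" n "2 * n" ?N ?w ?tg by (rule rado_0)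
      have "P1.rows own \<subseteq> {..<n}" using P1.invD(5)[OF tb] unfolding P1.rows_def by blast
      then have "insert i (P1.rows own) \<subseteq> {..<n}" using i by blast
      then have "P1.matchable (insert i (P1.rows own))" by (rule P1.matchable_subset[OF all])
      then show "i \<in> P1.rows own" using max[of i] i by blast
    qed
    have lt: "least_tight n ?T ?Q i (R i)" if "i < n" for i using full[OF rows] that by blast
    have RM: "R i = M.R i" if "i < n" for i
      using least_tight_unique[OF lt[OF that] M.R_least[OF that, unfolded MQ pat]] .
    have deadM: "M.dead = dead" by (intro ext) (simp add: M.dead_def dead_def MQ)
    have fam: "reach_family n R" by (rule least_tight_family[OF lt])
    have snkM: "snk M.R M.dead i \<longleftrightarrow> ?b i" if "i < n" for i
      unfolding snk_def deadM RM[OF that, symmetric] using RM R[OF that] by (metis lessThan_iff subsetD)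
    have val: "Y \<in> dual (states sys) (M1 sys) \<and> Y \<in> dual (states sys) (M2 sys m) \<longleftrightarrow> valid n (TA sys) ?A R dead Y" for Y
      unfolding dual_M1[OF wf n] M.dual_M2 valid_def matchA_def using RM snkM by auto
    interpret S2: second_phase n "TA sys" ?A R dead by unfold_locales (rule fam)
    note g = greedy_hits[OF fam S0n refl S_def]
    note opt = S2.optimum[OF tb2 max2 S0_def g]
    show ?thesis
      unfolding optimal_input_set_def is_arg_max_def V val[unfolded V]
      using Sn opt by (auto simp: not_less)
  qed
  then show ?thesis using result Sn V by blast
qed

theorem lemma3p10:
  shows "\<exists>(P :: program) (q :: nat poly). \<forall>sys :: descriptor_system.
    wf_system sys \<and> structurally_solvable sys \<longrightarrow>
    (\<exists>S t. runs P (system_data sys) (set_data (dim sys) S) t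
       \<and> t \<le> poly q (dim sys)
       \<and> S \<subseteq> states sys
       \<and> (\<forall>m. admissible_matching sys m \<longrightarrow> optimal_input_set sys m S))"
proof (rule exI[of _ "compile mainT"], rule exI[of _ "cost mainT + 2"], intro allI impI)
  fix sys :: descriptor_system
  assume "wf_system sys \<and> structurally_solvable sys"
  then have wf: "wf_system sys" by simp
  from mainT_correct[OF wf refl] obtain S where S: "S \<subseteq> states sys" "sem mainT (system_data sys) = set_data (dim sys) S"
    "\<forall>m. admissible_matching sys m \<longrightarrow> optimal_input_set sys m S" by blast
  have "has_ty (dim sys) (Pr mT (Pr mT (Pr mT (Pr mT Any)))) (system_data sys)"
    unfolding system_data_eq[OF wf refl] patD_def by (simp add: has_ty_matD)
  from compile_correct[OF ty_mainT this] obtain t where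
    "t \<le> poly (cost mainT + 2) (dim sys)" "runs (compile mainT) (system_data sys) (sem mainT (system_data sys)) t" by blast
  then show "\<exists>S t. runs (compile mainT) (system_data sys) (set_data (dim sys) S) t \<and> t \<le> poly (cost mainT + 2) (dim sys)
       \<and> S \<subseteq> states sys \<and> (\<forall>m. admissible_matching sys m \<longrightarrow> optimal_input_set sys m S)"
    using S by metis
qed

end
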